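(* Let $G=G_0*_HG_1$ be a nondegenerate free product with amalgamation, and suppose that $K_0$ or $K_1$ is amenable. Then $G$ is $C^*$-simple if and only if both $K_0$ and $K_1$ are trivial.
   Context: The amalgam is nondegenerate if $([G_0:H]-1)([G_1:H]-1)\ge2$. For $j=0,1$ and $k\ge1$ let $T_{j,k}=\{x_0\cdots x_{k-1}:x_i\in G_{i+j\bmod2}\setminus H\}$, $T_{j,0}=H$, $C_{j,k}=\bigcap_{g\in T_{j,k}}gHg^{-1}$, $K_j=\bigcap_{k\ge0}C_{j,k}$. A group is $C^*$-simple if its reduced group $C^*$-algebra is simple. *)

theory Defs
  imports "HOL-Algebra.Coset" "HOL-Algebra.Generated_Groups"
          "HOL-Analysis.Infinite_Sum" "HOL-Library.Extended_Nat"
begin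

definition alt_word :: "'a set \<Rightarrow> 'a set \<Rightarrow> 'a set \<Rightarrow> nat \<Rightarrow> 'a list \<Rightarrow> bool" where
  "alt_word G0 G1 H j xs \<longleftrightarrow>
     (\<forall>i < length xs. xs ! i \<in> (if even (i + j) then G0 else G1) - H)"

definition word_prod :: "('a, 'b) monoid_scheme \<Rightarrow> 'a list \<Rightarrow> 'a" where
  "word_prod G xs = foldr (\<lambda>x y. x \<otimes>\<^bsub>G\<^esub> y) xs \<one>\<^bsub>G\<^esub>"

text \<open>G is (internally) the free product of its subgroups G0 and G1 amalgamated
  over H: G0 \<inter> G1 = H, G is generated by G0 \<union> G1, and no nonempty reduced
  alternating word evaluates to the identity (normal form theorem).\<close>
definition is_amalgam :: "('a, 'b) monoid_scheme \<Rightarrow> 'a set \<Rightarrow> 'a set \<Rightarrow> 'a set \<Rightarrow> bool" where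
  "is_amalgam G G0 G1 H \<longleftrightarrow>
     group G \<and> subgroup G0 G \<and> subgroup G1 G \<and> G0 \<inter> G1 = H \<and>
     generate G (G0 \<union> G1) = carrier G \<and>
     (\<forall>j xs. j < 2 \<and> xs \<noteq> [] \<and> alt_word G0 G1 H j xs \<longrightarrow> word_prod G xs \<noteq> \<one>\<^bsub>G\<^esub>)"

definition sub_index :: "('a, 'b) monoid_scheme \<Rightarrow> 'a set \<Rightarrow> 'a set \<Rightarrow> enat" where
  "sub_index G K H =
     (let C = {H #>\<^bsub>G\<^esub> g | g. g \<in> K} in if finite C then enat (card C) else \<infinity>)"

definition nondegenerate :: "('a, 'b) monoid_scheme \<Rightarrow> 'a set \<Rightarrow> 'a set \<Rightarrow> 'a set \<Rightarrow> bool" where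
  "nondegenerate G G0 G1 H \<longleftrightarrow>
     (sub_index G G0 H - 1) * (sub_index G G1 H - 1) \<ge> 2"

definition T_set :: "('a, 'b) monoid_scheme \<Rightarrow> 'a set \<Rightarrow> 'a set \<Rightarrow> 'a set \<Rightarrow> nat \<Rightarrow> nat \<Rightarrow> 'a set" where
  "T_set G G0 G1 H j k =
     (if k = 0 then H
      else {word_prod G xs | xs. length xs = k \<and> alt_word G0 G1 H j xs})"

definition C_set :: "('a, 'b) monoid_scheme \<Rightarrow> 'a set \<Rightarrow> 'a set \<Rightarrow> 'a set \<Rightarrow> nat \<Rightarrow> nat \<Rightarrow> 'a set" where
  "C_set G G0 G1 H j k =
     (\<Inter>g \<in> T_set G G0 G1 H j k. (g <#\<^bsub>G\<^esub> H) #>\<^bsub>G\<^esub> inv\<^bsub>G\<^esub> g)"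

definition K_set :: "('a, 'b) monoid_scheme \<Rightarrow> 'a set \<Rightarrow> 'a set \<Rightarrow> 'a set \<Rightarrow> nat \<Rightarrow> 'a set" where
  "K_set G G0 G1 H j = (\<Inter>k. C_set G G0 G1 H j k)"

definition amenable_subgroup :: "('a, 'b) monoid_scheme \<Rightarrow> 'a set \<Rightarrow> bool" where
  "amenable_subgroup G K \<longleftrightarrow>
     (\<exists>m :: 'a set \<Rightarrow> real.
        m K = 1 \<and>
        (\<forall>A. A \<subseteq> K \<longrightarrow> m A \<ge> 0) \<and>
        (\<forall>A B. A \<subseteq> K \<and> B \<subseteq> K \<and> A \<inter> B = {} \<longrightarrow> m (A \<union> B) = m A + m B) \<and>
        (\<forall>g A. g \<in> K \<and> A \<subseteq> K \<longrightarrow> m (g <#\<^bsub>G\<^esub> A) = m A))"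

definition l2 :: "('a, 'b) monoid_scheme \<Rightarrow> ('a \<Rightarrow> complex) set" where
  "l2 G = {f. (\<forall>x. x \<notin> carrier G \<longrightarrow> f x = 0) \<and>
              (\<lambda>x. (cmod (f x))\<^sup>2) summable_on carrier G}"

definition l2norm :: "('a, 'b) monoid_scheme \<Rightarrow> ('a \<Rightarrow> complex) \<Rightarrow> real" where
  "l2norm G f = sqrt (\<Sum>\<^sub>\<infinity>x\<in>carrier G. (cmod (f x))\<^sup>2)"

type_synonym 'a op = "('a \<Rightarrow> complex) \<Rightarrow> ('a \<Rightarrow> complex)"

text \<open>Bounded linear operators on l2(G); normalised to be 0 off l2(G).\<close>
definition bounded_op :: "('a, 'b) monoid_scheme \<Rightarrow> 'a op \<Rightarrow> bool" where
  "bounded_op G T \<longleftrightarrow>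
     (\<forall>f \<in> l2 G. T f \<in> l2 G) \<and>
     (\<forall>f. f \<notin> l2 G \<longrightarrow> T f = (\<lambda>_. 0)) \<and>
     (\<forall>f \<in> l2 G. \<forall>g \<in> l2 G. T (\<lambda>x. f x + g x) = (\<lambda>x. T f x + T g x)) \<and>
     (\<forall>f \<in> l2 G. \<forall>c. T (\<lambda>x. c * f x) = (\<lambda>x. c * T f x)) \<and>
     (\<exists>B. \<forall>f \<in> l2 G. l2norm G (T f) \<le> B * l2norm G f)"

definition opnorm :: "('a, 'b) monoid_scheme \<Rightarrow> 'a op \<Rightarrow> real" where
  "opnorm G T = Sup {l2norm G (T f) | f. f \<in> l2 G \<and> l2norm G f \<le> 1}"

definition op_add :: "'a op \<Rightarrow> 'a op \<Rightarrow> 'a op" where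
  "op_add S T = (\<lambda>f x. S f x + T f x)"

definition op_diff :: "'a op \<Rightarrow> 'a op \<Rightarrow> 'a op" where
  "op_diff S T = (\<lambda>f x. S f x - T f x)"

definition op_scale :: "complex \<Rightarrow> 'a op \<Rightarrow> 'a op" where
  "op_scale c T = (\<lambda>f x. c * T f x)"

definition op_zero :: "'a op" where
  "op_zero = (\<lambda>f x. 0)"

definition left_reg :: "('a, 'b) monoid_scheme \<Rightarrow> 'a \<Rightarrow> 'a op" where
  "left_reg G g = (\<lambda>f. if f \<in> l2 G then
                        (\<lambda>x. if x \<in> carrier G then f (inv\<^bsub>G\<^esub> g \<otimes>\<^bsub>G\<^esub> x) else 0)
                      else (\<lambda>_. 0))"

definition group_algebra_ops :: "('a, 'b) monoid_scheme \<Rightarrow> 'a op set" where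
  "group_algebra_ops G =
     {(\<lambda>f x. \<Sum>g\<in>S. c g * left_reg G g f x) | S c. finite S \<and> S \<subseteq> carrier G}"

definition reduced_cstar :: "('a, 'b) monoid_scheme \<Rightarrow> 'a op set" where
  "reduced_cstar G =
     {T. bounded_op G T \<and>
         (\<forall>e>0. \<exists>A \<in> group_algebra_ops G. opnorm G (op_diff T A) < e)}"

definition closed_ideal :: "('a, 'b) monoid_scheme \<Rightarrow> 'a op set \<Rightarrow> 'a op set \<Rightarrow> bool" where
  "closed_ideal G A I \<longleftrightarrow>
     I \<subseteq> A \<and> op_zero \<in> I \<and>
     (\<forall>S\<in>I. \<forall>T\<in>I. op_add S T \<in> I) \<and>
     (\<forall>c. \<forall>S\<in>I. op_scale c S \<in> I) \<and>
     (\<forall>S\<in>I. \<forall>T\<in>A. S \<circ> T \<in> I \<and> T \<circ> S \<in> I) \<and>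
     (\<forall>T\<in>A. (\<forall>e>0. \<exists>S\<in>I. opnorm G (op_diff T S) < e) \<longrightarrow> T \<in> I)"

definition cstar_simple :: "('a, 'b) monoid_scheme \<Rightarrow> bool" where
  "cstar_simple G \<longleftrightarrow>
     (\<forall>I. closed_ideal G (reduced_cstar G) I \<longrightarrow>
          I = {op_zero} \<or> I = reduced_cstar G)"

end

theory Submission
  imports Defs "HOL-Analysis.L2_Norm"
begin

text \<open>
  The group acts on its Bass--Serre tree, whose edges are the cosets of \<open>H\<close>, and \<open>K\<^sub>0\<close>, \<open>K\<^sub>1\<close> are
  the pointwise stabilisers of the two half-trees at the base edge. A half-tree on one side of an edge
  contains translates of both half-trees, so the two stabilisers are trivial simultaneously.

  If both are trivial, then no nontrivial element fixes a half-tree, and any finite set of nontrivial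
  elements moves a common half-tree off itself. Its complement has infinitely many pairwise disjoint
  translates, which is Powers' averaging property: conjugates of a group algebra element average to
  a scalar, and so a nonzero closed ideal contains the identity.

  If both are nontrivial, let \<open>L\<close> be the group of elements that fix a neighbourhood of a given end
  of the tree. It is an increasing union of conjugates of \<open>K\<^sub>j\<close>, so by the Foelner condition the
  quasi-regular representation on \<open>G/L\<close> is weakly contained in the regular one. Every end lies in one of
  the two half-trees, so that representation kills \<open>(1 - h)(1 - k)\<close> for \<open>h \<in> K\<^sub>0\<close>, \<open>k \<in> K\<^sub>1\<close>, and its
  kernel is a proper nonzero ideal.
\<close>

section \<open>Hall's theorem for infinite families and the Foelner condition\<close>

text \<open>Amenability is given as a finitely additive mean, while the comparison of
  representations needs almost invariant finite sets. Hall's theorem bridges the gap: failure of the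
  Foelner condition becomes a paradoxical decomposition.

  No second Hilbert space is built. The quasi-regular representation on G/L enters only through its
  matrix coefficients, evaluated on finite formal sums; the ideal is the norm closure of the sums on
  which all of them vanish. Since only one of the two stabilisers is assumed amenable, the end is
  the limit of the powers of a word \<open>a\<close> of length two that begins in the factor of that
  index, so all half-trees shrinking to the end are translates of the amenable side.

  Nondegeneracy supplies a third coset of \<open>H\<close> in one factor. It turns a word of even
  length, whose ends lie in different factors, into a conjugate of odd length that exchanges sides
  of an edge, and it gives two maps that play ping-pong. Words are tracked by parity:
  \<open>i\<close> gives the first factor, and \<open>i\<close> plus the length gives the factor
  that may follow.\<close>

definition hall_condition :: "'i set \<Rightarrow> ('i \<times> 'y) set \<Rightarrow> bool" where
  "hall_condition I R \<longleftrightarrow> (\<forall>J. finite J \<and> J \<subseteq> I \<longrightarrow> card J \<le> card (R `` J))"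

lemma hall_conditionD:
  "hall_condition I R \<Longrightarrow> finite J \<Longrightarrow> J \<subseteq> I \<Longrightarrow> card J \<le> card (R `` J)"
  by (simp add: hall_condition_def)

text \<open>Rado's argument: deleting either of two values of \<open>i\<close> would give two tight families, and
  submodularity of the cardinality of the image contradicts the condition on their union with \<open>i\<close>.\<close>

lemma hall_minimal_single_valued:
  assumes hall: "hall_condition I R" and fin: "\<And>i. i \<in> I \<Longrightarrow> finite (R `` {i})"
    and min: "\<And>p. p \<in> R \<Longrightarrow> \<not> hall_condition I (R - {p})"
    and i: "i \<in> I" and y: "(i, y1) \<in> R" "(i, y2) \<in> R"
  shows "y1 = y2"
proof (rule ccontr)
  assume neq: "y1 \<noteq> y2"
  have finJ: "finite (R `` J)" if "finite J" "J \<subseteq> I" for J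
  proof -
    have "R `` J = (\<Union>i\<in>J. R `` {i})" by auto
    then show ?thesis using that fin by auto
  qed
  \<comment> \<open>By minimality the removal of \<open>(i, y)\<close> violates the condition on
    some \<open>J\<close>, which must contain \<open>i\<close>. Dropping \<open>i\<close> from
    \<open>J\<close> lowers the number of indices by one, so the violated inequality becomes the
    stated bound.\<close>
  have ex: "\<exists>K. finite K \<and> K \<subseteq> I \<and> i \<notin> K \<and> card (R `` K \<union> (R `` {i} - {y})) \<le> card K"
    if yR: "(i, y) \<in> R" for y
  proof -
    obtain J where J: "finite J" "J \<subseteq> I" "card ((R - {(i,y)}) `` J) < card J"
      using min[OF yR] unfolding hall_condition_def by (auto simp: not_le)
    have "i \<in> J"
    proof (rule ccontr)
      assume "i \<notin> J"
      then have "(R - {(i,y)}) `` J = R `` J" by auto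
      then show False using J hall unfolding hall_condition_def by (metis not_le)
    qed
    define K where "K = J - {i}"
    have "card J = Suc (card K)" using J(1) \<open>i \<in> J\<close> unfolding K_def by (metis card_Suc_Diff1)
    moreover have "R `` K \<union> (R `` {i} - {y}) = (R - {(i,y)}) `` J"
      using \<open>i \<in> J\<close> unfolding K_def by auto
    ultimately show ?thesis using J by (intro exI[of _ K]) (auto simp: K_def)
  qed
  obtain K1 where K1: "finite K1" "K1 \<subseteq> I" "i \<notin> K1" "card (R `` K1 \<union> (R `` {i} - {y1})) \<le> card K1"
    using ex[OF y(1)] by blast
  obtain K2 where K2: "finite K2" "K2 \<subseteq> I" "i \<notin> K2" "card (R `` K2 \<union> (R `` {i} - {y2})) \<le> card K2"
    using ex[OF y(2)] by blast
  define A1 where "A1 = R `` K1 \<union> (R `` {i} - {y1})"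
  define A2 where "A2 = R `` K2 \<union> (R `` {i} - {y2})"
  have finA: "finite A1" "finite A2" unfolding A1_def A2_def using finJ K1 K2 fin i by auto
  have "card (insert i (K1 \<union> K2)) \<le> card (R `` insert i (K1 \<union> K2))"
    using K1 K2 i by (intro hall_conditionD[OF hall]) auto
  \<comment> \<open>Each of \<open>y1\<close> and \<open>y2\<close> is dropped from only one of the
    two sets, so their union regains the full image of \<open>i\<close>.\<close>
  also have "R `` insert i (K1 \<union> K2) = A1 \<union> A2"
    unfolding A1_def A2_def using neq by auto
  finally have 1: "Suc (card (K1 \<union> K2)) \<le> card (A1 \<union> A2)" using K1 K2 by simp
  have "card (K1 \<inter> K2) \<le> card (R `` (K1 \<inter> K2))"
    using K1 by (intro hall_conditionD[OF hall]) auto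
  also have "\<dots> \<le> card (A1 \<inter> A2)"
    using finA by (intro card_mono) (auto simp: A1_def A2_def)
  finally have 2: "card (K1 \<inter> K2) \<le> card (A1 \<inter> A2)" .
  show False
    using 1 2 card_Un_Int[OF finA] card_Un_Int[OF K1(1) K2(1)] K1(4) K2(4)
    unfolding A1_def A2_def by linarith
qed

text \<open>Zorn's lemma is applied to the sets of deleted pairs that keep Hall's condition. Local
  finiteness makes this class closed under unions of chains, since only finitely many pairs lie over
  a finite \<open>J\<close>; a maximal deletion leaves the graph of an injection.\<close>

lemma hall_infinite:
  assumes hall: "hall_condition I E" and fin: "\<And>i. i \<in> I \<Longrightarrow> finite (E `` {i})"
  obtains f where "inj_on f I" "\<And>i. i \<in> I \<Longrightarrow> (i, f i) \<in> E"
proof -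
  have finJ: "finite (E \<inter> J \<times> UNIV)" if "finite J" "J \<subseteq> I" for J
  proof -
    have "E \<inter> J \<times> UNIV = (\<Union>i\<in>J. Pair i ` (E `` {i}))" by auto
    then show ?thesis using that fin by auto
  qed
  define \<A> where "\<A> = {S. hall_condition I (E - S)}"
  have "\<exists>M\<in>\<A>. \<forall>X\<in>\<A>. M \<subseteq> X \<longrightarrow> X = M"
  proof (rule subset_Zorn')
    fix C assume C: "subset.chain \<A> C"
    show "\<Union>C \<in> \<A>"
    proof (cases "C = {}")
      case True
      then show ?thesis using hall by (simp add: \<A>_def)
    next
      case False
      have "card J \<le> card ((E - \<Union>C) `` J)" if J: "finite J" "J \<subseteq> I" for J
      proof -
        have "finite (E \<inter> J \<times> UNIV \<inter> \<Union>C)" using finJ[OF J] by blast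
        then obtain S where S: "S \<in> C" "E \<inter> J \<times> UNIV \<inter> \<Union>C \<subseteq> S"
          using finite_subset_Union_chain[OF _ _ False C] by (metis inf_le2)
        have "(E - \<Union>C) `` J = (E - S) `` J" using S by auto
        moreover have "S \<in> \<A>" using S C by (auto simp: subset.chain_def)
        ultimately show ?thesis using J by (auto simp: \<A>_def hall_condition_def)
      qed
      then show ?thesis by (auto simp: \<A>_def hall_condition_def)
    qed
  qed
  then obtain M where M: "M \<in> \<A>" "\<And>X. X \<in> \<A> \<Longrightarrow> M \<subseteq> X \<Longrightarrow> X = M" by blast
  define R where "R = E - M"
  have hR: "hall_condition I R" using M by (simp add: R_def \<A>_def)
  have min: "\<not> hall_condition I (R - {p})" if "p \<in> R" for p
  proof
    assume "hall_condition I (R - {p})"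
    moreover have "R - {p} = E - insert p M" unfolding R_def by blast
    ultimately have "insert p M \<in> \<A>" by (simp add: \<A>_def)
    then have "insert p M = M" using M(2) by blast
    then show False using that unfolding R_def by blast
  qed
  have finR: "finite (R `` {i})" if "i \<in> I" for i
    using fin[OF that] by (rule finite_subset[rotated]) (auto simp: R_def)
  have sv: "y1 = y2" if "i \<in> I" "(i, y1) \<in> R" "(i, y2) \<in> R" for i y1 y2
    using hall_minimal_single_valued[OF hR finR min that] by blast
  have "\<exists>y. (i, y) \<in> R" if "i \<in> I" for i
  proof -
    have "card {i} \<le> card (R `` {i})" using that by (intro hall_conditionD[OF hR]) auto
    then have "R `` {i} \<noteq> {}" by auto
    then show ?thesis by auto
  qed
  then obtain f where f: "\<And>i. i \<in> I \<Longrightarrow> (i, f i) \<in> R" by metis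
  have "inj_on f I"
  proof (rule inj_onI, rule ccontr)
    fix i j assume ij: "i \<in> I" "j \<in> I" "f i = f j" "i \<noteq> j"
    have "R `` {i} = {f i}" "R `` {j} = {f j}" using ij f sv by blast+
    then have "R `` {i, j} = {f i}" using ij by auto
    moreover have "card {i, j} \<le> card (R `` {i, j})"
      using ij by (intro hall_conditionD[OF hR]) auto
    ultimately show False using ij by simp
  qed
  moreover have "\<And>i. i \<in> I \<Longrightarrow> (i, f i) \<in> E" using f by (auto simp: R_def)
  ultimately show ?thesis using that by blast
qed

section \<open>Invariant means and Foelner sets\<close>

lemma finite_additivity_UN:
  fixes m :: "'a set \<Rightarrow> real"
  assumes add: "\<And>A B. A \<subseteq> K \<Longrightarrow> B \<subseteq> K \<Longrightarrow> A \<inter> B = {} \<Longrightarrow> m (A \<union> B) = m A + m B"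
    and fin: "finite I" and sub: "\<And>i. i \<in> I \<Longrightarrow> A i \<subseteq> K"
    and disj: "\<And>i j. i \<in> I \<Longrightarrow> j \<in> I \<Longrightarrow> i \<noteq> j \<Longrightarrow> A i \<inter> A j = {}"
  shows "m (\<Union>i\<in>I. A i) = (\<Sum>i\<in>I. m (A i))"
  using fin sub disj
proof (induction I)
  case empty
  have "m ({} \<union> {}) = m {} + m {}" by (rule add) auto
  then show ?case by simp
next
  case (insert i I)
  have "m (A i \<union> (\<Union>i\<in>I. A i)) = m (A i) + m (\<Union>i\<in>I. A i)"
  proof (rule add)
    show "A i \<inter> (\<Union>i\<in>I. A i) = {}" using insert.prems(2)[of i] insert.hyps by auto
  qed (use insert.prems in auto)
  then show ?case using insert by simp
qed

context group
begin

text \<open>If every finite \<open>A\<close> were at least doubled by \<open>F\<close>, Hall's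
  theorem would inject two copies of \<open>K\<close> into \<open>K\<close>, moving each point by an
  element of \<open>F\<close>. Cutting the copies according to the multiplier used gives a
  paradoxical decomposition, which an invariant mean of total mass 1 forbids.\<close>

lemma amenable_no_doubling:
  assumes K: "subgroup K G" and am: "amenable_subgroup G K"
    and F: "finite F" "F \<subseteq> K"
  shows "\<exists>A. finite A \<and> A \<subseteq> K \<and> card (F <#> A) < 2 * card A"
proof (rule ccontr)
  assume "\<not> ?thesis"
  then have dbl: "2 * card A \<le> card (F <#> A)" if "finite A" "A \<subseteq> K" for A
    using that by (meson not_le)
  obtain m :: "'a set \<Rightarrow> real" where m: "m K = 1" "\<And>A. A \<subseteq> K \<Longrightarrow> m A \<ge> 0"
    "\<And>A B. A \<subseteq> K \<Longrightarrow> B \<subseteq> K \<Longrightarrow> A \<inter> B = {} \<Longrightarrow> m (A \<union> B) = m A + m B"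
    "\<And>g A. g \<in> K \<Longrightarrow> A \<subseteq> K \<Longrightarrow> m (g <# A) = m A"
    using am unfolding amenable_subgroup_def by metis
  have Kc: "x \<in> carrier G" if "x \<in> K" for x using that K subgroup.mem_carrier by metis
  \<comment> \<open>The boolean labels the two copies of a point; each copy may be matched with any
    translate of the point by \<open>F\<close>.\<close>
  define E where "E = {((x::'a, b::bool), t \<otimes> x) | x b t. x \<in> K \<and> t \<in> F}"
  define I where "I = K \<times> (UNIV :: bool set)"
  have "hall_condition I E"
    unfolding hall_condition_def
  proof (intro allI impI)
    fix J assume J: "finite J \<and> J \<subseteq> I"
    define A where "A = fst ` J"
    have A: "finite A" "A \<subseteq> K" using J by (auto simp: A_def I_def)
    have "J \<subseteq> A \<times> UNIV" unfolding A_def by force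
    then have "card J \<le> card (A \<times> (UNIV :: bool set))" using A by (intro card_mono) auto
    also have "\<dots> = 2 * card A" by (simp add: card_cartesian_product)
    also have "\<dots> \<le> card (F <#> A)" using dbl A by blast
    also have "F <#> A = E `` J" using A
      by (force simp: E_def A_def set_mult_def Image_def)
    finally show "card J \<le> card (E `` J)" .
  qed
  moreover have "finite (E `` {i})" if "i \<in> I" for i
  proof -
    have "E `` {i} \<subseteq> (\<lambda>t. t \<otimes> fst i) ` F" by (auto simp: E_def)
    then show ?thesis using F finite_surj by blast
  qed
  ultimately obtain f where f: "inj_on f I" "\<And>i. i \<in> I \<Longrightarrow> (i, f i) \<in> E"
    using hall_infinite by metis
  \<comment> \<open>The piece of copy \<open>b\<close> that the matching moves by \<open>t\<close>.
    For fixed \<open>b\<close> these pieces partition \<open>K\<close>, while all their translates,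
    over both copies, are disjoint by injectivity of \<open>f\<close>.\<close>
  define B where "B = (\<lambda>(t, b). {x \<in> K. f (x, b) = t \<otimes> x})"
  have B: "B p \<subseteq> K" for p by (auto simp: B_def split: prod.splits)
  have Bun: "(\<Union>t\<in>F. B (t, b)) = K" for b
  proof
    show "K \<subseteq> (\<Union>t\<in>F. B (t, b))"
    proof
      fix x assume "x \<in> K"
      then have "((x, b), f (x, b)) \<in> E" using f(2) by (auto simp: I_def)
      then show "x \<in> (\<Union>t\<in>F. B (t, b))" by (auto simp: E_def B_def)
    qed
  qed (use B in auto)
  have half: "(\<Sum>t\<in>F. m (B (t, b))) = 1" for b
  proof -
    have "m (\<Union>t\<in>F. B (t, b)) = (\<Sum>t\<in>F. m (B (t, b)))"
    proof (rule finite_additivity_UN[where K = K])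
      fix t t' assume t: "t \<in> F" "t' \<in> F" "t \<noteq> t'"
      have "t = t'" if "x \<in> B (t, b)" "x \<in> B (t', b)" for x
      proof -
        have "x \<in> K" "t \<otimes> x = t' \<otimes> x" using that by (auto simp: B_def)
        then show ?thesis using t F Kc right_cancel[of x t t'] by blast
      qed
      then show "B (t, b) \<inter> B (t', b) = {}" using t by blast
    qed (use m F B in auto)
    then show ?thesis using Bun m by simp
  qed
  have sub: "t <# B (t, b) \<subseteq> K" if "t \<in> F" for t b
  proof
    fix y assume "y \<in> t <# B (t, b)"
    then obtain x where "x \<in> B (t, b)" "y = t \<otimes> x" by (auto simp: l_coset_def)
    then show "y \<in> K" using subgroup.m_closed[OF K] that F B by blast
  qed
  define P where "P = F \<times> (UNIV :: bool set)"
  have "m (\<Union>p\<in>P. fst p <# B p) = (\<Sum>p\<in>P. m (fst p <# B p))"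
  proof (rule finite_additivity_UN[where K = K])
    fix p q assume pq: "p \<in> P" "q \<in> P" "p \<noteq> q"
    obtain t b t' b' where [simp]: "p = (t, b)" "q = (t', b')" by (cases p, cases q) auto
    show "(fst p <# B p) \<inter> (fst q <# B q) = {}"
    proof (rule ccontr)
      assume "\<not> ?thesis"
      then obtain x x' where x: "x \<in> B p" "x' \<in> B q" "t \<otimes> x = t' \<otimes> x'"
        by (auto simp: l_coset_def)
      then have "f (x, b) = f (x', b')" and K': "x \<in> K" "x' \<in> K" by (auto simp: B_def)
      then have "x = x'" "b = b'" using f(1) by (auto simp: inj_on_def I_def)
      moreover have "t = t'"
        using x(3) K' pq F Kc \<open>x = x'\<close> right_cancel[of x t t'] by (auto simp: P_def)
      ultimately show False using pq by simp
    qed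
  next
    show "fst p <# B p \<subseteq> K" if "p \<in> P" for p
      using sub[of "fst p" "snd p"] that by (auto simp: P_def)
  qed (use m(3) F in \<open>auto simp: P_def\<close>)
  also have "\<dots> = (\<Sum>p\<in>P. m (B p))"
    using m(4) B F by (intro sum.cong) (auto simp: P_def)
  also have "\<dots> = (\<Sum>t\<in>F. \<Sum>b\<in>UNIV. m (B (t, b)))"
    unfolding P_def by (simp add: sum.cartesian_product)
  also have "\<dots> = (\<Sum>b\<in>UNIV. \<Sum>t\<in>F. m (B (t, b)))" by (rule sum.swap)
  also have "\<dots> = 2" by (simp add: half)
  finally have two: "m (\<Union>p\<in>P. fst p <# B p) = 2" .
  define U where "U = (\<Union>p\<in>P. fst p <# B p)"
  have U: "U \<subseteq> K" unfolding U_def P_def using sub by (intro UN_least) (metis mem_Times_iff prod.collapse)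
  have "m (U \<union> (K - U)) = m U + m (K - U)" using U by (intro m(3)) auto
  moreover have "U \<union> (K - U) = K" using U by auto
  ultimately show False using two m(1) m(2)[of "K - U"] unfolding U_def by auto
qed

text \<open>Without such a set, every finite \<open>A\<close> would grow by a factor
  \<open>1 + e\<close> when its translates by \<open>S\<close> are added. Iterating until
  \<open>(1 + e) ^ n > 2\<close> produces one finite set of multipliers that doubles every finite
  \<open>A\<close>, contrary to \<open>amenable_no_doubling\<close>.\<close>

lemma amenable_folner:
  assumes K: "subgroup K G" and am: "amenable_subgroup G K"
    and S: "finite S" "S \<subseteq> K" and e: "e > 0"
  shows "\<exists>A. finite A \<and> A \<noteq> {} \<and> A \<subseteq> K \<and> (\<forall>s\<in>S. real (card (A \<inter> (s <# A))) \<ge> (1 - e) * real (card A))"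
proof (rule ccontr)
  assume neg: "\<not> ?thesis"
  have Kc: "x \<in> carrier G" if "x \<in> K" for x using that K subgroup.mem_carrier by metis
  define grow where "grow = (\<lambda>A. A \<union> (\<Union>s\<in>S. s <# A))"
  \<comment> \<open>Growth by left translates commutes with multiplication on the right, so
    \<open>F n <#> A\<close> is the n-th stage of growth started at \<open>A\<close>: the
    multipliers do not depend on \<open>A\<close>.\<close>
  define F where "F = (\<lambda>n. (grow ^^ n) {\<one>})"
  have growK: "finite (grow A) \<and> grow A \<subseteq> K" if "finite A" "A \<subseteq> K" for A
    using that S subgroup.m_closed[OF K] by (auto simp: grow_def l_coset_def)
  have FK: "finite (F n) \<and> F n \<subseteq> K" for n
    by (induction n) (use growK subgroup.one_closed[OF K] in \<open>auto simp: F_def\<close>)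
  have step: "real (card (grow A)) \<ge> (1 + e) * real (card A)" if A: "finite A" "A \<subseteq> K" for A
  proof (cases "A = {}")
    case False
    then obtain s where s: "s \<in> S" "real (card (A \<inter> (s <# A))) < (1 - e) * real (card A)"
      using neg A by (meson not_le)
    have "s <# A = (\<lambda>x. s \<otimes> x) ` A" by (auto simp: l_coset_def)
    moreover have "inj_on (\<lambda>x. s \<otimes> x) A"
      using s S A Kc by (intro inj_onI) (metis Units_eq Units_l_cancel subsetD)
    ultimately have cs: "card (s <# A) = card A" "finite (s <# A)" using A by (auto simp: card_image)
    have "card (A \<union> (s <# A)) \<le> card (grow A)"
      using growK[OF A] s by (intro card_mono) (auto simp: grow_def)
    moreover have "card (A \<union> (s <# A)) + card (A \<inter> (s <# A)) = 2 * card A"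
      using card_Un_Int[OF A(1) cs(2)] cs by simp
    ultimately have "real (card (grow A)) \<ge> 2 * real (card A) - real (card (A \<inter> (s <# A)))"
      by linarith
    then show ?thesis using s by (simp add: algebra_simps)
  qed (simp)
  have Fmul: "F n <#> A = (grow ^^ n) A" if A: "A \<subseteq> K" for A n
  proof (induction n)
    case 0
    have "\<one> \<otimes> a = a" if "a \<in> A" for a using that A Kc by auto
    then show ?case by (auto simp: F_def set_mult_def)
  next
    case (Suc n)
    have "grow B <#> A = grow (B <#> A)" if B: "B \<subseteq> K" for B
    proof -
      have "s \<otimes> b \<otimes> a = s \<otimes> (b \<otimes> a)" if "s \<in> S" "b \<in> B" "a \<in> A" for s b a
        using that A B S Kc by (intro m_assoc) auto
      then have "(s <# B) <#> A = s <# (B <#> A)" if "s \<in> S" for s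
        using that by (force simp: set_mult_def l_coset_def)
      moreover have "grow B <#> A = (B <#> A) \<union> (\<Union>s\<in>S. (s <# B) <#> A)"
        unfolding grow_def set_mult_def by blast
      ultimately show ?thesis by (simp add: grow_def)
    qed
    then show ?case using Suc FK by (simp add: F_def)
  qed
  have iter: "finite ((grow ^^ n) A) \<and> (grow ^^ n) A \<subseteq> K \<and> real (card ((grow ^^ n) A)) \<ge> (1 + e) ^ n * real (card A)"
    if A: "finite A" "A \<subseteq> K" for A n
  proof (induction n)
    case (Suc n)
    let ?B = "(grow ^^ n) A"
    have "(1 + e) * ((1 + e) ^ n * real (card A)) \<le> (1 + e) * real (card ?B)"
      using Suc.IH e by (intro mult_left_mono) linarith+
    also have "\<dots> \<le> real (card (grow ?B))" using step[of ?B] Suc.IH by linarith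
    finally show ?case using growK[of ?B] Suc.IH by (simp add: mult.assoc)
  qed (use A in auto)
  obtain n where n: "(1 + e) ^ n > 2" using real_arch_pow[of "1 + e" 2] e by auto
  obtain A where A: "finite A" "A \<subseteq> K" "card (F n <#> A) < 2 * card A"
    using amenable_no_doubling[OF K am conjunct1[OF FK] conjunct2[OF FK]] by blast
  have "2 * real (card A) \<le> (1 + e) ^ n * real (card A)" using n by (intro mult_right_mono) auto
  also have "\<dots> \<le> real (card (F n <#> A))" using iter[OF A(1,2), of n] Fmul[OF A(2)] by simp
  finally show False using A(3) by linarith
qed

end

section \<open>Operators on l2 of a group\<close>

context group
begin

section \<open>Square-summable functions and their translates\<close>

lemma l2_zero_outside: "f \<in> l2 G \<Longrightarrow> x \<notin> carrier G \<Longrightarrow> f x = 0"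
  by (simp add: l2_def)

text \<open>Bounds over finite sets yield both summability and the norm estimate; this transfers the
  inequalities for \<open>L2_set\<close> to infinite sums.\<close>

lemma l2_boundI:
  assumes out: "\<And>x. x \<notin> carrier G \<Longrightarrow> f x = 0" and B: "B \<ge> 0"
    and le: "\<And>F. finite F \<Longrightarrow> F \<subseteq> carrier G \<Longrightarrow> L2_set (\<lambda>x. cmod (f x)) F \<le> B"
  shows "f \<in> l2 G" "l2norm G f \<le> B"
proof -
  have le2: "(\<Sum>x\<in>F. (cmod (f x))\<^sup>2) \<le> B\<^sup>2" if "finite F" "F \<subseteq> carrier G" for F
    using le[OF that] sqrt_le_D unfolding L2_set_def by blast
  have sm: "(\<lambda>x. (cmod (f x))\<^sup>2) summable_on carrier G"
    by (rule nonneg_bdd_above_summable_on) (use le2 in \<open>auto intro!: bdd_aboveI2\<close>)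
  then show "f \<in> l2 G" using out by (simp add: l2_def)
  have "(\<Sum>\<^sub>\<infinity>x\<in>carrier G. (cmod (f x))\<^sup>2) \<le> B\<^sup>2"
    using sm le2 by (rule infsum_le_finite_sums)
  then show "l2norm G f \<le> B" unfolding l2norm_def using B real_le_lsqrt by (simp add: real_sqrt_le_iff real_le_lsqrt)
qed

lemma l2norm_nonneg: "l2norm G f \<ge> 0"
  unfolding l2norm_def by (simp add: infsum_nonneg)

lemma L2_set_le_l2norm:
  assumes "f \<in> l2 G" "finite F" "F \<subseteq> carrier G"
  shows "L2_set (\<lambda>x. cmod (f x)) F \<le> l2norm G f"
  unfolding L2_set_def l2norm_def
  using assms by (intro real_sqrt_le_mono finite_sum_le_infsum) (auto simp: l2_def)

lemma sum_cmod_sq_le_l2norm: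
  assumes "f \<in> l2 G" "finite F" "F \<subseteq> carrier G"
  shows "(\<Sum>x\<in>F. (cmod (f x))\<^sup>2) \<le> (l2norm G f)\<^sup>2"
  using L2_set_le_l2norm[OF assms] sqrt_le_D unfolding L2_set_def by blast

lemma cmod_le_l2norm: "f \<in> l2 G \<Longrightarrow> cmod (f x) \<le> l2norm G f"
  using L2_set_le_l2norm[of f "{x}"] l2norm_nonneg[of f] l2_zero_outside[of f x] by (cases "x \<in> carrier G") auto

lemma l2_add:
  assumes "f \<in> l2 G" "g \<in> l2 G"
  shows "(\<lambda>x. f x + g x) \<in> l2 G" "l2norm G (\<lambda>x. f x + g x) \<le> l2norm G f + l2norm G g"
proof -
  have le: "L2_set (\<lambda>x. cmod (f x + g x)) F \<le> l2norm G f + l2norm G g"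
    if F: "finite F" "F \<subseteq> carrier G" for F
  proof -
    have "L2_set (\<lambda>x. cmod (f x + g x)) F \<le> L2_set (\<lambda>x. cmod (f x) + cmod (g x)) F"
      by (rule L2_set_mono) (auto simp: norm_triangle_ineq)
    also have "\<dots> \<le> L2_set (\<lambda>x. cmod (f x)) F + L2_set (\<lambda>x. cmod (g x)) F"
      by (rule L2_set_triangle_ineq)
    also have "\<dots> \<le> l2norm G f + l2norm G g"
      using assms F by (intro add_mono L2_set_le_l2norm)
    finally show ?thesis .
  qed
  have B: "0 \<le> l2norm G f + l2norm G g" using l2norm_nonneg by simp
  have out: "f x + g x = 0" if "x \<notin> carrier G" for x using assms that by (simp add: l2_zero_outside)
  show "(\<lambda>x. f x + g x) \<in> l2 G" by (rule l2_boundI(1)[OF out B le])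
  show "l2norm G (\<lambda>x. f x + g x) \<le> l2norm G f + l2norm G g" by (rule l2_boundI(2)[OF out B le])
qed

lemma l2_scale:
  assumes "f \<in> l2 G"
  shows "(\<lambda>x. c * f x) \<in> l2 G" "l2norm G (\<lambda>x. c * f x) \<le> cmod c * l2norm G f"
proof -
  have le: "L2_set (\<lambda>x. cmod (c * f x)) F \<le> cmod c * l2norm G f"
    if F: "finite F" "F \<subseteq> carrier G" for F
  proof -
    have "L2_set (\<lambda>x. cmod (c * f x)) F = cmod c * L2_set (\<lambda>x. cmod (f x)) F"
      by (simp add: norm_mult L2_set_right_distrib)
    then show ?thesis using L2_set_le_l2norm[OF assms F] by (simp add: mult_left_mono)
  qed
  have B: "0 \<le> cmod c * l2norm G f" using l2norm_nonneg by simp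
  have out: "c * f x = 0" if "x \<notin> carrier G" for x using assms that by (simp add: l2_zero_outside)
  show "(\<lambda>x. c * f x) \<in> l2 G" by (rule l2_boundI(1)[OF out B le])
  show "l2norm G (\<lambda>x. c * f x) \<le> cmod c * l2norm G f" by (rule l2_boundI(2)[OF out B le])
qed

lemma l2_diff:
  assumes "f \<in> l2 G" "g \<in> l2 G"
  shows "(\<lambda>x. f x - g x) \<in> l2 G" "l2norm G (\<lambda>x. f x - g x) \<le> l2norm G f + l2norm G g"
  using l2_add[OF assms(1) l2_scale(1)[OF assms(2), of "-1"]] l2_scale(2)[OF assms(2), of "-1"] by simp_all

lemma l2_zero: "(\<lambda>_. 0) \<in> l2 G" "l2norm G (\<lambda>_. 0) = 0"
  by (simp_all add: l2_def l2norm_def)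

lemma l2_indicator:
  assumes "finite A" "A \<subseteq> carrier G"
  shows "(\<lambda>x. if x \<in> A then 1 else 0) \<in> l2 G"
    "l2norm G (\<lambda>x. if x \<in> A then 1 else 0) \<le> sqrt (real (card A))"
proof -
  have le: "L2_set (\<lambda>x. cmod (if x \<in> A then 1 else 0)) F \<le> sqrt (real (card A))"
    if F: "finite F" "F \<subseteq> carrier G" for F
  proof -
    have "(\<Sum>x\<in>F. (cmod (if x \<in> A then 1 else 0))\<^sup>2) = (\<Sum>x\<in>F. if x \<in> A then 1 else 0)"
      by (rule sum.cong) auto
    also have "\<dots> = real (card (F \<inter> A))" using F by (simp add: sum.If_cases)
    also have "\<dots> \<le> real (card A)" using assms by (simp add: card_mono)
    finally show ?thesis unfolding L2_set_def by simp
  qed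
  have out: "(if x \<in> A then 1 else 0 :: complex) = 0" if "x \<notin> carrier G" for x using assms that by auto
  show "(\<lambda>x. if x \<in> A then 1 else 0) \<in> l2 G" by (rule l2_boundI(1)[OF out _ le]) auto
  show "l2norm G (\<lambda>x. if x \<in> A then 1 else 0) \<le> sqrt (real (card A))"
    by (rule l2_boundI(2)[OF out _ le]) auto
qed

lemma left_reg_apply:
  "f \<in> l2 G \<Longrightarrow> left_reg G g f x = (if x \<in> carrier G then f (inv g \<otimes> x) else 0)"
  by (simp add: left_reg_def)

lemma left_reg_outside: "f \<notin> l2 G \<Longrightarrow> left_reg G g f = (\<lambda>_. 0)"
  by (simp add: left_reg_def)

lemma left_translation_inj: "g \<in> carrier G \<Longrightarrow> F \<subseteq> carrier G \<Longrightarrow> inj_on (\<lambda>x. inv g \<otimes> x) F"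
  by (intro inj_onI) (metis Units_eq Units_l_cancel inv_closed subsetD)

lemma l2_left_reg:
  assumes f: "f \<in> l2 G" and g: "g \<in> carrier G"
  shows "left_reg G g f \<in> l2 G" "l2norm G (left_reg G g f) \<le> l2norm G f"
proof -
  have le: "L2_set (\<lambda>x. cmod (left_reg G g f x)) F \<le> l2norm G f"
    if F: "finite F" "F \<subseteq> carrier G" for F
  proof -
    have "(\<Sum>x\<in>F. (cmod (left_reg G g f x))\<^sup>2) = (\<Sum>x\<in>F. (cmod (f (inv g \<otimes> x)))\<^sup>2)"
      using F f by (intro sum.cong) (auto simp: left_reg_apply)
    also have "\<dots> = (\<Sum>y\<in>(\<lambda>x. inv g \<otimes> x) ` F. (cmod (f y))\<^sup>2)"
      using left_translation_inj[OF g F(2)] by (simp add: sum.reindex)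
    finally have "L2_set (\<lambda>x. cmod (left_reg G g f x)) F = L2_set (\<lambda>x. cmod (f x)) ((\<lambda>x. inv g \<otimes> x) ` F)"
      unfolding L2_set_def by simp
    also have "\<dots> \<le> l2norm G f" using F g f by (intro L2_set_le_l2norm) auto
    finally show ?thesis .
  qed
  have out: "left_reg G g f x = 0" if "x \<notin> carrier G" for x using that f by (simp add: left_reg_apply)
  show "left_reg G g f \<in> l2 G" by (rule l2_boundI(1)[OF out l2norm_nonneg le])
  show "l2norm G (left_reg G g f) \<le> l2norm G f" by (rule l2_boundI(2)[OF out l2norm_nonneg le])
qed

lemma left_reg_comp:
  assumes g: "g \<in> carrier G" and h: "h \<in> carrier G"
  shows "left_reg G g \<circ> left_reg G h = left_reg G (g \<otimes> h)"
proof (intro ext)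
  fix f x
  show "(left_reg G g \<circ> left_reg G h) f x = left_reg G (g \<otimes> h) f x"
  proof (cases "f \<in> l2 G")
    case True
    have "inv h \<otimes> (inv g \<otimes> x) = inv (g \<otimes> h) \<otimes> x" if "x \<in> carrier G"
      using that g h by (simp add: inv_mult_group m_assoc)
    then show ?thesis using True l2_left_reg(1)[OF True h] g by (simp add: left_reg_apply)
  next
    case False
    then show ?thesis using l2_zero by (simp add: left_reg_outside left_reg_apply)
  qed
qed

lemma left_reg_one: "f \<in> l2 G \<Longrightarrow> left_reg G \<one> f = f"
  by (rule ext) (auto simp: left_reg_apply l2_zero_outside)

section \<open>Bounded operators and the operator norm\<close>

lemma bounded_opD:
  assumes "bounded_op G T"
  shows "\<And>f. f \<in> l2 G \<Longrightarrow> T f \<in> l2 G"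
    and "\<And>f. f \<notin> l2 G \<Longrightarrow> T f = (\<lambda>_. 0)"
    and "\<And>f g. f \<in> l2 G \<Longrightarrow> g \<in> l2 G \<Longrightarrow> T (\<lambda>x. f x + g x) = (\<lambda>x. T f x + T g x)"
    and "\<And>f c. f \<in> l2 G \<Longrightarrow> T (\<lambda>x. c * f x) = (\<lambda>x. c * T f x)"
  using assms unfolding bounded_op_def by blast+

lemma bounded_op_bound:
  assumes "bounded_op G T"
  obtains B where "B \<ge> 0" "\<And>f. f \<in> l2 G \<Longrightarrow> l2norm G (T f) \<le> B * l2norm G f"
proof -
  obtain B where B: "\<And>f. f \<in> l2 G \<Longrightarrow> l2norm G (T f) \<le> B * l2norm G f"
    using assms unfolding bounded_op_def by blast
  have "l2norm G (T f) \<le> max B 0 * l2norm G f" if "f \<in> l2 G" for f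
    using B[OF that] mult_right_mono[of B "max B 0" "l2norm G f"] l2norm_nonneg[of f] by linarith
  then show ?thesis using that[of "max B 0"] by simp
qed

lemma bounded_opI:
  assumes "\<And>f. f \<in> l2 G \<Longrightarrow> T f \<in> l2 G"
    and "\<And>f. f \<notin> l2 G \<Longrightarrow> T f = (\<lambda>_. 0)"
    and "\<And>f g. f \<in> l2 G \<Longrightarrow> g \<in> l2 G \<Longrightarrow> T (\<lambda>x. f x + g x) = (\<lambda>x. T f x + T g x)"
    and "\<And>f c. f \<in> l2 G \<Longrightarrow> T (\<lambda>x. c * f x) = (\<lambda>x. c * T f x)"
    and "\<And>f. f \<in> l2 G \<Longrightarrow> l2norm G (T f) \<le> B * l2norm G f"
  shows "bounded_op G T"
  using assms unfolding bounded_op_def by blast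

text \<open>The real supremum in \<open>opnorm\<close> is informative only for a set bounded above,
  which boundedness of \<open>T\<close> supplies. The estimate on the unit ball extends by scaling;
  functions of norm zero, which cannot be rescaled, are covered by the bound
  \<open>B\<close>.\<close>

lemma opnorm_bound:
  assumes T: "bounded_op G T" and f: "f \<in> l2 G"
  shows "l2norm G (T f) \<le> opnorm G T * l2norm G f"
proof -
  obtain B where B: "B \<ge> 0" "\<And>f. f \<in> l2 G \<Longrightarrow> l2norm G (T f) \<le> B * l2norm G f"
    using bounded_op_bound[OF T] by blast
  have bdd: "bdd_above {l2norm G (T f) | f. f \<in> l2 G \<and> l2norm G f \<le> 1}"
  proof (rule bdd_aboveI[of _ B])
    fix r assume "r \<in> {l2norm G (T f) | f. f \<in> l2 G \<and> l2norm G f \<le> 1}"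
    then obtain f where "r = l2norm G (T f)" "f \<in> l2 G" "l2norm G f \<le> 1" by blast
    then show "r \<le> B" using B(2)[of f] mult_left_mono[of "l2norm G f" 1 B] B(1) by simp
  qed
  show ?thesis
  proof (cases "l2norm G f = 0")
    case True
    then show ?thesis using B(2)[OF f] by simp
  next
    case False
    define n where "n = l2norm G f"
    have n: "n > 0" using False l2norm_nonneg[of f] by (simp add: n_def)
    define f' where "f' = (\<lambda>x. complex_of_real (1 / n) * f x)"
    have f': "f' \<in> l2 G" unfolding f'_def by (rule l2_scale(1)[OF f])
    have "l2norm G f' \<le> 1"
      using l2_scale(2)[OF f, of "complex_of_real (1 / n)"] n unfolding f'_def n_def[symmetric]
      by (simp add: norm_divide)
    then have le: "l2norm G (T f') \<le> opnorm G T"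
      unfolding opnorm_def using f' bdd by (intro cSup_upper) auto
    have "f = (\<lambda>x. complex_of_real n * f' x)" using n by (simp add: f'_def)
    then have "T f = (\<lambda>x. complex_of_real n * T f' x)" using bounded_opD(4)[OF T f'] by metis
    then have "l2norm G (T f) \<le> n * l2norm G (T f')"
      using l2_scale(2)[OF bounded_opD(1)[OF T f'], of "complex_of_real n"] n by simp
    also have "\<dots> \<le> n * opnorm G T" using le n by simp
    finally show ?thesis by (simp add: n_def mult.commute)
  qed
qed

lemma opnorm_le:
  assumes "B \<ge> 0" "\<And>f. f \<in> l2 G \<Longrightarrow> l2norm G (T f) \<le> B * l2norm G f"
  shows "opnorm G T \<le> B"
  unfolding opnorm_def
proof (rule cSup_least)
  show "{l2norm G (T f) |f. f \<in> l2 G \<and> l2norm G f \<le> 1} \<noteq> {}"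
    using l2_zero by (auto intro!: exI[of _ "\<lambda>_. 0"])
next
  fix r assume "r \<in> {l2norm G (T f) | f. f \<in> l2 G \<and> l2norm G f \<le> 1}"
  then obtain f where "r = l2norm G (T f)" "f \<in> l2 G" "l2norm G f \<le> 1" by blast
  then show "r \<le> B" using assms(2)[of f] mult_left_mono[of "l2norm G f" 1 B] assms(1) by simp
qed

text \<open>The point mass at the identity has positive norm, so the sign of
  \<open>opnorm G T\<close> can be read off from \<open>opnorm_bound\<close>.\<close>

lemma opnorm_nonneg: "bounded_op G T \<Longrightarrow> opnorm G T \<ge> 0"
proof -
  assume T: "bounded_op G T"
  have ind: "(\<lambda>x. if x \<in> {\<one>} then 1 else 0) \<in> l2 G" by (rule l2_indicator) auto
  define f :: "'a \<Rightarrow> complex" where "f = (\<lambda>x. if x \<in> {\<one>} then 1 else 0)"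
  have "0 < l2norm G f" using cmod_le_l2norm[OF ind, of \<one>] by (simp add: f_def)
  moreover have "0 \<le> opnorm G T * l2norm G f"
    using opnorm_bound[OF T, of f] l2norm_nonneg[of "T f"] ind by (simp add: f_def)
  ultimately show ?thesis by (simp add: zero_le_mult_iff)
qed

lemma bounded_op_left_reg:
  assumes "g \<in> carrier G" shows "bounded_op G (left_reg G g)"
proof (rule bounded_opI[where B = 1])
  fix f h assume fh: "f \<in> l2 G" "h \<in> l2 G"
  show "left_reg G g (\<lambda>x. f x + h x) = (\<lambda>x. left_reg G g f x + left_reg G g h x)"
    using fh l2_add(1)[OF fh] by (auto simp: left_reg_apply)
next
  fix f c assume f: "f \<in> l2 G"
  show "left_reg G g (\<lambda>x. c * f x) = (\<lambda>x. c * left_reg G g f x)"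
    using f l2_scale(1)[OF f] by (auto simp: left_reg_apply)
qed (use assms l2_left_reg left_reg_outside in auto)

lemma bounded_op_zero: "bounded_op G op_zero"
  by (rule bounded_opI[where B = 0]) (auto simp: op_zero_def l2_zero)

lemma bounded_op_add:
  assumes S: "bounded_op G S" and T: "bounded_op G T" shows "bounded_op G (op_add S T)"
proof (rule bounded_opI[where B = "opnorm G S + opnorm G T"])
  note D = bounded_opD[OF S] bounded_opD[OF T]
  fix f assume f: "f \<in> l2 G"
  show "op_add S T f \<in> l2 G" unfolding op_add_def using D f by (intro l2_add) auto
  have "l2norm G (op_add S T f) \<le> l2norm G (S f) + l2norm G (T f)"
    unfolding op_add_def using D f by (intro l2_add) auto
  then show "l2norm G (op_add S T f) \<le> (opnorm G S + opnorm G T) * l2norm G f"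
    using opnorm_bound[OF S f] opnorm_bound[OF T f] by (simp add: distrib_right)
  show "op_add S T (\<lambda>x. c * f x) = (\<lambda>x. c * op_add S T f x)" for c
    using D f by (simp add: op_add_def distrib_left)
  show "op_add S T (\<lambda>x. f x + g x) = (\<lambda>x. op_add S T f x + op_add S T g x)" if "g \<in> l2 G" for g
    using D f that by (simp add: op_add_def add_ac)
next
  fix f assume "f \<notin> l2 G"
  then show "op_add S T f = (\<lambda>_. 0)" using bounded_opD(2)[OF S] bounded_opD(2)[OF T] by (simp add: op_add_def)
qed

lemma bounded_op_scale:
  assumes S: "bounded_op G S" shows "bounded_op G (op_scale c S)"
proof (rule bounded_opI[where B = "cmod c * opnorm G S"])
  note D = bounded_opD[OF S]
  fix f assume f: "f \<in> l2 G"
  show "op_scale c S f \<in> l2 G" unfolding op_scale_def using D f by (intro l2_scale) auto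
  have "l2norm G (op_scale c S f) \<le> cmod c * l2norm G (S f)"
    unfolding op_scale_def using D f by (intro l2_scale) auto
  then show "l2norm G (op_scale c S f) \<le> (cmod c * opnorm G S) * l2norm G f"
    using mult_left_mono[OF opnorm_bound[OF S f], of "cmod c"] by (simp add: mult.assoc)
  show "op_scale c S (\<lambda>x. d * f x) = (\<lambda>x. d * op_scale c S f x)" for d
    using D f by (simp add: op_scale_def mult_ac)
  show "op_scale c S (\<lambda>x. f x + g x) = (\<lambda>x. op_scale c S f x + op_scale c S g x)" if "g \<in> l2 G" for g
    using D f that by (simp add: op_scale_def distrib_left)
next
  fix f assume "f \<notin> l2 G"
  then show "op_scale c S f = (\<lambda>_. 0)" using bounded_opD(2)[OF S] by (simp add: op_scale_def)
qed

lemma op_diff_conv: "op_diff S T = op_add S (op_scale (-1) T)"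
  by (simp add: op_diff_def op_add_def op_scale_def)

lemma bounded_op_diff: "bounded_op G S \<Longrightarrow> bounded_op G T \<Longrightarrow> bounded_op G (op_diff S T)"
  unfolding op_diff_conv by (intro bounded_op_add bounded_op_scale)

lemma bounded_op_comp:
  assumes S: "bounded_op G S" and T: "bounded_op G T" shows "bounded_op G (S \<circ> T)"
proof (rule bounded_opI[where B = "opnorm G S * opnorm G T"])
  note D = bounded_opD[OF S] bounded_opD[OF T]
  fix f assume f: "f \<in> l2 G"
  show "(S \<circ> T) f \<in> l2 G" using D f by simp
  have "l2norm G ((S \<circ> T) f) \<le> opnorm G S * l2norm G (T f)"
    using opnorm_bound[OF S D(5)[OF f]] by simp
  also have "\<dots> \<le> opnorm G S * (opnorm G T * l2norm G f)"
    by (intro mult_left_mono opnorm_bound[OF T f] opnorm_nonneg[OF S])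
  finally show "l2norm G ((S \<circ> T) f) \<le> (opnorm G S * opnorm G T) * l2norm G f" by (simp add: mult.assoc)
  show "(S \<circ> T) (\<lambda>x. c * f x) = (\<lambda>x. c * (S \<circ> T) f x)" for c
    using D f by simp
  show "(S \<circ> T) (\<lambda>x. f x + g x) = (\<lambda>x. (S \<circ> T) f x + (S \<circ> T) g x)" if "g \<in> l2 G" for g
    using D f that by simp
next
  fix f assume "f \<notin> l2 G"
  moreover have "S (\<lambda>_. 0) = (\<lambda>_. 0)" using bounded_opD(4)[OF S l2_zero(1), of 0] by simp
  ultimately show "(S \<circ> T) f = (\<lambda>_. 0)" using bounded_opD(2)[OF T] by simp
qed

lemma opnorm_triangle:
  assumes S: "bounded_op G S" and T: "bounded_op G T"
  shows "opnorm G (op_add S T) \<le> opnorm G S + opnorm G T"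
proof (rule opnorm_le)
  show "0 \<le> opnorm G S + opnorm G T" using opnorm_nonneg S T by simp
  fix f assume f: "f \<in> l2 G"
  have "l2norm G (op_add S T f) \<le> l2norm G (S f) + l2norm G (T f)"
    unfolding op_add_def using bounded_opD(1)[OF S f] bounded_opD(1)[OF T f] by (rule l2_add)
  then show "l2norm G (op_add S T f) \<le> (opnorm G S + opnorm G T) * l2norm G f"
    using opnorm_bound[OF S f] opnorm_bound[OF T f] by (simp add: distrib_right)
qed

lemma opnorm_scale:
  assumes S: "bounded_op G S" shows "opnorm G (op_scale c S) \<le> cmod c * opnorm G S"
proof (rule opnorm_le)
  show "0 \<le> cmod c * opnorm G S" using opnorm_nonneg[OF S] by simp
  fix f assume f: "f \<in> l2 G"
  have "l2norm G (op_scale c S f) \<le> cmod c * l2norm G (S f)"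
    unfolding op_scale_def using bounded_opD(1)[OF S f] by (rule l2_scale)
  then show "l2norm G (op_scale c S f) \<le> (cmod c * opnorm G S) * l2norm G f"
    using mult_left_mono[OF opnorm_bound[OF S f], of "cmod c"] by (simp add: mult.assoc)
qed

lemma opnorm_comp:
  assumes S: "bounded_op G S" and T: "bounded_op G T"
  shows "opnorm G (S \<circ> T) \<le> opnorm G S * opnorm G T"
proof (rule opnorm_le)
  show "0 \<le> opnorm G S * opnorm G T" using opnorm_nonneg S T by simp
  fix f assume f: "f \<in> l2 G"
  have "l2norm G ((S \<circ> T) f) \<le> opnorm G S * l2norm G (T f)"
    using opnorm_bound[OF S bounded_opD(1)[OF T f]] by simp
  also have "\<dots> \<le> opnorm G S * (opnorm G T * l2norm G f)"
    by (intro mult_left_mono opnorm_bound[OF T f] opnorm_nonneg[OF S])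
  finally show "l2norm G ((S \<circ> T) f) \<le> (opnorm G S * opnorm G T) * l2norm G f" by (simp add: mult.assoc)
qed

lemma opnorm_zero: "opnorm G op_zero = 0"
proof -
  have "opnorm G op_zero \<le> 0" by (rule opnorm_le) (auto simp: op_zero_def l2_zero)
  then show ?thesis using opnorm_nonneg[OF bounded_op_zero] by simp
qed

end

text \<open>A list of pairs stands for a formal combination of group elements, and
  \<open>lsum \<phi>\<close> extends \<open>\<phi>\<close> linearly to it. Repetitions are allowed,
  so sums and translates of combinations are plain list operations without collecting
  coefficients.\<close>

definition lsum :: "('a \<Rightarrow> complex) \<Rightarrow> (complex \<times> 'a) list \<Rightarrow> complex" where
  "lsum \<phi> ps = (\<Sum>p\<leftarrow>ps. fst p * \<phi> (snd p))"

lemma lsum_simps [simp]: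
  "lsum \<phi> [] = 0"
  "lsum \<phi> (p # ps) = fst p * \<phi> (snd p) + lsum \<phi> ps"
  "lsum \<phi> (ps @ qs) = lsum \<phi> ps + lsum \<phi> qs"
  by (simp_all add: lsum_def)

lemma lsum_scale: "lsum \<phi> (map (\<lambda>p. (c * fst p, snd p)) ps) = c * lsum \<phi> ps"
  by (induction ps) (simp_all add: algebra_simps)

lemma lsum_map: "lsum \<phi> (map (\<lambda>p. (fst p, h (snd p))) ps) = lsum (\<lambda>g. \<phi> (h g)) ps"
  by (induction ps) simp_all

lemma lsum_cong: "(\<And>g. g \<in> snd ` set ps \<Longrightarrow> \<phi> g = \<psi> g) \<Longrightarrow> lsum \<phi> ps = lsum \<psi> ps"
  by (induction ps) auto

lemma sum_lsum: "(\<Sum>x\<in>B. lsum (\<lambda>g. \<phi> g x) ps) = lsum (\<lambda>g. \<Sum>x\<in>B. \<phi> g x) ps"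
  by (induction ps) (simp_all add: sum.distrib sum_distrib_left)

lemma lsum_scale_arg: "lsum (\<lambda>g. c * \<phi> g) ps = c * lsum \<phi> ps"
  by (induction ps) (simp_all add: algebra_simps)

lemma lsum_diff_bound:
  assumes "\<And>g. g \<in> snd ` set ps \<Longrightarrow> cmod (\<phi> g - \<psi> g) \<le> e"
  shows "cmod (lsum \<phi> ps - lsum \<psi> ps) \<le> (\<Sum>p\<leftarrow>ps. cmod (fst p)) * e"
  using assms
proof (induction ps)
  case (Cons p ps)
  have "lsum \<phi> (p # ps) - lsum \<psi> (p # ps) = fst p * (\<phi> (snd p) - \<psi> (snd p)) + (lsum \<phi> ps - lsum \<psi> ps)"
    by (simp add: algebra_simps)
  also have "cmod \<dots> \<le> cmod (fst p * (\<phi> (snd p) - \<psi> (snd p))) + cmod (lsum \<phi> ps - lsum \<psi> ps)"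
    by (rule norm_triangle_ineq)
  also have "\<dots> \<le> cmod (fst p) * e + (\<Sum>p\<leftarrow>ps. cmod (fst p)) * e"
    using Cons by (intro add_mono) (auto simp: norm_mult intro!: mult_left_mono)
  finally show ?case by (simp add: distrib_right)
qed simp

text \<open>Serves epsilon estimates in which \<open>a\<close> is a norm that may vanish;
  \<open>a + 1\<close> keeps the denominator positive.\<close>

lemma mult_lt_half:
  fixes a b e :: real
  assumes "0 \<le> a" "0 \<le> b" "b < e / (2 * (a + 1))" "e > 0" shows "a * b < e / 2"
proof -
  have "a * b \<le> (a + 1) * b" using assms by (simp add: mult_right_mono)
  also have "\<dots> < (a + 1) * (e / (2 * (a + 1)))" using assms by (intro mult_strict_left_mono) auto
  also have "\<dots> = e / 2" using assms by (simp add: field_simps)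
  finally show ?thesis .
qed

definition lop :: "('a, 'b) monoid_scheme \<Rightarrow> (complex \<times> 'a) list \<Rightarrow> 'a op" where
  "lop G ps = (\<lambda>f x. lsum (\<lambda>g. left_reg G g f x) ps)"

definition norm_closure :: "('a, 'b) monoid_scheme \<Rightarrow> 'a op set \<Rightarrow> 'a op set" where
  "norm_closure G J = {T. bounded_op G T \<and> (\<forall>e>0. \<exists>A\<in>J. opnorm G (op_diff T A) < e)}"

context group
begin

section \<open>The group algebra inside the reduced algebra\<close>

lemma bounded_op_range: "bounded_op G T \<Longrightarrow> T f \<in> l2 G"
  using bounded_opD(1,2)[of T f] l2_zero(1) by (cases "f \<in> l2 G") auto

lemma comp_add_right:
  assumes "bounded_op G T" "bounded_op G A" "bounded_op G B"
  shows "T \<circ> op_add A B = op_add (T \<circ> A) (T \<circ> B)"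
  using bounded_opD(3)[OF assms(1) bounded_op_range[OF assms(2)] bounded_op_range[OF assms(3)]]
  by (simp add: fun_eq_iff op_add_def)

lemma comp_scale_right:
  assumes "bounded_op G T" "bounded_op G A"
  shows "T \<circ> op_scale c A = op_scale c (T \<circ> A)"
  using bounded_opD(4)[OF assms(1) bounded_op_range[OF assms(2)]]
  by (simp add: fun_eq_iff op_scale_def)

lemma comp_diff_right:
  assumes "bounded_op G T" "bounded_op G A" "bounded_op G B"
  shows "T \<circ> op_diff A B = op_diff (T \<circ> A) (T \<circ> B)"
  unfolding op_diff_conv
  using comp_add_right[OF assms(1,2) bounded_op_scale[OF assms(3)]] comp_scale_right[OF assms(1,3)] by simp

lemma comp_left:
  "op_add A B \<circ> T = op_add (A \<circ> T) (B \<circ> T)"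
  "op_diff A B \<circ> T = op_diff (A \<circ> T) (B \<circ> T)"
  "op_scale c A \<circ> T = op_scale c (A \<circ> T)"
  by (simp_all add: fun_eq_iff op_add_def op_diff_def op_scale_def)

lemma lop_Nil: "lop G [] = op_zero"
  by (simp add: lop_def op_zero_def)

lemma lop_Cons: "lop G (p # ps) = op_add (op_scale (fst p) (left_reg G (snd p))) (lop G ps)"
  by (simp add: lop_def op_add_def op_scale_def)

lemma lop_append: "lop G (ps @ qs) = op_add (lop G ps) (lop G qs)"
  by (simp add: lop_def op_add_def)

lemma lop_scale: "lop G (map (\<lambda>p. (c * fst p, snd p)) ps) = op_scale c (lop G ps)"
  by (simp add: lop_def op_scale_def lsum_scale)

lemma bounded_op_lop: "snd ` set ps \<subseteq> carrier G \<Longrightarrow> bounded_op G (lop G ps)"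
proof (induction ps)
  case (Cons p ps)
  then show ?case unfolding lop_Cons
    by (intro bounded_op_add bounded_op_scale bounded_op_left_reg) auto
qed (simp add: lop_Nil bounded_op_zero)

lemma lop_comp_left_reg:
  assumes g: "g \<in> carrier G" and ps: "snd ` set ps \<subseteq> carrier G"
  shows "lop G ps \<circ> left_reg G g = lop G (map (\<lambda>p. (fst p, snd p \<otimes> g)) ps)"
  using ps
proof (induction ps)
  case (Cons p ps)
  have IH: "lop G ps \<circ> left_reg G g = lop G (map (\<lambda>p. (fst p, snd p \<otimes> g)) ps)"
    using Cons.prems by (intro Cons.IH) auto
  have "left_reg G (snd p) \<circ> left_reg G g = left_reg G (snd p \<otimes> g)"
    using Cons.prems g by (intro left_reg_comp) auto
  then show ?case by (simp only: lop_Cons comp_left IH list.map fst_conv snd_conv)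
qed (simp add: lop_Nil op_zero_def fun_eq_iff)

lemma left_reg_comp_lop:
  assumes g: "g \<in> carrier G" and ps: "snd ` set ps \<subseteq> carrier G"
  shows "left_reg G g \<circ> lop G ps = lop G (map (\<lambda>p. (fst p, g \<otimes> snd p)) ps)"
  using ps
proof (induction ps)
  case Nil
  have "left_reg G g (\<lambda>x. 0) = (\<lambda>x. 0)" using l2_zero(1) by (simp add: left_reg_apply fun_eq_iff)
  then show ?case by (simp add: lop_Nil op_zero_def fun_eq_iff)
next
  case (Cons p ps)
  have b: "bounded_op G (left_reg G g)" "bounded_op G (left_reg G (snd p))" "bounded_op G (lop G ps)"
    using Cons.prems g by (auto intro!: bounded_op_left_reg bounded_op_lop)
  have "left_reg G g \<circ> lop G (p # ps) =
      op_add (op_scale (fst p) (left_reg G g \<circ> left_reg G (snd p))) (left_reg G g \<circ> lop G ps)"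
    unfolding lop_Cons using comp_add_right[OF b(1) bounded_op_scale[OF b(2)] b(3)]
      comp_scale_right[OF b(1,2)] by simp
  moreover have "left_reg G g \<circ> lop G ps = lop G (map (\<lambda>p. (fst p, g \<otimes> snd p)) ps)"
    using Cons.prems by (intro Cons.IH) auto
  moreover have "left_reg G g \<circ> left_reg G (snd p) = left_reg G (g \<otimes> snd p)"
    using Cons.prems g by (intro left_reg_comp) auto
  ultimately show ?case by (simp only: lop_Cons list.map fst_conv snd_conv)
qed

text \<open>A list may name a group element several times, whereas \<open>group_algebra_ops\<close>
  uses a coefficient function on a finite set; the induction merges coefficients as pairs are
  added.\<close>

lemma group_algebra_ops_lop: "group_algebra_ops G = {lop G ps | ps. snd ` set ps \<subseteq> carrier G}"
proof (intro equalityI subsetI)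
  fix T assume "T \<in> group_algebra_ops G"
  then obtain S c where T: "T = (\<lambda>f x. \<Sum>g\<in>S. c g * left_reg G g f x)" "finite S" "S \<subseteq> carrier G"
    unfolding group_algebra_ops_def by blast
  obtain xs where xs: "set xs = S" "distinct xs" using finite_distinct_list[OF T(2)] by blast
  have "T = lop G (map (\<lambda>g. (c g, g)) xs)"
    unfolding T lop_def lsum_def xs(1)[symmetric]
    using xs(2) by (simp add: sum_list_distinct_conv_sum_set comp_def)
  moreover have "snd ` set (map (\<lambda>g. (c g, g)) xs) \<subseteq> carrier G" using xs T by auto
  ultimately show "T \<in> {lop G ps | ps. snd ` set ps \<subseteq> carrier G}" by blast
next
  fix T assume "T \<in> {lop G ps | ps. snd ` set ps \<subseteq> carrier G}"
  then obtain ps where ps: "T = lop G ps" "snd ` set ps \<subseteq> carrier G" by blast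
  from ps(2) have "lop G ps \<in> group_algebra_ops G"
  proof (induction ps)
    case Nil
    show ?case unfolding group_algebra_ops_def lop_Nil op_zero_def by (intro CollectI exI[of _ "{}"]) auto
  next
    case (Cons p ps)
    then obtain S c where S: "lop G ps = (\<lambda>f x. \<Sum>g\<in>S. c g * left_reg G g f x)" "finite S" "S \<subseteq> carrier G"
      unfolding group_algebra_ops_def by auto
    define S' where "S' = insert (snd p) S"
    \<comment> \<open>The guard on \<open>S\<close> discards the arbitrary values of
      \<open>c\<close> outside \<open>S\<close>; if \<open>snd p\<close> already lies in
      \<open>S\<close>, the two coefficients add up.\<close>
    define c' where "c' = (\<lambda>g. (if g = snd p then fst p else 0) + (if g \<in> S then c g else 0))"
    have fin: "finite S'" "S' \<subseteq> carrier G" using S Cons.prems by (auto simp: S'_def)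
    have "lop G (p # ps) f x = (\<Sum>g\<in>S'. c' g * left_reg G g f x)" for f x
    proof -
      have "(\<Sum>g\<in>S'. (if g = snd p then fst p else 0) * left_reg G g f x) = fst p * left_reg G (snd p) f x"
      proof -
        have "(\<Sum>g\<in>S'. (if g = snd p then fst p else 0) * left_reg G g f x) =
            (\<Sum>g\<in>S'. if g = snd p then fst p * left_reg G g f x else 0)"
          by (intro sum.cong) auto
        then show ?thesis using fin by (simp add: S'_def)
      qed
      moreover have "(\<Sum>g\<in>S'. (if g \<in> S then c g else 0) * left_reg G g f x) = (\<Sum>g\<in>S. c g * left_reg G g f x)"
        using fin by (intro sum.mono_neutral_cong_right) (auto simp: S'_def)
      ultimately show ?thesis
        by (simp add: lop_Cons S(1) c'_def distrib_right sum.distrib op_add_def op_scale_def)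
    qed
    then have "lop G (p # ps) = (\<lambda>f x. \<Sum>g\<in>S'. c' g * left_reg G g f x)" by blast
    then show ?case unfolding group_algebra_ops_def using fin by blast
  qed
  then show "T \<in> group_algebra_ops G" using ps by simp
qed

lemma reduced_cstar_closure: "reduced_cstar G = norm_closure G (group_algebra_ops G)"
  by (simp add: reduced_cstar_def norm_closure_def)

lemma subset_norm_closure:
  assumes "A \<in> J" "bounded_op G A" shows "A \<in> norm_closure G J"
proof -
  have "op_diff A A = op_zero" by (simp add: op_diff_def op_zero_def)
  then have "opnorm G (op_diff A A) = 0" using opnorm_zero by simp
  then show ?thesis using assms unfolding norm_closure_def by (auto intro!: bexI[of _ A])
qed

lemma group_algebra_reduced_cstar:
  assumes "snd ` set ps \<subseteq> carrier G" shows "lop G ps \<in> reduced_cstar G"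
  unfolding reduced_cstar_closure
proof (rule subset_norm_closure)
  show "lop G ps \<in> group_algebra_ops G" using assms unfolding group_algebra_ops_lop by blast
  show "bounded_op G (lop G ps)" using assms by (rule bounded_op_lop)
qed

lemma left_reg_reduced_cstar: "g \<in> carrier G \<Longrightarrow> left_reg G g \<in> reduced_cstar G"
  using group_algebra_reduced_cstar[of "[(1, g)]"]
  by (simp add: lop_Cons lop_Nil op_add_def op_scale_def op_zero_def)

section \<open>Norm closures of ideals of the group algebra\<close>

lemma op_diff_triangle:
  assumes "bounded_op G S" "bounded_op G T" "bounded_op G U"
  shows "opnorm G (op_diff S U) \<le> opnorm G (op_diff S T) + opnorm G (op_diff T U)"
proof -
  have "op_diff S U = op_add (op_diff S T) (op_diff T U)" by (simp add: op_diff_def op_add_def)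
  then show ?thesis using opnorm_triangle bounded_op_diff assms by simp
qed

lemma opnorm_comp_diff:
  assumes S: "bounded_op G S" and T: "bounded_op G T" and A: "bounded_op G A" and B: "bounded_op G B"
  shows "opnorm G (op_diff (S \<circ> T) (A \<circ> B)) \<le>
    opnorm G (op_diff S A) * opnorm G T + opnorm G A * opnorm G (op_diff T B)"
proof -
  have "op_diff (S \<circ> T) (A \<circ> B) = op_add (op_diff S A \<circ> T) (A \<circ> op_diff T B)"
    unfolding comp_diff_right[OF A T B] comp_left by (simp add: op_diff_def op_add_def)
  moreover have "opnorm G (op_add (op_diff S A \<circ> T) (A \<circ> op_diff T B)) \<le>
      opnorm G (op_diff S A \<circ> T) + opnorm G (A \<circ> op_diff T B)"
    using assms by (intro opnorm_triangle bounded_op_comp bounded_op_diff)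
  moreover have "opnorm G (op_diff S A \<circ> T) \<le> opnorm G (op_diff S A) * opnorm G T"
    "opnorm G (A \<circ> op_diff T B) \<le> opnorm G A * opnorm G (op_diff T B)"
    using assms by (auto intro!: opnorm_comp bounded_op_diff)
  ultimately show ?thesis by simp
qed

text \<open>Telescoping is arranged to bring out the same four norms as in
  \<open>opnorm_comp_diff\<close>, so that one choice of approximants serves multiplication from
  both sides.\<close>

lemma opnorm_comp_diff':
  assumes S: "bounded_op G S" and T: "bounded_op G T" and A: "bounded_op G A" and B: "bounded_op G B"
  shows "opnorm G (op_diff (T \<circ> S) (B \<circ> A)) \<le>
    opnorm G T * opnorm G (op_diff S A) + opnorm G (op_diff T B) * opnorm G A"
proof -
  have "op_diff (T \<circ> S) (B \<circ> A) = op_add (T \<circ> op_diff S A) (op_diff T B \<circ> A)"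
    unfolding comp_diff_right[OF T S A] comp_left by (simp add: op_diff_def op_add_def)
  moreover have "opnorm G (op_add (T \<circ> op_diff S A) (op_diff T B \<circ> A)) \<le>
      opnorm G (T \<circ> op_diff S A) + opnorm G (op_diff T B \<circ> A)"
    using assms by (intro opnorm_triangle bounded_op_comp bounded_op_diff)
  moreover have "opnorm G (T \<circ> op_diff S A) \<le> opnorm G T * opnorm G (op_diff S A)"
    "opnorm G (op_diff T B \<circ> A) \<le> opnorm G (op_diff T B) * opnorm G A"
    using assms by (auto intro!: opnorm_comp bounded_op_diff)
  ultimately show ?thesis by simp
qed

text \<open>Group elements span the group algebra, so stability under translations makes
  \<open>J\<close> an ideal there, and norm estimates carry this over to the closure. For products,
  the approximant \<open>A\<close> of the ideal element is chosen before \<open>B\<close>, because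
  the tolerance for \<open>B\<close> depends on the norm of \<open>A\<close>.\<close>

lemma closed_ideal_norm_closure:
  assumes sub: "J \<subseteq> group_algebra_ops G" and zero: "op_zero \<in> J"
    and add: "\<And>S T. S \<in> J \<Longrightarrow> T \<in> J \<Longrightarrow> op_add S T \<in> J"
    and scale: "\<And>c S. S \<in> J \<Longrightarrow> op_scale c S \<in> J"
    and right: "\<And>g S. S \<in> J \<Longrightarrow> g \<in> carrier G \<Longrightarrow> S \<circ> left_reg G g \<in> J"
    and left: "\<And>g S. S \<in> J \<Longrightarrow> g \<in> carrier G \<Longrightarrow> left_reg G g \<circ> S \<in> J"
  shows "closed_ideal G (reduced_cstar G) (norm_closure G J)"
proof -
  have bA: "bounded_op G A" if "A \<in> group_algebra_ops G" for A
    using that bounded_op_lop unfolding group_algebra_ops_lop by blast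
  have bJ: "bounded_op G A" if "A \<in> J" for A using that sub bA by blast
  have rightA: "S \<circ> A \<in> J" and leftA: "A \<circ> S \<in> J" if S: "S \<in> J" and A: "A \<in> group_algebra_ops G" for S A
  proof -
    obtain ps where ps: "A = lop G ps" "snd ` set ps \<subseteq> carrier G"
      using A unfolding group_algebra_ops_lop by blast
    have "S \<circ> lop G ps \<in> J \<and> lop G ps \<circ> S \<in> J" using ps(2)
    proof (induction ps)
      case Nil
      have "S (\<lambda>x. 0) = (\<lambda>x. 0)" using bounded_opD(4)[OF bJ[OF S] l2_zero(1), of 0] by simp
      then have "S \<circ> op_zero = op_zero" "op_zero \<circ> S = op_zero" by (simp_all add: op_zero_def fun_eq_iff)
      then show ?case using zero by (simp add: lop_Nil)
    next
      case (Cons p ps)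
      have b: "bounded_op G (left_reg G (snd p))" "bounded_op G (lop G ps)"
        using Cons.prems by (auto intro!: bounded_op_left_reg bounded_op_lop)
      have "S \<circ> lop G (p # ps) = op_add (op_scale (fst p) (S \<circ> left_reg G (snd p))) (S \<circ> lop G ps)"
        unfolding lop_Cons using comp_add_right[OF bJ[OF S] bounded_op_scale[OF b(1)] b(2)]
          comp_scale_right[OF bJ[OF S] b(1)] by simp
      moreover have "lop G (p # ps) \<circ> S = op_add (op_scale (fst p) (left_reg G (snd p) \<circ> S)) (lop G ps \<circ> S)"
        unfolding lop_Cons comp_left ..
      moreover have "S \<circ> lop G ps \<in> J \<and> lop G ps \<circ> S \<in> J" using Cons.prems by (intro Cons.IH) auto
      moreover have "snd p \<in> carrier G" using Cons.prems by simp
      ultimately show ?case using add scale right[OF S] left[OF S] by metis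
    qed
    then show "S \<circ> A \<in> J" "A \<circ> S \<in> J" using ps by auto
  qed
  have I: "T \<in> norm_closure G J \<longleftrightarrow> bounded_op G T \<and> (\<forall>e>0. \<exists>A\<in>J. opnorm G (op_diff T A) < e)" for T
    by (simp add: norm_closure_def)
  have R: "T \<in> reduced_cstar G \<longleftrightarrow> bounded_op G T \<and> (\<forall>e>0. \<exists>A\<in>group_algebra_ops G. opnorm G (op_diff T A) < e)" for T
    by (simp add: reduced_cstar_def)
  have c1: "norm_closure G J \<subseteq> reduced_cstar G" using I R sub by blast
  have c2: "op_zero \<in> norm_closure G J" using subset_norm_closure[OF zero bounded_op_zero] .
  have c3: "op_add S T \<in> norm_closure G J" if S: "S \<in> norm_closure G J" and T: "T \<in> norm_closure G J" for S T
  proof -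
    have b: "bounded_op G S" "bounded_op G T" using S T I by auto
    have "\<exists>A\<in>J. opnorm G (op_diff (op_add S T) A) < e" if "e > 0" for e
    proof -
      have "e / 2 > 0" using that by simp
      then obtain A B where A: "A \<in> J" "opnorm G (op_diff S A) < e / 2" and B: "B \<in> J" "opnorm G (op_diff T B) < e / 2"
        using S T I by blast
      have "op_diff (op_add S T) (op_add A B) = op_add (op_diff S A) (op_diff T B)"
        by (simp add: op_diff_def op_add_def fun_eq_iff)
      then have "opnorm G (op_diff (op_add S T) (op_add A B)) \<le> opnorm G (op_diff S A) + opnorm G (op_diff T B)"
        using opnorm_triangle[OF bounded_op_diff[OF b(1) bJ[OF A(1)]] bounded_op_diff[OF b(2) bJ[OF B(1)]]] by simp
      then show ?thesis using A B add by (intro bexI[of _ "op_add A B"]) auto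
    qed
    then show ?thesis using I bounded_op_add[OF b] by blast
  qed
  have c4: "op_scale c S \<in> norm_closure G J" if S: "S \<in> norm_closure G J" for c S
  proof -
    have b: "bounded_op G S" using S I by auto
    have "\<exists>A\<in>J. opnorm G (op_diff (op_scale c S) A) < e" if e: "e > 0" for e
    proof -
      have "e / (2 * (cmod c + 1)) > 0" using e by (simp add: add_nonneg_pos)
      then obtain A where A: "A \<in> J" "opnorm G (op_diff S A) < e / (2 * (cmod c + 1))" using S I by blast
      note bd = bounded_op_diff[OF b bJ[OF A(1)]]
      have "op_diff (op_scale c S) (op_scale c A) = op_scale c (op_diff S A)"
        by (simp add: op_diff_def op_scale_def fun_eq_iff right_diff_distrib)
      then have "opnorm G (op_diff (op_scale c S) (op_scale c A)) \<le> cmod c * opnorm G (op_diff S A)"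
        using opnorm_scale[OF bd] by simp
      also have "\<dots> < e / 2" using A e opnorm_nonneg[OF bd] by (intro mult_lt_half) auto
      finally show ?thesis using A scale e by (intro bexI[of _ "op_scale c A"]) auto
    qed
    then show ?thesis using I bounded_op_scale[OF b] by blast
  qed
  have c5: "S \<circ> T \<in> norm_closure G J \<and> T \<circ> S \<in> norm_closure G J"
    if S: "S \<in> norm_closure G J" and T: "T \<in> reduced_cstar G" for S T
  proof -
    have b: "bounded_op G S" "bounded_op G T" using S T I R by auto
    have "\<exists>A B. A \<in> J \<and> B \<in> group_algebra_ops G \<and>
        opnorm G T * opnorm G (op_diff S A) + opnorm G A * opnorm G (op_diff T B) < e" if e: "e > 0" for e
    proof -
      have "e / (2 * (opnorm G T + 1)) > 0" using e opnorm_nonneg[OF b(2)] by simp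
      then obtain A where A: "A \<in> J" "opnorm G (op_diff S A) < e / (2 * (opnorm G T + 1))" using S I by blast
      have nA: "opnorm G A \<ge> 0" using opnorm_nonneg bJ A by blast
      then have "e / (2 * (opnorm G A + 1)) > 0" using e by simp
      then obtain B where B: "B \<in> group_algebra_ops G" "opnorm G (op_diff T B) < e / (2 * (opnorm G A + 1))"
        using T R by blast
      have "opnorm G T * opnorm G (op_diff S A) < e / 2"
        by (rule mult_lt_half[OF opnorm_nonneg[OF b(2)] opnorm_nonneg[OF bounded_op_diff[OF b(1) bJ[OF A(1)]]] A(2) e])
      moreover have "opnorm G A * opnorm G (op_diff T B) < e / 2"
        by (rule mult_lt_half[OF nA opnorm_nonneg[OF bounded_op_diff[OF b(2) bA[OF B(1)]]] B(2) e])
      ultimately have "opnorm G T * opnorm G (op_diff S A) + opnorm G A * opnorm G (op_diff T B) < e" by linarith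
      then show ?thesis using A(1) B(1) by blast
    qed
    note ex = this
    have "\<exists>C\<in>J. opnorm G (op_diff (S \<circ> T) C) < e" and "\<exists>C\<in>J. opnorm G (op_diff (T \<circ> S) C) < e" if e: "e > 0" for e
    proof -
      obtain A B where AB: "A \<in> J" "B \<in> group_algebra_ops G"
        "opnorm G T * opnorm G (op_diff S A) + opnorm G A * opnorm G (op_diff T B) < e"
        using ex[OF e] by blast
      have "opnorm G (op_diff (S \<circ> T) (A \<circ> B)) < e"
        using opnorm_comp_diff[OF b bJ[OF AB(1)] bA[OF AB(2)]] AB(3) by (simp add: mult.commute)
      then show "\<exists>C\<in>J. opnorm G (op_diff (S \<circ> T) C) < e" using rightA[OF AB(1,2)] by blast
      have "opnorm G (op_diff (T \<circ> S) (B \<circ> A)) < e"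
        using opnorm_comp_diff'[OF b bJ[OF AB(1)] bA[OF AB(2)]] AB(3) by (simp add: mult.commute)
      then show "\<exists>C\<in>J. opnorm G (op_diff (T \<circ> S) C) < e" using leftA[OF AB(1,2)] by blast
    qed
    then show ?thesis using I bounded_op_comp b by blast
  qed
  have c6: "T \<in> norm_closure G J"
    if T: "T \<in> reduced_cstar G" and ap: "\<forall>e>0. \<exists>S\<in>norm_closure G J. opnorm G (op_diff T S) < e" for T
  proof -
    have b: "bounded_op G T" using T R by auto
    have "\<exists>A\<in>J. opnorm G (op_diff T A) < e" if "e > 0" for e
    proof -
      have e2: "e / 2 > 0" using that by simp
      then obtain S where S: "S \<in> norm_closure G J" "opnorm G (op_diff T S) < e / 2" using ap by blast
      then obtain A where A: "A \<in> J" "opnorm G (op_diff S A) < e / 2" using I e2 by blast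
      have "bounded_op G S" using S I by blast
      then have "opnorm G (op_diff T A) < e"
        using op_diff_triangle[OF b _ bJ[OF A(1)], of S] S A by simp
      then show ?thesis using A by blast
    qed
    then show ?thesis using I b by blast
  qed
  show ?thesis unfolding closed_ideal_def
  proof (intro conjI)
    show "\<forall>T\<in>reduced_cstar G. (\<forall>e>0. \<exists>S\<in>norm_closure G J. opnorm G (op_diff T S) < e) \<longrightarrow> T \<in> norm_closure G J"
      by (intro ballI impI) (rule c6)
    show "\<forall>S\<in>norm_closure G J. \<forall>T\<in>reduced_cstar G. S \<circ> T \<in> norm_closure G J \<and> T \<circ> S \<in> norm_closure G J"
      by (intro ballI) (rule c5)
  qed (auto intro: c1[THEN subsetD] c2 c3 c4)
qed

text \<open>This is weak containment of the quasi-regular representation on G/K in the regular one,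
  tested at the coset of \<open>u\<close>: the coefficient of \<open>g\<close> there is 1 exactly
  when \<open>g\<close> fixes that coset. A translated Foelner set is almost invariant under the
  elements that fix the coset, and every other element carries it off itself.\<close>

lemma amenable_lsum_bound:
  assumes K: "subgroup K G" and am: "amenable_subgroup G K" and u: "u \<in> carrier G"
    and ps: "snd ` set ps \<subseteq> carrier G"
  shows "cmod (lsum (\<lambda>g. if inv u \<otimes> g \<otimes> u \<in> K then 1 else 0) ps) \<le> opnorm G (lop G ps)"
proof -
  define \<phi> :: "'a \<Rightarrow> complex" where "\<phi> = (\<lambda>g. if inv u \<otimes> g \<otimes> u \<in> K then 1 else 0)"
  define M where "M = (\<Sum>p\<leftarrow>ps. cmod (fst p))"
  have M: "M \<ge> 0" unfolding M_def by (intro sum_list_nonneg) auto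
  have Kc: "x \<in> carrier G" if "x \<in> K" for x using that K subgroup.mem_carrier by metis
  have main: "cmod (lsum \<phi> ps) \<le> opnorm G (lop G ps) + M * e" if e: "e > 0" for e
  proof -
    \<comment> \<open>Almost invariance is required only for the conjugates that lie in
      \<open>K\<close>; any other conjugate carries \<open>K\<close>, and with it every subset, to a
      disjoint set.\<close>
    define S where "S = (\<lambda>g. inv u \<otimes> g \<otimes> u) ` (snd ` set ps) \<inter> K"
    have S: "finite S" "S \<subseteq> K" by (auto simp: S_def)
    obtain A where A: "finite A" "A \<noteq> {}" "A \<subseteq> K"
      "\<And>s. s \<in> S \<Longrightarrow> real (card (A \<inter> (s <# A))) \<ge> (1 - e) * real (card A)"
      using amenable_folner[OF K am S e] by blast
    define B where "B = (\<lambda>a. u \<otimes> a) ` A"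
    have Ac: "a \<in> carrier G" if "a \<in> A" for a using that A Kc by blast
    have injB: "inj_on (\<lambda>a. u \<otimes> a) A" using Ac u by (intro inj_onI) (metis Units_eq Units_l_cancel)
    have B: "finite B" "B \<subseteq> carrier G" "card B = card A"
      using A Ac u injB by (auto simp: B_def card_image)
    define n where "n = real (card A)"
    have n: "n > 0" using A by (simp add: n_def card_gt_0_iff)
    define \<xi> :: "'a \<Rightarrow> complex" where "\<xi> = (\<lambda>x. if x \<in> B then 1 else 0)"
    have \<xi>: "\<xi> \<in> l2 G" "l2norm G \<xi> \<le> sqrt n"
      using l2_indicator[OF B(1,2)] B(3) by (simp_all add: \<xi>_def n_def)
    \<comment> \<open>The inner product of the translated indicator with the indicator itself, that
      is, the size of the overlap of \<open>B\<close> with its translate by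
      \<open>g\<close>.\<close>
    define \<psi> where "\<psi> = (\<lambda>g. \<Sum>x\<in>B. left_reg G g \<xi> x)"
    have \<psi>: "cmod (\<psi> g - of_real n * \<phi> g) \<le> n * e" if g: "g \<in> snd ` set ps" for g
    proof -
      have gc: "g \<in> carrier G" using g ps by blast
      define k where "k = inv u \<otimes> g \<otimes> u"
      have kc: "k \<in> carrier G" using u gc by (simp add: k_def)
      have mem: "inv g \<otimes> (u \<otimes> a) \<in> B \<longleftrightarrow> a \<in> k <# A" if a: "a \<in> A" for a
      proof -
        have "inv g \<otimes> (u \<otimes> a) = u \<otimes> a' \<longleftrightarrow> a = k \<otimes> a'" if "a' \<in> A" for a'
        proof -
          have c: "a \<in> carrier G" "a' \<in> carrier G" using a that Ac by auto
          have "inv g \<otimes> (u \<otimes> a) = u \<otimes> a' \<longleftrightarrow> u \<otimes> a = g \<otimes> (u \<otimes> a')"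
            using c u gc by (metis inv_solve_left m_closed inv_closed)
          also have "\<dots> \<longleftrightarrow> a = inv u \<otimes> (g \<otimes> (u \<otimes> a'))"
            using c u gc by (metis inv_solve_left m_closed)
          also have "inv u \<otimes> (g \<otimes> (u \<otimes> a')) = k \<otimes> a'" using c u gc by (simp add: k_def m_assoc)
          finally show ?thesis .
        qed
        then show ?thesis unfolding B_def l_coset_def by auto
      qed
      have "\<psi> g = (\<Sum>a\<in>A. \<xi> (inv g \<otimes> (u \<otimes> a)))"
        unfolding \<psi>_def B_def sum.reindex[OF injB] comp_def
        using Ac u by (intro sum.cong) (auto simp: left_reg_apply[OF \<xi>(1)])
      also have "\<dots> = (\<Sum>a\<in>A. if a \<in> k <# A then 1 else 0)"
        by (intro sum.cong) (auto simp: \<xi>_def mem)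
      also have "\<dots> = of_nat (card (A \<inter> (k <# A)))" using A by (simp add: sum.If_cases)
      finally have eq: "\<psi> g = of_real (real (card (A \<inter> (k <# A))))" by simp
      show ?thesis
      proof (cases "k \<in> K")
        case True
        then have "k \<in> S" using g by (auto simp: S_def k_def)
        then have "real (card (A \<inter> (k <# A))) \<ge> (1 - e) * n" using A(4) by (simp add: n_def)
        moreover have "real (card (A \<inter> (k <# A))) \<le> n" using A by (simp add: n_def card_mono)
        moreover have "\<psi> g - of_real n * \<phi> g = of_real (real (card (A \<inter> (k <# A))) - n)"
          using True eq by (simp add: \<phi>_def k_def)
        ultimately show ?thesis by (simp add: norm_of_real algebra_simps del: of_real_diff)
      next
        case False
        have "A \<inter> (k <# A) = {}"
        proof (rule ccontr)
          assume "A \<inter> (k <# A) \<noteq> {}"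
          then obtain a a' where a: "a \<in> A" "a' \<in> A" "a = k \<otimes> a'" by (auto simp: l_coset_def)
          then have "k = a \<otimes> inv a'" using Ac kc by (metis inv_solve_right)
          then have "k \<in> K" using a A K by (metis subgroup.m_closed subgroup.m_inv_closed subsetD)
          then show False using False by simp
        qed
        then show ?thesis using False eq n e by (simp add: \<phi>_def k_def)
      qed
    qed
    have b: "bounded_op G (lop G ps)" using bounded_op_lop ps by blast
    define h where "h = lop G ps \<xi>"
    have h: "h \<in> l2 G" "l2norm G h \<le> opnorm G (lop G ps) * sqrt n"
    proof -
      show "h \<in> l2 G" unfolding h_def using bounded_opD(1)[OF b \<xi>(1)] .
      have "l2norm G h \<le> opnorm G (lop G ps) * l2norm G \<xi>" unfolding h_def using opnorm_bound[OF b \<xi>(1)] .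
      also have "\<dots> \<le> opnorm G (lop G ps) * sqrt n" using \<xi>(2) opnorm_nonneg[OF b] by (rule mult_left_mono)
      finally show "l2norm G h \<le> opnorm G (lop G ps) * sqrt n" .
    qed
    have "lsum \<psi> ps = (\<Sum>x\<in>B. h x)" unfolding \<psi>_def h_def lop_def by (simp add: sum_lsum)
    then have "cmod (lsum \<psi> ps) \<le> (\<Sum>x\<in>B. cmod (h x))" using norm_sum by metis
    \<comment> \<open>Cauchy--Schwarz against the constant 1 on \<open>B\<close> costs one factor
      \<open>sqrt n\<close>, and the norm of the test vector costs another; the resulting
      \<open>n\<close> cancels at the end.\<close>
    also have "\<dots> = (\<Sum>x\<in>B. \<bar>1\<bar> * \<bar>cmod (h x)\<bar>)" by simp
    also have "\<dots> \<le> L2_set (\<lambda>x. 1) B * L2_set (\<lambda>x. cmod (h x)) B" by (rule L2_set_mult_ineq)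
    also have "\<dots> \<le> sqrt n * (opnorm G (lop G ps) * sqrt n)"
      using L2_set_le_l2norm[OF h(1) B(1,2)] h(2) B(3) n
      by (intro mult_mono) (auto simp: L2_set_constant n_def)
    also have "\<dots> = n * opnorm G (lop G ps)" using n by simp
    finally have up: "cmod (lsum \<psi> ps) \<le> n * opnorm G (lop G ps)" .
    have "cmod (lsum \<psi> ps - of_real n * lsum \<phi> ps) \<le> M * (n * e)"
      using lsum_diff_bound[of ps \<psi> "\<lambda>g. of_real n * \<phi> g" "n * e"] \<psi> by (simp add: lsum_scale_arg M_def)
    then have "cmod (of_real n * lsum \<phi> ps) \<le> n * opnorm G (lop G ps) + M * (n * e)"
      using up norm_triangle_sub[of "of_real n * lsum \<phi> ps" "lsum \<psi> ps"] norm_minus_commute[of "lsum \<psi> ps"] by simp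
    then have "n * cmod (lsum \<phi> ps) \<le> n * (opnorm G (lop G ps) + M * e)"
      using n by (simp add: norm_mult algebra_simps)
    then show ?thesis using n by simp
  qed
  have "cmod (lsum \<phi> ps) \<le> opnorm G (lop G ps)"
  proof (rule field_le_epsilon)
    fix e :: real assume e: "e > 0"
    have "e / (M + 1) > 0" using e M by simp
    from main[OF this] have "cmod (lsum \<phi> ps) \<le> opnorm G (lop G ps) + M * (e / (M + 1))" .
    also have "M * (e / (M + 1)) \<le> e" using e M by (simp add: field_simps)
    finally show "cmod (lsum \<phi> ps) \<le> opnorm G (lop G ps) + e" by simp
  qed
  then show ?thesis by (simp add: \<phi>_def)
qed

text \<open>Each translate is split according to whether the argument of \<open>f\<close> lies in
  \<open>D i\<close>. The parts inside come from pieces of \<open>f\<close> with disjoint supports,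
  so Cauchy--Schwarz over \<open>i\<close> bounds their sum by \<open>sqrt N\<close> times the norm
  of \<open>f\<close>. The parts outside are carried into the disjoint sets \<open>D i\<close>,
  hence are orthogonal and obey the same bound. The factor 2 adds the two.\<close>

lemma powers_estimate:
  fixes N :: nat
  assumes f: "f \<in> l2 G" and t: "\<And>i. i < N \<Longrightarrow> t i \<in> carrier G"
    and disj: "\<And>i j. i < N \<Longrightarrow> j < N \<Longrightarrow> i \<noteq> j \<Longrightarrow> D i \<inter> D j = {}"
    and move: "\<And>i x. i < N \<Longrightarrow> x \<in> carrier G \<Longrightarrow> x \<notin> D i \<Longrightarrow> t i \<otimes> x \<in> D i"
  shows "l2norm G (\<lambda>x. \<Sum>i<N. left_reg G (t i) f x) \<le> 2 * sqrt (real N) * l2norm G f"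
proof (rule l2_boundI(2))
  show "(\<Sum>i<N. left_reg G (t i) f x) = 0" if "x \<notin> carrier G" for x
    using that f by (simp add: left_reg_apply)
  show "0 \<le> 2 * sqrt (real N) * l2norm G f" using l2norm_nonneg by simp
  fix F assume F: "finite F" "F \<subseteq> carrier G"
  define q where "q = (\<lambda>i x. inv (t i) \<otimes> x)"
  define a where "a = (\<lambda>i x. if q i x \<in> D i then f (q i x) else 0)"
  define b where "b = (\<lambda>i x. if q i x \<in> D i then 0 else f (q i x))"
  have qc: "q i x \<in> carrier G" if "i < N" "x \<in> F" for i x using that t F by (auto simp: q_def)
  have q_inj: "inj_on (q i) F" if "i < N" for i
    unfolding q_def using left_translation_inj[OF t[OF that] F(2)] .
  have split: "(\<Sum>i<N. left_reg G (t i) f x) = (\<Sum>i<N. a i x) + (\<Sum>i<N. b i x)" if "x \<in> F" for x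
    unfolding sum.distrib[symmetric] using that F f
    by (intro sum.cong) (auto simp: left_reg_apply a_def b_def q_def)
  have "L2_set (\<lambda>x. cmod (\<Sum>i<N. left_reg G (t i) f x)) F
      \<le> L2_set (\<lambda>x. cmod (\<Sum>i<N. a i x) + cmod (\<Sum>i<N. b i x)) F"
    by (rule L2_set_mono) (auto simp: split norm_triangle_ineq)
  also have "\<dots> \<le> L2_set (\<lambda>x. cmod (\<Sum>i<N. a i x)) F + L2_set (\<lambda>x. cmod (\<Sum>i<N. b i x)) F"
    by (rule L2_set_triangle_ineq)
  also have "L2_set (\<lambda>x. cmod (\<Sum>i<N. a i x)) F \<le> sqrt (real N) * l2norm G f"
  proof -
    have tri: "L2_set (\<lambda>x. cmod (\<Sum>i<m. a i x)) F \<le> (\<Sum>i<m. L2_set (\<lambda>x. cmod (a i x)) F)" for m :: nat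
    proof (induction m)
      case 0
      then show ?case by (simp add: L2_set_def)
    next
      case (Suc m)
      have "L2_set (\<lambda>x. cmod (\<Sum>i<Suc m. a i x)) F \<le> L2_set (\<lambda>x. cmod (\<Sum>i<m. a i x) + cmod (a m x)) F"
        by (rule L2_set_mono) (auto simp: norm_triangle_ineq)
      also have "\<dots> \<le> L2_set (\<lambda>x. cmod (\<Sum>i<m. a i x)) F + L2_set (\<lambda>x. cmod (a m x)) F"
        by (rule L2_set_triangle_ineq)
      finally show ?case using Suc by simp
    qed
    define Y where "Y = (\<lambda>i. q i ` F \<inter> D i)"
    have aY: "(\<Sum>x\<in>F. (cmod (a i x))\<^sup>2) = (\<Sum>y\<in>Y i. (cmod (f y))\<^sup>2)" if i: "i < N" for i
    proof -
      have "(\<Sum>x\<in>F. (cmod (a i x))\<^sup>2) = (\<Sum>x\<in>F. (if q i x \<in> D i then (cmod (f (q i x)))\<^sup>2 else 0))"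
        by (intro sum.cong) (auto simp: a_def)
      also have "\<dots> = (\<Sum>y\<in>q i ` F. (if y \<in> D i then (cmod (f y))\<^sup>2 else 0))"
        by (simp add: sum.reindex[OF q_inj[OF i]])
      also have "\<dots> = (\<Sum>y\<in>Y i. (cmod (f y))\<^sup>2)" using F by (simp add: sum.inter_restrict Y_def)
      finally show ?thesis .
    qed
    have "(\<Sum>i<N. \<Sum>x\<in>F. (cmod (a i x))\<^sup>2) = (\<Sum>i<N. \<Sum>y\<in>Y i. (cmod (f y))\<^sup>2)" by (simp add: aY)
    also have "\<dots> = (\<Sum>y\<in>(\<Union>i<N. Y i). (cmod (f y))\<^sup>2)"
      using F disj by (intro sum.UNION_disjoint[symmetric]) (auto simp: Y_def)
    also have "\<dots> \<le> (l2norm G f)\<^sup>2"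
      using F qc f by (intro sum_cmod_sq_le_l2norm) (auto simp: Y_def)
    finally have sq: "(\<Sum>i<N. \<Sum>x\<in>F. (cmod (a i x))\<^sup>2) \<le> (l2norm G f)\<^sup>2" .
    have "(\<Sum>i<N. L2_set (\<lambda>x. cmod (a i x)) F) = (\<Sum>i<N. \<bar>1\<bar> * \<bar>L2_set (\<lambda>x. cmod (a i x)) F\<bar>)" by simp
    also have "\<dots> \<le> L2_set (\<lambda>i. 1) {..<N} * L2_set (\<lambda>i. L2_set (\<lambda>x. cmod (a i x)) F) {..<N}"
      by (rule L2_set_mult_ineq)
    also have "\<dots> \<le> sqrt (real N) * l2norm G f"
    proof -
      have "L2_set (\<lambda>i. L2_set (\<lambda>x. cmod (a i x)) F) {..<N} = sqrt (\<Sum>i<N. \<Sum>x\<in>F. (cmod (a i x))\<^sup>2)"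
        by (simp add: L2_set_def sum_nonneg)
      also have "\<dots> \<le> l2norm G f" using sq l2norm_nonneg real_le_lsqrt by (simp add: real_le_lsqrt sum_nonneg)
      finally show ?thesis by (simp add: L2_set_constant mult_left_mono)
    qed
    finally show ?thesis using tri[of N] by linarith
  qed
  also have "L2_set (\<lambda>x. cmod (\<Sum>i<N. b i x)) F \<le> sqrt (real N) * l2norm G f"
  proof -
    have bD: "x \<in> D i" if "i < N" "x \<in> F" "b i x \<noteq> 0" for i x
    proof -
      have "q i x \<notin> D i" using that by (auto simp: b_def split: if_splits)
      then have "t i \<otimes> q i x \<in> D i" using move that qc by blast
      moreover have "t i \<otimes> q i x = x" using that t F by (auto simp: q_def simp flip: m_assoc)
      ultimately show ?thesis by simp
    qed
    \<comment> \<open>At a given point at most one \<open>b i\<close> is nonzero, because a nonzero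
      value places the point in \<open>D i\<close>.\<close>
    have one: "(cmod (\<Sum>i<N. b i x))\<^sup>2 \<le> (\<Sum>i<N. (cmod (b i x))\<^sup>2)" if x: "x \<in> F" for x
    proof (cases "\<exists>i<N. b i x \<noteq> 0")
      case False
      then show ?thesis by (simp add: sum_nonneg)
    next
      case True
      then obtain i where i: "i < N" "b i x \<noteq> 0" by blast
      have "b j x = 0" if "j < N" "j \<noteq> i" for j
        using bD[OF i(1) x i(2)] bD[OF that(1) x] disj[OF that(1) i(1) that(2)] by blast
      then have "(\<Sum>j<N. b j x) = (\<Sum>j\<in>{i}. b j x)" using i by (intro sum.mono_neutral_right) auto
      then have "(cmod (\<Sum>j<N. b j x))\<^sup>2 = (cmod (b i x))\<^sup>2" by simp
      also have "\<dots> \<le> (\<Sum>i<N. (cmod (b i x))\<^sup>2)" using i by (intro member_le_sum) auto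
      finally show ?thesis .
    qed
    have "(\<Sum>x\<in>F. (cmod (\<Sum>i<N. b i x))\<^sup>2) \<le> (\<Sum>x\<in>F. \<Sum>i<N. (cmod (b i x))\<^sup>2)"
      by (intro sum_mono one)
    also have "\<dots> = (\<Sum>i<N. \<Sum>x\<in>F. (cmod (b i x))\<^sup>2)" by (rule sum.swap)
    also have "\<dots> \<le> (\<Sum>i<N. (l2norm G f)\<^sup>2)"
    proof (rule sum_mono)
      fix i assume "i \<in> {..<N}"
      then have i: "i < N" by simp
      have "(\<Sum>x\<in>F. (cmod (b i x))\<^sup>2) \<le> (\<Sum>x\<in>F. (cmod (f (q i x)))\<^sup>2)"
        by (intro sum_mono) (auto simp: b_def)
      also have "\<dots> = (\<Sum>y\<in>q i ` F. (cmod (f y))\<^sup>2)" by (simp add: sum.reindex[OF q_inj[OF i]])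
      also have "\<dots> \<le> (l2norm G f)\<^sup>2" using F qc[OF i] f by (intro sum_cmod_sq_le_l2norm) auto
      finally show "(\<Sum>x\<in>F. (cmod (b i x))\<^sup>2) \<le> (l2norm G f)\<^sup>2" .
    qed
    also have "\<dots> = (sqrt (real N) * l2norm G f)\<^sup>2" by (simp add: power_mult_distrib)
    finally show ?thesis unfolding L2_set_def using l2norm_nonneg by (intro real_le_lsqrt) (auto intro: sum_nonneg)
  qed
  finally show "L2_set (\<lambda>x. cmod (\<Sum>i<N. left_reg G (t i) f x)) F \<le> 2 * sqrt (real N) * l2norm G f"
    by (simp add: mult_ac)
qed

end

section \<open>Powers' averaging\<close>

context group
begin

lemma l2_sum:
  assumes "finite S" "\<And>i. i \<in> S \<Longrightarrow> f i \<in> l2 G"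
  shows "(\<lambda>x. \<Sum>i\<in>S. f i x) \<in> l2 G \<and> l2norm G (\<lambda>x. \<Sum>i\<in>S. f i x) \<le> (\<Sum>i\<in>S. l2norm G (f i))"
  using assms
proof (induction S)
  case empty
  then show ?case by (simp add: l2_zero)
next
  case (insert i S)
  have "f i \<in> l2 G" "(\<lambda>x. \<Sum>i\<in>S. f i x) \<in> l2 G"
    "l2norm G (\<lambda>x. \<Sum>i\<in>S. f i x) \<le> (\<Sum>i\<in>S. l2norm G (f i))" using insert by auto
  then show ?case using l2_add[of "f i" "\<lambda>x. \<Sum>i\<in>S. f i x"] insert.hyps by simp
qed

section \<open>The column of an operator at the identity\<close>

definition delta :: "'a \<Rightarrow> complex" where
  "delta = (\<lambda>x. if x \<in> {\<one>} then 1 else 0)"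

lemma delta: "delta \<in> l2 G" "l2norm G delta \<le> 1" "delta \<one> = 1" "x \<noteq> \<one> \<Longrightarrow> delta x = 0"
  using l2_indicator[of "{\<one>}"] by (simp_all add: delta_def)

lemma delta_translate:
  assumes "g \<in> carrier G" "x \<in> carrier G" shows "delta (inv g \<otimes> x) = (if g = x then 1 else 0)"
proof (cases "g = x")
  case True
  then show ?thesis using assms delta(3) by simp
next
  case False
  then have "inv g \<otimes> x \<noteq> \<one>" using assms by (metis inv_inv inv_equality inv_closed)
  then show ?thesis using False delta(4) by simp
qed

lemma group_algebra_delta:
  assumes "finite S" "S \<subseteq> carrier G" "x \<in> carrier G"
  shows "(\<Sum>g\<in>S. c g * left_reg G g delta x) = (if x \<in> S then c x else 0)"
proof -
  have "(\<Sum>g\<in>S. c g * left_reg G g delta x) = (\<Sum>g\<in>S. if g = x then c g else 0)"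
    using assms delta(1) by (intro sum.cong) (auto simp: left_reg_apply delta_translate delta(3))
  then show ?thesis using assms by simp
qed

text \<open>The operator is recovered from its column at the identity: if that column vanishes, then the
  coefficients of an approximating group algebra element are small in the l2 norm, and by
  Cauchy--Schwarz so are all values of the operator.\<close>

lemma reduced_cstar_separating:
  assumes T: "T \<in> reduced_cstar G" and z: "\<And>q. q \<in> carrier G \<Longrightarrow> T delta q = 0"
  shows "T = op_zero"
proof (intro ext)
  fix f x
  have b: "bounded_op G T" using T by (simp add: reduced_cstar_def)
  show "T f x = op_zero f x"
  proof (cases "f \<in> l2 G \<and> x \<in> carrier G")
    case False
    then have "T f x = 0" using bounded_opD(2)[OF b] l2_zero_outside[OF bounded_op_range[OF b]] by metis
    then show ?thesis by (simp add: op_zero_def)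
  next
    case True
    then have f: "f \<in> l2 G" and x: "x \<in> carrier G" by auto
    have bound: "cmod (T f x) \<le> 2 * l2norm G f * e" if e: "e > 0" for e
    proof -
      obtain A where A: "A \<in> group_algebra_ops G" "opnorm G (op_diff T A) < e"
        using T e unfolding reduced_cstar_def by blast
      have bA: "bounded_op G A" using A bounded_op_lop unfolding group_algebra_ops_lop by blast
      obtain S c where S: "A = (\<lambda>f x. \<Sum>g\<in>S. c g * left_reg G g f x)" "finite S" "S \<subseteq> carrier G"
        using A unfolding group_algebra_ops_def by blast
      note bd = bounded_op_diff[OF b bA]
      have small: "l2norm G (op_diff T A h) \<le> e * l2norm G h" if "h \<in> l2 G" for h
        using opnorm_bound[OF bd that] A(2) mult_right_mono[of "opnorm G (op_diff T A)" e "l2norm G h"]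
          l2norm_nonneg[of h] by simp
      have "L2_set (\<lambda>g. cmod (c g)) S = L2_set (\<lambda>g. cmod (op_diff T A delta g)) S"
      proof (rule L2_set_cong)
        fix g assume g: "g \<in> S"
        then have "A delta g = c g" using S group_algebra_delta[of S g c] by auto
        moreover have "T delta g = 0" using z g S by blast
        ultimately show "cmod (c g) = cmod (op_diff T A delta g)" by (simp add: op_diff_def)
      qed simp
      also have "\<dots> \<le> l2norm G (op_diff T A delta)"
        using bounded_opD(1)[OF bd delta(1)] S by (intro L2_set_le_l2norm) auto
      also have "\<dots> \<le> e * l2norm G delta" by (rule small[OF delta(1)])
      also have "\<dots> \<le> e" using delta(2) e mult_left_mono[of "l2norm G delta" 1 e] by simp
      finally have c: "L2_set (\<lambda>g. cmod (c g)) S \<le> e" .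
      have inj: "inj_on (\<lambda>g. inv g \<otimes> x) S"
      proof (rule inj_onI)
        fix g h assume gh: "g \<in> S" "h \<in> S" "inv g \<otimes> x = inv h \<otimes> x"
        then have "inv g = inv h" using right_cancel[of x "inv g" "inv h"] x S by auto
        then show "g = h" using gh S by (metis inv_inv subsetD)
      qed
      have "L2_set (\<lambda>g. cmod (f (inv g \<otimes> x))) S = L2_set (\<lambda>y. cmod (f y)) ((\<lambda>g. inv g \<otimes> x) ` S)"
        unfolding L2_set_def sum.reindex[OF inj] by simp
      also have "\<dots> \<le> l2norm G f" using S x f by (intro L2_set_le_l2norm) auto
      finally have fs: "L2_set (\<lambda>g. cmod (f (inv g \<otimes> x))) S \<le> l2norm G f" .
      have "cmod (A f x) = cmod (\<Sum>g\<in>S. c g * f (inv g \<otimes> x))"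
        using S f x by (simp add: left_reg_apply)
      also have "\<dots> \<le> (\<Sum>g\<in>S. \<bar>cmod (c g)\<bar> * \<bar>cmod (f (inv g \<otimes> x))\<bar>)"
        by (rule order_trans[OF norm_sum]) (simp add: norm_mult)
      also have "\<dots> \<le> L2_set (\<lambda>g. cmod (c g)) S * L2_set (\<lambda>g. cmod (f (inv g \<otimes> x))) S"
        by (rule L2_set_mult_ineq)
      also have "\<dots> \<le> e * l2norm G f" using c fs e by (intro mult_mono) auto
      finally have Af: "cmod (A f x) \<le> e * l2norm G f" .
      have "cmod (op_diff T A f x) \<le> e * l2norm G f"
        using cmod_le_l2norm[OF bounded_opD(1)[OF bd f], of x] small[OF f] by linarith
      then have "cmod (T f x) \<le> e * l2norm G f + e * l2norm G f"
        using Af norm_triangle_sub[of "T f x" "A f x"] by (simp add: op_diff_def)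
      then show ?thesis by (simp add: algebra_simps)
    qed
    have "cmod (T f x) \<le> 0"
    proof (rule field_le_epsilon)
      fix e :: real assume e: "e > 0"
      define n where "n = 2 * l2norm G f"
      have n: "n \<ge> 0" using l2norm_nonneg by (simp add: n_def)
      have "e / (n + 1) > 0" using e n by simp
      from bound[OF this] have "cmod (T f x) \<le> n * (e / (n + 1))" by (simp add: n_def)
      also have "\<dots> \<le> e" using e n by (simp add: field_simps)
      finally show "cmod (T f x) \<le> 0 + e" by simp
    qed
    then show ?thesis by (simp add: op_zero_def)
  qed
qed

text \<open>De la Harpe's Powers property for the partition of the group into \<open>C\<close> and
  its complement, with one infinite sequence of disjoint translates in place of arbitrarily long
  finite ones.\<close>

definition powers_group :: bool where
  "powers_group \<longleftrightarrow> (\<forall>F. finite F \<and> F \<subseteq> carrier G - {\<one>} \<longrightarrow> (\<exists>C \<gamma>.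
     (\<forall>n::nat. \<gamma> n \<in> carrier G) \<and> (\<forall>t\<in>F. \<forall>x\<in>C. t \<otimes> x \<notin> C) \<and>
     (\<forall>m n x y. m \<noteq> n \<and> x \<in> carrier G - C \<and> y \<in> carrier G - C \<longrightarrow> \<gamma> m \<otimes> x \<noteq> \<gamma> n \<otimes> y)))"

definition conj_avg :: "nat \<Rightarrow> (nat \<Rightarrow> 'a) \<Rightarrow> 'a op \<Rightarrow> 'a op" where
  "conj_avg N \<gamma> X = (\<lambda>f x. (1 / of_nat N) * (\<Sum>i<N. (left_reg G (\<gamma> i) \<circ> X \<circ> left_reg G (inv \<gamma> i)) f x))"

lemma conj_avg_ideal:
  assumes I: "closed_ideal G (reduced_cstar G) I" and S: "S \<in> I" and \<gamma>: "\<And>n. \<gamma> n \<in> carrier G"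
  shows "conj_avg N \<gamma> S \<in> I"
proof -
  note I' = I[unfolded closed_ideal_def]
  have step: "left_reg G (\<gamma> i) \<circ> S \<circ> left_reg G (inv \<gamma> i) \<in> I" for i
  proof -
    have "left_reg G (\<gamma> i) \<in> reduced_cstar G" "left_reg G (inv \<gamma> i) \<in> reduced_cstar G"
      using \<gamma> by (auto intro!: left_reg_reduced_cstar)
    then show ?thesis using I' S by blast
  qed
  have "(\<lambda>f x. \<Sum>i<m. (left_reg G (\<gamma> i) \<circ> S \<circ> left_reg G (inv \<gamma> i)) f x) \<in> I" for m :: nat
  proof (induction m)
    case 0
    have "op_zero \<in> I" using I' by blast
    then show ?case by (simp add: op_zero_def)
  next
    case (Suc m)
    have "op_add (\<lambda>f x. \<Sum>i<m. (left_reg G (\<gamma> i) \<circ> S \<circ> left_reg G (inv \<gamma> i)) f x)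
        (left_reg G (\<gamma> m) \<circ> S \<circ> left_reg G (inv \<gamma> m)) \<in> I"
      using I' Suc step by blast
    then show ?case by (simp add: op_add_def)
  qed
  then have "op_scale (1 / of_nat N) (\<lambda>f x. \<Sum>i<N. (left_reg G (\<gamma> i) \<circ> S \<circ> left_reg G (inv \<gamma> i)) f x) \<in> I"
    using I' by blast
  then show ?thesis by (simp add: op_scale_def conj_avg_def)
qed

lemma l2norm_mean_le:
  assumes N: "N > 0" and u: "\<And>i. i < N \<Longrightarrow> u i \<in> l2 G" "\<And>i. i < N \<Longrightarrow> l2norm G (u i) \<le> B"
  shows "(\<lambda>x. (1 / of_nat N) * (\<Sum>i<N. u i x)) \<in> l2 G"
    "l2norm G (\<lambda>x. (1 / of_nat N) * (\<Sum>i<N. u i x)) \<le> B"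
proof -
  have s: "(\<lambda>x. \<Sum>i<N. u i x) \<in> l2 G" "l2norm G (\<lambda>x. \<Sum>i<N. u i x) \<le> (\<Sum>i<N. l2norm G (u i))"
    using l2_sum[of "{..<N}" u] u by auto
  show "(\<lambda>x. (1 / of_nat N) * (\<Sum>i<N. u i x)) \<in> l2 G" by (rule l2_scale(1)[OF s(1)])
  have "(\<Sum>i<N. l2norm G (u i)) \<le> real N * B" using sum_bounded_above[of "{..<N}" "\<lambda>i. l2norm G (u i)" B] u by simp
  then have le: "l2norm G (\<lambda>x. \<Sum>i<N. u i x) \<le> real N * B" using s(2) by linarith
  have "l2norm G (\<lambda>x. (1 / of_nat N) * (\<Sum>i<N. u i x)) \<le> cmod (1 / of_nat N) * l2norm G (\<lambda>x. \<Sum>i<N. u i x)"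
    by (rule l2_scale(2)[OF s(1)])
  also have "\<dots> \<le> (1 / real N) * (real N * B)"
    using mult_left_mono[OF le, of "1 / real N"] by (simp add: norm_divide)
  also have "\<dots> = B" using N by simp
  finally show "l2norm G (\<lambda>x. (1 / of_nat N) * (\<Sum>i<N. u i x)) \<le> B" .
qed

text \<open>The number \<open>S delta \<one>\<close> is the canonical trace of \<open>S\<close>. The
  error has three sources, each contributing at most \<open>e\<close>: the replacement of
  \<open>S\<close> by the group algebra element \<open>A\<close>, the averaged conjugates of the
  nontrivial elements in \<open>A\<close>, and the difference between the coefficient of
  \<open>A\<close> at the identity and the trace of \<open>S\<close>. For the second,
  \<open>powers_estimate\<close> gives \<open>2 / sqrt N\<close> per unit coefficient.\<close>

lemma conj_avg_near_scalar:
  assumes b: "bounded_op G S" and fin: "finite S0" "S0 \<subseteq> carrier G"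
    and A: "A = (\<lambda>f x. \<Sum>g\<in>S0. c g * left_reg G g f x)"
    and close: "opnorm G (op_diff S A) < e"
    and \<gamma>: "\<And>n. \<gamma> n \<in> carrier G"
    and C1: "\<And>t x. t \<in> S0 - {\<one>} \<Longrightarrow> x \<in> C \<Longrightarrow> t \<otimes> x \<notin> C"
    and C2: "\<And>m n x y. m \<noteq> n \<Longrightarrow> x \<in> carrier G - C \<Longrightarrow> y \<in> carrier G - C \<Longrightarrow> \<gamma> m \<otimes> x \<noteq> \<gamma> n \<otimes> y"
    and N: "N > 0" "(\<Sum>g\<in>S0 - {\<one>}. cmod (c g)) * (2 / sqrt (real N)) \<le> e"
    and f: "f \<in> l2 G"
  shows "l2norm G (\<lambda>x. conj_avg N \<gamma> S f x - S delta \<one> * f x) \<le> 3 * e * l2norm G f"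
proof -
  define d where "d = S delta \<one>"
  define c1 where "c1 = (if \<one> \<in> S0 then c \<one> else 0)"
  have bA: "bounded_op G A"
  proof -
    have "A \<in> group_algebra_ops G" unfolding group_algebra_ops_def using A fin by blast
    then show ?thesis using bounded_op_lop unfolding group_algebra_ops_lop by blast
  qed
  note bd = bounded_op_diff[OF b bA]
  have small: "l2norm G (op_diff S A h) \<le> e * l2norm G h" if "h \<in> l2 G" for h
    using opnorm_bound[OF bd that] close mult_right_mono[of "opnorm G (op_diff S A)" e "l2norm G h"]
      l2norm_nonneg[of h] by simp
  have e0: "e \<ge> 0" using close opnorm_nonneg[OF bd] by simp
  have dc: "cmod (c1 - d) \<le> e"
  proof -
    have "A delta \<one> = c1" using group_algebra_delta[OF fin one_closed, of c] by (simp add: A c1_def)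
    then have "op_diff S A delta \<one> = d - c1" by (simp add: op_diff_def d_def)
    then have "cmod (c1 - d) \<le> l2norm G (op_diff S A delta)"
      using cmod_le_l2norm[OF bounded_opD(1)[OF bd delta(1)], of \<one>] by (simp add: norm_minus_commute)
    also have "\<dots> \<le> e" using small[OF delta(1)] delta(2) e0 mult_left_mono[of "l2norm G delta" 1 e] by simp
    finally show ?thesis .
  qed
  define \<phi> where "\<phi> = (\<lambda>i. left_reg G (inv \<gamma> i) f)"
  have \<phi>: "\<phi> i \<in> l2 G" "l2norm G (\<phi> i) \<le> l2norm G f" for i
    using l2_left_reg[OF f, of "inv \<gamma> i"] \<gamma> by (simp_all add: \<phi>_def)
  define u where "u = (\<lambda>x. (1 / of_nat N) * (\<Sum>i<N. left_reg G (\<gamma> i) (op_diff S A (\<phi> i)) x))"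
  define s where "s = (\<lambda>g x. \<Sum>i<N. left_reg G (\<gamma> i \<otimes> g \<otimes> inv \<gamma> i) f x)"
  define v where "v = (\<lambda>x. \<Sum>g\<in>S0 - {\<one>}. (c g / of_nat N) * s g x)"
  define w where "w = (\<lambda>x. (c1 - d) * f x)"
  have u: "u \<in> l2 G" "l2norm G u \<le> e * l2norm G f"
  proof -
    have 1: "left_reg G (\<gamma> i) (op_diff S A (\<phi> i)) \<in> l2 G" for i
      using l2_left_reg(1)[OF bounded_opD(1)[OF bd \<phi>(1)] \<gamma>] .
    have 2: "l2norm G (left_reg G (\<gamma> i) (op_diff S A (\<phi> i))) \<le> e * l2norm G f" for i
    proof -
      have "l2norm G (left_reg G (\<gamma> i) (op_diff S A (\<phi> i))) \<le> l2norm G (op_diff S A (\<phi> i))"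
        using l2_left_reg(2)[OF bounded_opD(1)[OF bd \<phi>(1)] \<gamma>] .
      also have "\<dots> \<le> e * l2norm G (\<phi> i)" by (rule small[OF \<phi>(1)])
      also have "\<dots> \<le> e * l2norm G f" using \<phi>(2) e0 by (rule mult_left_mono)
      finally show ?thesis .
    qed
    show "u \<in> l2 G" "l2norm G u \<le> e * l2norm G f"
      unfolding u_def using l2norm_mean_le[OF N(1) 1 2] by auto
  qed
  have s: "s g \<in> l2 G" "l2norm G (s g) \<le> 2 * sqrt (real N) * l2norm G f" if g: "g \<in> S0 - {\<one>}" for g
  proof -
    have gc: "g \<in> carrier G" using g fin by blast
    have tc: "\<gamma> i \<otimes> g \<otimes> inv \<gamma> i \<in> carrier G" for i using gc \<gamma> by simp
    show "s g \<in> l2 G" unfolding s_def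
      using l2_sum[of "{..<N}" "\<lambda>i. left_reg G (\<gamma> i \<otimes> g \<otimes> inv \<gamma> i) f"] l2_left_reg(1)[OF f tc] by simp
    \<comment> \<open>These are the disjoint translates of the complement of \<open>C\<close>. That
      \<open>g\<close> moves \<open>C\<close> off itself becomes, after conjugation by
      \<open>\<gamma> i\<close>, that the conjugate carries the complement of \<open>D i\<close>
      into \<open>D i\<close>.\<close>
    define D where "D = (\<lambda>i. (\<lambda>x. \<gamma> i \<otimes> x) ` (carrier G - C))"
    show "l2norm G (s g) \<le> 2 * sqrt (real N) * l2norm G f" unfolding s_def
    proof (rule powers_estimate[OF f tc, where D = D])
      fix i j :: nat assume "i \<noteq> j"
      then show "D i \<inter> D j = {}" unfolding D_def using C2[of i j] by blast
    next
      fix i :: nat and x assume x: "x \<in> carrier G" "x \<notin> D i"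
      define y where "y = inv \<gamma> i \<otimes> x"
      have yc: "y \<in> carrier G" using x \<gamma> by (simp add: y_def)
      have "\<gamma> i \<otimes> y = x" using x \<gamma> by (simp add: y_def flip: m_assoc)
      then have "y \<in> C" using x yc unfolding D_def by blast
      then have "g \<otimes> y \<notin> C" using C1[OF g] by blast
      then have "\<gamma> i \<otimes> (g \<otimes> y) \<in> D i" using gc yc unfolding D_def by blast
      moreover have "\<gamma> i \<otimes> g \<otimes> inv \<gamma> i \<otimes> x = \<gamma> i \<otimes> (g \<otimes> y)"
        using gc x \<gamma> by (simp add: y_def m_assoc)
      ultimately show "\<gamma> i \<otimes> g \<otimes> inv \<gamma> i \<otimes> x \<in> D i" by simp
    qed
  qed
  have v: "v \<in> l2 G" "l2norm G v \<le> e * l2norm G f"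
  proof -
    have 1: "(\<lambda>x. (c g / of_nat N) * s g x) \<in> l2 G" if "g \<in> S0 - {\<one>}" for g
      using l2_scale(1)[OF s(1)[OF that]] .
    have 2: "l2norm G (\<lambda>x. (c g / of_nat N) * s g x) \<le> cmod (c g) * (2 / sqrt (real N)) * l2norm G f"
      if g: "g \<in> S0 - {\<one>}" for g
    proof -
      have "l2norm G (\<lambda>x. (c g / of_nat N) * s g x) \<le> cmod (c g / of_nat N) * l2norm G (s g)"
        using l2_scale(2)[OF s(1)[OF g]] .
      also have "\<dots> \<le> cmod (c g / of_nat N) * (2 * sqrt (real N) * l2norm G f)"
        using s(2)[OF g] by (rule mult_left_mono) simp
      also have "\<dots> = cmod (c g) * (2 * (sqrt (real N) / real N)) * l2norm G f" by (simp add: norm_divide)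
      also have "sqrt (real N) / real N = 1 / sqrt (real N)" using N by (simp add: real_div_sqrt field_simps)
      finally show ?thesis by simp
    qed
    have l: "v \<in> l2 G \<and> l2norm G v \<le> (\<Sum>g\<in>S0 - {\<one>}. l2norm G (\<lambda>x. (c g / of_nat N) * s g x))"
      unfolding v_def using fin 1 by (intro l2_sum) auto
    then show "v \<in> l2 G" by simp
    have "(\<Sum>g\<in>S0 - {\<one>}. l2norm G (\<lambda>x. (c g / of_nat N) * s g x)) \<le>
        (\<Sum>g\<in>S0 - {\<one>}. cmod (c g) * (2 / sqrt (real N)) * l2norm G f)" by (intro sum_mono 2)
    also have "\<dots> = (\<Sum>g\<in>S0 - {\<one>}. cmod (c g)) * (2 / sqrt (real N)) * l2norm G f"
      by (simp only: sum_distrib_right)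
    also have "\<dots> \<le> e * l2norm G f" using N(2) l2norm_nonneg by (rule mult_right_mono)
    finally show "l2norm G v \<le> e * l2norm G f" using l by linarith
  qed
  have w: "w \<in> l2 G" "l2norm G w \<le> e * l2norm G f"
  proof -
    show "w \<in> l2 G" unfolding w_def by (rule l2_scale(1)[OF f])
    have "l2norm G w \<le> cmod (c1 - d) * l2norm G f" unfolding w_def by (rule l2_scale(2)[OF f])
    also have "\<dots> \<le> e * l2norm G f" using dc l2norm_nonneg by (rule mult_right_mono)
    finally show "l2norm G w \<le> e * l2norm G f" .
  qed
  have eq: "conj_avg N \<gamma> S f x - d * f x = u x + v x + w x" for x
  proof -
    have A\<phi>: "left_reg G (\<gamma> i) (A (\<phi> i)) x = (\<Sum>g\<in>S0. c g * left_reg G (\<gamma> i \<otimes> g \<otimes> inv \<gamma> i) f x)" for i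
    proof -
      have "left_reg G (\<gamma> i) (A (\<phi> i)) x = (\<Sum>g\<in>S0. c g * left_reg G (\<gamma> i) (left_reg G g (\<phi> i)) x)"
        unfolding left_reg_apply[OF bounded_opD(1)[OF bA \<phi>(1)]]
        using fin by (simp add: A left_reg_apply[OF l2_left_reg(1)[OF \<phi>(1)]] subset_iff)
      also have "\<dots> = (\<Sum>g\<in>S0. c g * left_reg G (\<gamma> i \<otimes> g \<otimes> inv \<gamma> i) f x)"
      proof (rule sum.cong[OF refl])
        fix g assume "g \<in> S0"
        then have gc: "g \<in> carrier G" using fin by blast
        have "left_reg G (\<gamma> i) (left_reg G g (\<phi> i)) = (left_reg G (\<gamma> i) \<circ> left_reg G g \<circ> left_reg G (inv \<gamma> i)) f"
          by (simp add: \<phi>_def)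
        also have "left_reg G (\<gamma> i) \<circ> left_reg G g \<circ> left_reg G (inv \<gamma> i) = left_reg G (\<gamma> i \<otimes> g \<otimes> inv \<gamma> i)"
          using left_reg_comp[OF \<gamma> gc] left_reg_comp[of "\<gamma> i \<otimes> g" "inv \<gamma> i"] gc \<gamma> by simp
        finally show "c g * left_reg G (\<gamma> i) (left_reg G g (\<phi> i)) x = c g * left_reg G (\<gamma> i \<otimes> g \<otimes> inv \<gamma> i) f x"
          by simp
      qed
      finally show ?thesis .
    qed
    have "left_reg G (\<gamma> i) (op_diff S A (\<phi> i)) x = left_reg G (\<gamma> i) (S (\<phi> i)) x - left_reg G (\<gamma> i) (A (\<phi> i)) x" for i
      using bounded_opD(1)[OF bd \<phi>(1)] bounded_opD(1)[OF b \<phi>(1)] bounded_opD(1)[OF bA \<phi>(1)]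
      by (simp add: left_reg_apply) (simp add: op_diff_def)
    then have Sx: "left_reg G (\<gamma> i) (S (\<phi> i)) x = left_reg G (\<gamma> i) (op_diff S A (\<phi> i)) x +
        (\<Sum>g\<in>S0. c g * left_reg G (\<gamma> i \<otimes> g \<otimes> inv \<gamma> i) f x)" for i
      using A\<phi> by simp
    have "conj_avg N \<gamma> S f x = u x + (1 / of_nat N) * (\<Sum>i<N. \<Sum>g\<in>S0. c g * left_reg G (\<gamma> i \<otimes> g \<otimes> inv \<gamma> i) f x)"
    proof -
      have "(left_reg G (\<gamma> i) \<circ> S \<circ> left_reg G (inv \<gamma> i)) f x = left_reg G (\<gamma> i) (S (\<phi> i)) x" for i
        by (simp add: \<phi>_def)
      then show ?thesis unfolding conj_avg_def u_def by (simp only: Sx sum.distrib distrib_left)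
    qed
    also have "(\<Sum>i<N. \<Sum>g\<in>S0. c g * left_reg G (\<gamma> i \<otimes> g \<otimes> inv \<gamma> i) f x) = (\<Sum>g\<in>S0. c g * s g x)"
      unfolding s_def sum_distrib_left by (rule sum.swap)
    also have "\<dots> = c1 * (of_nat N * f x) + (\<Sum>g\<in>S0 - {\<one>}. c g * s g x)"
    proof -
      have "s \<one> x = of_nat N * f x" unfolding s_def using \<gamma> f by (simp add: left_reg_one)
      then show ?thesis using fin by (cases "\<one> \<in> S0") (simp_all add: sum.remove c1_def)
    qed
    also have "(1 / of_nat N) * (c1 * (of_nat N * f x) + (\<Sum>g\<in>S0 - {\<one>}. c g * s g x)) = c1 * f x + v x"
      using N(1) by (simp add: v_def distrib_left sum_distrib_left add_divide_distrib sum_divide_distrib)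
    finally show ?thesis by (simp add: w_def algebra_simps)
  qed
  have "l2norm G (\<lambda>x. (u x + v x) + w x) \<le> l2norm G u + l2norm G v + l2norm G w"
    using l2_add[OF u(1) v(1)] l2_add[OF l2_add(1)[OF u(1) v(1)] w(1)] by linarith
  then show ?thesis using u v w eq by (simp add: d_def)
qed

text \<open>A nonzero element of the ideal has a translate with nonzero trace \<open>d\<close>.
  Averages of conjugates of that translate remain in the ideal and approach \<open>d\<close> times
  the identity.\<close>

lemma powers_group_cstar_simple:
  assumes powers: powers_group
  shows "cstar_simple G"
  unfolding cstar_simple_def
proof (intro allI impI)
  fix I assume I: "closed_ideal G (reduced_cstar G) I"
  note I' = I[unfolded closed_ideal_def]
  show "I = {op_zero} \<or> I = reduced_cstar G"
  proof (rule disjCI)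
    assume "I \<noteq> reduced_cstar G"
    show "I = {op_zero}"
    proof (rule ccontr)
      assume "I \<noteq> {op_zero}"
      then obtain T where T: "T \<in> I" "T \<noteq> op_zero" using I' by blast
      have TR: "T \<in> reduced_cstar G" using T I' by blast
      then obtain q where q: "q \<in> carrier G" "T delta q \<noteq> 0" using reduced_cstar_separating T by blast
      have bT: "bounded_op G T" using TR by (simp add: reduced_cstar_def)
      \<comment> \<open>Translation by \<open>inv q\<close> brings the nonzero entry
        \<open>T delta q\<close> to the identity, where it becomes the trace.\<close>
      define S where "S = left_reg G (inv q) \<circ> T"
      have SI: "S \<in> I" unfolding S_def using I' T left_reg_reduced_cstar[of "inv q"] q by blast
      then have SR: "S \<in> reduced_cstar G" using I' by blast
      have bS: "bounded_op G S" using SR by (simp add: reduced_cstar_def)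
      define d where "d = S delta \<one>"
      have "d = T delta q" using q bounded_opD(1)[OF bT delta(1)] by (simp add: d_def S_def left_reg_apply)
      then have d: "d \<noteq> 0" using q by simp
      have "\<exists>X\<in>I. opnorm G (op_diff (left_reg G \<one>) X) < e" if e: "e > 0" for e
      proof -
        \<comment> \<open>The averages come within \<open>3 * e'\<close> of \<open>d\<close> times
          the identity. After division by \<open>d\<close> the denominator 4 leaves three quarters
          of \<open>e\<close>, hence a strict inequality.\<close>
        define e' where "e' = e * cmod d / 4"
        have e': "e' > 0" using e d by (simp add: e'_def)
        obtain A where A: "A \<in> group_algebra_ops G" "opnorm G (op_diff S A) < e'"
          using SR e' unfolding reduced_cstar_def by blast
        obtain S0 c where S0: "A = (\<lambda>f x. \<Sum>g\<in>S0. c g * left_reg G g f x)" "finite S0" "S0 \<subseteq> carrier G"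
          using A unfolding group_algebra_ops_def by blast
        have "finite (S0 - {\<one>})" "S0 - {\<one>} \<subseteq> carrier G - {\<one>}" using S0 by auto
        then have "\<exists>C \<gamma>. (\<forall>n::nat. \<gamma> n \<in> carrier G) \<and> (\<forall>t\<in>S0 - {\<one>}. \<forall>x\<in>C. t \<otimes> x \<notin> C) \<and>
            (\<forall>m n x y. m \<noteq> n \<and> x \<in> carrier G - C \<and> y \<in> carrier G - C \<longrightarrow> \<gamma> m \<otimes> x \<noteq> \<gamma> n \<otimes> y)"
          by (intro powers[unfolded powers_group_def, THEN spec, THEN mp] conjI)
        then obtain C \<gamma> where C': "\<forall>n::nat. \<gamma> n \<in> carrier G"
          "\<forall>t\<in>S0 - {\<one>}. \<forall>x\<in>C. t \<otimes> x \<notin> C"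
          "\<forall>m n x y. m \<noteq> n \<and> x \<in> carrier G - C \<and> y \<in> carrier G - C \<longrightarrow> \<gamma> m \<otimes> x \<noteq> \<gamma> n \<otimes> y"
          by (elim exE conjE)
        have C: "\<And>n::nat. \<gamma> n \<in> carrier G"
          "\<And>t x. t \<in> S0 - {\<one>} \<Longrightarrow> x \<in> C \<Longrightarrow> t \<otimes> x \<notin> C"
          "\<And>m n x y. m \<noteq> n \<Longrightarrow> x \<in> carrier G - C \<Longrightarrow> y \<in> carrier G - C \<Longrightarrow> \<gamma> m \<otimes> x \<noteq> \<gamma> n \<otimes> y"
          using C' by blast+
        define M where "M = (\<Sum>g\<in>S0 - {\<one>}. cmod (c g))"
        have M: "M \<ge> 0" unfolding M_def by (intro sum_nonneg) auto
        \<comment> \<open>Chosen so that \<open>M * (2 / sqrt N)\<close> is at most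
          \<open>e'\<close>.\<close>
        obtain N :: nat where N: "N > (2 * M / e')\<^sup>2" using reals_Archimedean2 by blast
        have N0: "N > 0" using N by (metis gr0I of_nat_0 not_less zero_le_power2)
        have "2 * M / e' \<le> sqrt (real N)" using N by (intro real_le_rsqrt) simp
        then have "M * (2 / sqrt (real N)) \<le> e'" using e' N0 by (simp add: field_simps)
        then have Me: "(\<Sum>g\<in>S0 - {\<one>}. cmod (c g)) * (2 / sqrt (real N)) \<le> e'" by (simp only: M_def)
        have near: "l2norm G (\<lambda>x. conj_avg N \<gamma> S f x - d * f x) \<le> 3 * e' * l2norm G f" if "f \<in> l2 G" for f
          unfolding d_def by (rule conj_avg_near_scalar[OF bS S0(2,3,1) A(2) C N0 Me that])
        define X where "X = op_scale (1 / d) (conj_avg N \<gamma> S)"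
        have avgI: "conj_avg N \<gamma> S \<in> I" by (rule conj_avg_ideal[OF I SI C(1)])
        then have XI: "X \<in> I" unfolding X_def using I' by blast
        have bavg: "bounded_op G (conj_avg N \<gamma> S)"
        proof -
          have "conj_avg N \<gamma> S \<in> reduced_cstar G" using avgI I' by blast
          then show ?thesis by (simp add: reduced_cstar_def)
        qed
        have "opnorm G (op_diff (left_reg G \<one>) X) \<le> 3 * e' / cmod d"
        proof (rule opnorm_le)
          show "0 \<le> 3 * e' / cmod d" using e' by simp
          fix f assume f: "f \<in> l2 G"
          define h where "h = (\<lambda>x. conj_avg N \<gamma> S f x - d * f x)"
          have h: "h \<in> l2 G" unfolding h_def
            using bounded_opD(1)[OF bavg f] l2_scale(1)[OF f] by (intro l2_diff)
          have "op_diff (left_reg G \<one>) X f = (\<lambda>x. (- 1 / d) * h x)"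
            using f d by (simp add: op_diff_def left_reg_one X_def op_scale_def h_def fun_eq_iff field_simps)
          then have "l2norm G (op_diff (left_reg G \<one>) X f) \<le> cmod (- 1 / d) * l2norm G h"
            by (simp only: l2_scale(2)[OF h])
          also have "\<dots> \<le> (1 / cmod d) * (3 * e' * l2norm G f)"
            using near[OF f] d by (simp add: h_def norm_divide divide_right_mono)
          finally show "l2norm G (op_diff (left_reg G \<one>) X f) \<le> 3 * e' / cmod d * l2norm G f" by simp
        qed
        also have "3 * e' / cmod d < e" using d e by (simp add: e'_def)
        finally show ?thesis using XI by blast
      qed
      then have oneI: "left_reg G \<one> \<in> I" using I' left_reg_reduced_cstar[OF one_closed] by blast
      have "X \<in> I" if X: "X \<in> reduced_cstar G" for X
      proof -
        have bX: "bounded_op G X" using X by (simp add: reduced_cstar_def)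
        \<comment> \<open>On \<open>l2 G\<close> the factor is the identity; elsewhere both sides
          vanish, because operators are normalised to be 0 there.\<close>
        have "X \<circ> left_reg G \<one> = X"
        proof
          fix f
          show "(X \<circ> left_reg G \<one>) f = X f"
          proof (cases "f \<in> l2 G")
            case False
            have "X (\<lambda>x. 0) = (\<lambda>x. 0)" using bounded_opD(4)[OF bX l2_zero(1), of 0] by simp
            then show ?thesis using False bounded_opD(2)[OF bX False] by (simp add: left_reg_outside)
          qed (simp add: left_reg_one)
        qed
        moreover have "X \<circ> left_reg G \<one> \<in> I" using I' oneI X by blast
        ultimately show ?thesis by simp
      qed
      then show False using \<open>I \<noteq> reduced_cstar G\<close> I' by blast
    qed
  qed
qed

end

section \<open>Reduced words in an amalgam\<close>

context group
begin

lemma cancel_inv: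
  assumes "x \<in> carrier G" "y \<in> carrier G"
  shows "x \<otimes> (inv x \<otimes> y) = y" "inv x \<otimes> (x \<otimes> y) = y"
  using assms by (simp_all flip: m_assoc)

end

locale amalgam =
  fixes G (structure) and G0 G1 H :: "'a set"
  assumes amalgam: "is_amalgam G G0 G1 H"
begin

sublocale group G
  using amalgam unfolding is_amalgam_def by blast

text \<open>Only the parity of the index counts, so a position along a word can be added to an index
  without reducing it.\<close>

definition factor :: "nat \<Rightarrow> 'a set" where
  "factor i = (if even i then G0 else G1)"

lemma factor_cong: "even i = even j \<Longrightarrow> factor i = factor j"
  by (simp add: factor_def)

lemma factor_subgroup: "subgroup (factor i) G"
  using amalgam unfolding is_amalgam_def factor_def by auto

lemma H_eq: "H = G0 \<inter> G1"
  using amalgam unfolding is_amalgam_def by auto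

lemma H_subgroup: "subgroup H G"
  using subgroups_Inter_pair[of G0 G1] factor_subgroup[of 0] factor_subgroup[of 1]
  by (simp add: H_eq factor_def)

lemma H_factor: "h \<in> H \<Longrightarrow> h \<in> factor i"
  by (simp add: H_eq factor_def)

lemma H_carrier: "h \<in> H \<Longrightarrow> h \<in> carrier G"
  using H_subgroup subgroup.mem_carrier by metis

lemma factor_carrier: "x \<in> factor i \<Longrightarrow> x \<in> carrier G"
  using factor_subgroup subgroup.mem_carrier by metis

lemma factor_m_closed: "x \<in> factor i \<Longrightarrow> y \<in> factor i \<Longrightarrow> x \<otimes> y \<in> factor i"
  using factor_subgroup subgroup.m_closed by metis

lemma factor_inv_closed: "x \<in> factor i \<Longrightarrow> inv x \<in> factor i"
  using factor_subgroup subgroup.m_inv_closed by metis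

lemmas H_m_closed = subgroup.m_closed[OF H_subgroup]
lemmas H_inv_closed = subgroup.m_inv_closed[OF H_subgroup]
lemmas H_one_closed = subgroup.one_closed[OF H_subgroup]

lemma H_mult_left_iff:
  assumes "h \<in> H" "x \<in> carrier G" shows "h \<otimes> x \<in> H \<longleftrightarrow> x \<in> H"
proof
  assume "h \<otimes> x \<in> H"
  then have "inv h \<otimes> (h \<otimes> x) \<in> H" by (rule H_m_closed[OF H_inv_closed[OF assms(1)]])
  then show "x \<in> H" using assms H_carrier by (simp add: cancel_inv)
qed (use assms H_m_closed in blast)

lemma H_mult_right_iff:
  assumes "h \<in> H" "x \<in> carrier G" shows "x \<otimes> h \<in> H \<longleftrightarrow> x \<in> H"
proof
  assume "x \<otimes> h \<in> H"
  then have "x \<otimes> h \<otimes> inv h \<in> H" by (rule H_m_closed[OF _ H_inv_closed[OF assms(1)]])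
  then show "x \<in> H" using assms H_carrier by (simp add: m_assoc)
qed (use assms H_m_closed in blast)

lemma H_inv_iff: "x \<in> carrier G \<Longrightarrow> inv x \<in> H \<longleftrightarrow> x \<in> H"
  by (metis H_inv_closed inv_inv)

text \<open>The sets of \<open>T_set\<close>, by recursion on the first letter. Ending in
  \<open>H\<close> rather than in the identity changes nothing at positive length, since the last
  letter absorbs \<open>H\<close>, and it makes length 0 agree.\<close>

primrec Tw :: "nat \<Rightarrow> nat \<Rightarrow> 'a set" where
  "Tw 0 i = H"
| "Tw (Suc k) i = {x \<otimes> w | x w. x \<in> factor i - H \<and> w \<in> Tw k (Suc i)}"

lemma Tw_cong: "even i = even j \<Longrightarrow> Tw k i = Tw k j"
proof (induction k arbitrary: i j)
  case (Suc k)
  have "Tw k (Suc i) = Tw k (Suc j)" by (rule Suc.IH) (simp add: Suc.prems)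
  moreover have "factor i = factor j" by (rule factor_cong) (rule Suc.prems)
  ultimately show ?case by simp
qed simp

lemma Tw_carrier: "w \<in> Tw k i \<Longrightarrow> w \<in> carrier G"
proof (induction k arbitrary: i w)
  case 0
  then show ?case by (simp add: H_carrier)
next
  case (Suc k)
  then obtain x v where "w = x \<otimes> v" "x \<in> factor i" "v \<in> Tw k (Suc i)" by auto
  then show ?case using Suc.IH[of v "Suc i"] factor_carrier[of x i] by simp
qed

lemma Tw_SucI: "x \<in> factor i \<Longrightarrow> x \<notin> H \<Longrightarrow> w \<in> Tw k (Suc i) \<Longrightarrow> x \<otimes> w \<in> Tw (Suc k) i"
  by auto

lemma Tw_SucE:
  assumes "w \<in> Tw (Suc k) i"
  obtains x v where "w = x \<otimes> v" "x \<in> factor i" "x \<notin> H" "v \<in> Tw k (Suc i)"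
  using assms by auto

declare Tw.simps(2)[simp del]

lemma Tw_H_left:
  assumes "h \<in> H" "w \<in> Tw k i" shows "h \<otimes> w \<in> Tw k i"
proof (cases k)
  case 0
  then show ?thesis using assms H_m_closed by simp
next
  case (Suc l)
  then obtain x v where w: "w = x \<otimes> v" "x \<in> factor i" "x \<notin> H" "v \<in> Tw l (Suc i)"
    using assms Tw_SucE by metis
  have "h \<otimes> w = (h \<otimes> x) \<otimes> v"
    using w assms by (simp add: m_assoc H_carrier factor_carrier Tw_carrier)
  moreover have "h \<otimes> x \<in> factor i - H"
    using w assms H_mult_left_iff[of h x] factor_carrier[of x i] H_factor[of h i]
      factor_m_closed[of h i x] by blast
  ultimately show ?thesis using Suc w Tw_SucI by simp
qed

lemma Tw_one: "x \<in> factor i - H \<Longrightarrow> x \<in> Tw 1 i"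
  using Tw_SucI[of x i \<one> 0] H_one_closed factor_carrier[of x i] by simp

text \<open>For nonempty words the parity condition says that the last letter of \<open>w\<close>
  and the first letter of \<open>v\<close> lie in different factors, so the concatenation is again
  reduced.\<close>

lemma Tw_mult:
  assumes "w \<in> Tw k i" "v \<in> Tw l j" "even j = even (i + k)"
  shows "w \<otimes> v \<in> Tw (k + l) i"
  using assms
proof (induction k arbitrary: i w)
  case 0
  then show ?case using Tw_H_left Tw_cong[of i j l] by simp
next
  case (Suc k)
  then obtain x u where w: "w = x \<otimes> u" "x \<in> factor i" "x \<notin> H" "u \<in> Tw k (Suc i)"
    using Tw_SucE by metis
  have "u \<otimes> v \<in> Tw (k + l) (Suc i)" using Suc.IH[OF w(4)] Suc.prems by simp
  moreover have "w \<otimes> v = x \<otimes> (u \<otimes> v)"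
    using w Suc.prems by (simp add: m_assoc factor_carrier Tw_carrier)
  ultimately show ?case using w Tw_SucI by simp
qed

text \<open>Inversion reverses a word, and for positive \<open>k\<close> the last letter of
  \<open>w\<close> has index \<open>i + k - 1\<close>, of the same parity as
  \<open>Suc (i + k)\<close>.\<close>

lemma Tw_inv:
  "w \<in> Tw k i \<Longrightarrow> inv w \<in> Tw k (Suc (i + k))"
proof (induction k arbitrary: i w)
  case 0
  then show ?case using H_inv_closed by simp
next
  case (Suc k)
  then obtain x u where w: "w = x \<otimes> u" "x \<in> factor i" "x \<notin> H" "u \<in> Tw k (Suc i)"
    using Tw_SucE by metis
  have "inv x \<in> Tw 1 i"
    using w by (intro Tw_one) (auto simp: factor_inv_closed H_inv_iff factor_carrier)
  moreover have "inv u \<in> Tw k (Suc (Suc i + k))" using Suc.IH w by blast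
  ultimately have "inv u \<otimes> inv x \<in> Tw (k + 1) (Suc (Suc i + k))"
    by (intro Tw_mult) auto
  then show ?case using w by (simp add: inv_mult_group factor_carrier Tw_carrier)
qed

lemma alt_word_Cons:
  "alt_word G0 G1 H i (x # xs) \<longleftrightarrow> x \<in> factor i - H \<and> alt_word G0 G1 H (Suc i) xs"
  unfolding alt_word_def factor_def by (simp add: All_less_Suc2)

lemma word_prod_Cons: "word_prod G (x # xs) = x \<otimes> word_prod G xs"
  by (simp add: word_prod_def)

lemma Tw_eq_words:
  "Tw (Suc k) i = {word_prod G xs | xs. length xs = Suc k \<and> alt_word G0 G1 H i xs}"
proof (induction k arbitrary: i)
  case 0
  have Tw: "Tw (Suc 0) i = factor i - H"
  proof
    show "Tw (Suc 0) i \<subseteq> factor i - H"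
    proof
      fix w assume "w \<in> Tw (Suc 0) i"
      then obtain x h where "w = x \<otimes> h" "x \<in> factor i" "x \<notin> H" "h \<in> H"
        by (rule Tw_SucE) simp
      then show "w \<in> factor i - H"
        using H_mult_right_iff[of h x] factor_carrier[of x i] H_factor[of h i] factor_m_closed[of x i h]
        by blast
    qed
    show "factor i - H \<subseteq> Tw (Suc 0) i" using Tw_one by auto
  qed
  have wp: "word_prod G [x] = x" if "x \<in> factor i" for x
    using that by (simp add: word_prod_def factor_carrier)
  have alt: "alt_word G0 G1 H i [x] \<longleftrightarrow> x \<in> factor i - H" for x
    by (simp add: alt_word_Cons) (simp add: alt_word_def)
  show ?case unfolding Tw
  proof (intro equalityI subsetI)
    fix x assume "x \<in> factor i - H"
    then show "x \<in> {word_prod G xs | xs. length xs = Suc 0 \<and> alt_word G0 G1 H i xs}"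
      using wp alt by (intro CollectI exI[of _ "[x]"]) auto
  next
    fix y assume "y \<in> {word_prod G xs | xs. length xs = Suc 0 \<and> alt_word G0 G1 H i xs}"
    then obtain x where "y = word_prod G [x]" "alt_word G0 G1 H i [x]"
      by (auto simp: length_Suc_conv)
    then show "y \<in> factor i - H" using wp alt by auto
  qed
next
  case (Suc k)
  show ?case unfolding Tw.simps(2)[of "Suc k"] Suc
  proof (intro equalityI subsetI)
    fix y assume "y \<in> {x \<otimes> w |x w. x \<in> factor i - H \<and>
        w \<in> {word_prod G xs |xs. length xs = Suc k \<and> alt_word G0 G1 H (Suc i) xs}}"
    then obtain x xs where "y = x \<otimes> word_prod G xs" "x \<in> factor i - H" "length xs = Suc k"
      "alt_word G0 G1 H (Suc i) xs" by blast
    then show "y \<in> {word_prod G xs |xs. length xs = Suc (Suc k) \<and> alt_word G0 G1 H i xs}"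
      by (intro CollectI exI[of _ "x # xs"]) (simp add: word_prod_Cons alt_word_Cons)
  next
    fix y assume "y \<in> {word_prod G xs |xs. length xs = Suc (Suc k) \<and> alt_word G0 G1 H i xs}"
    then obtain x xs where "y = word_prod G (x # xs)" "length xs = Suc k" "alt_word G0 G1 H i (x # xs)"
      by (auto simp: length_Suc_conv[of _ "Suc k"])
    then show "y \<in> {x \<otimes> w |x w. x \<in> factor i - H \<and>
        w \<in> {word_prod G xs |xs. length xs = Suc k \<and> alt_word G0 G1 H (Suc i) xs}}"
      unfolding word_prod_Cons alt_word_Cons by blast
  qed
qed

lemma T_set_eq: "T_set G G0 G1 H i k = Tw k i"
  using Tw_eq_words by (cases k) (auto simp: T_set_def)

lemma one_notin_Tw: "\<one> \<notin> Tw (Suc k) i"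
proof
  assume "\<one> \<in> Tw (Suc k) i"
  \<comment> \<open>The normal form hypothesis speaks of the indices 0 and 1 only.\<close>
  moreover have "Tw (Suc k) i = Tw (Suc k) (i mod 2)" by (rule Tw_cong) auto
  ultimately obtain xs where "length xs = Suc k" "alt_word G0 G1 H (i mod 2) xs" "word_prod G xs = \<one>"
    unfolding Tw_eq_words by auto
  moreover have "i mod 2 < 2" by simp
  ultimately show False using amalgam unfolding is_amalgam_def by (metis length_0_conv nat.distinct(1))
qed

text \<open>If \<open>w\<close> also lay in \<open>H\<close> or had a form beginning in the other
  factor, then \<open>inv w \<otimes> w\<close> would be a reduced word of positive length for the
  identity: \<open>inv w\<close> ends in the factor where the given form of \<open>w\<close>
  begins.\<close>

lemma Tw_disjoint:
  assumes "w \<in> Tw (Suc k) i" "even i \<noteq> even j" shows "w \<notin> Tw l j"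
proof
  assume "w \<in> Tw l j"
  then have "inv w \<otimes> w \<in> Tw (Suc k + l) (Suc (i + Suc k))"
    using assms by (intro Tw_mult Tw_inv) auto
  moreover have "inv w \<otimes> w = \<one>" using assms Tw_carrier by (intro l_inv) blast
  ultimately show False using one_notin_Tw[of "k + l"] by simp
qed

text \<open>An element stands for the edge given by its left coset of \<open>H\<close>. These are
  the edges strictly on one side of the base edge, which belongs to neither side.\<close>

definition halftree :: "nat \<Rightarrow> 'a set" where
  "halftree i = (\<Union>k. Tw (Suc k) i)"

lemma halftree_carrier: "w \<in> halftree i \<Longrightarrow> w \<in> carrier G"
  unfolding halftree_def using Tw_carrier by blast

lemma halftreeI: "w \<in> Tw k i \<Longrightarrow> k > 0 \<Longrightarrow> w \<in> halftree i"
  unfolding halftree_def by (cases k) auto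

lemma halftree_disjoint: "w \<in> halftree i \<Longrightarrow> even i \<noteq> even j \<Longrightarrow> w \<notin> halftree j"
  unfolding halftree_def using Tw_disjoint[of w _ i j] by auto

lemma Tw_halftree:
  assumes "s \<in> Tw m i" "w \<in> halftree j" "even j = even (i + m)" shows "s \<otimes> w \<in> halftree i"
proof -
  obtain k where "w \<in> Tw (Suc k) j" using assms by (auto simp: halftree_def)
  then have "s \<otimes> w \<in> Tw (m + Suc k) i" using assms Tw_mult by blast
  then show ?thesis by (rule halftreeI) simp
qed

text \<open>A letter outside \<open>H\<close> either lengthens the word, or merges with its first
  letter, or cancels that letter up to \<open>H\<close>. The parity of \<open>i + k\<close> is kept
  in each case; for a nonempty word it records the factor of the last letter.\<close>

lemma factor_mult_Tw:
  assumes s: "s \<in> factor a" and w: "w \<in> Tw k i" "k > 0"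
  shows "\<exists>i' k'. k \<le> k' + 1 \<and> even (i' + k') = even (i + k) \<and> s \<otimes> w \<in> Tw k' i'"
proof (cases "s \<in> H")
  case True
  then show ?thesis using Tw_H_left w by (intro exI[of _ i] exI[of _ k]) auto
next
  case sH: False
  show ?thesis
  proof (cases "even a = even i")
    case False
    then have "s \<otimes> w \<in> Tw (1 + k) a"
      using sH s w by (intro Tw_mult Tw_one) auto
    then show ?thesis using False by (intro exI[of _ a] exI[of _ "1 + k"]) auto
  next
    case True
    obtain l where l: "k = Suc l" using w by (cases k) auto
    then obtain x v where x: "w = x \<otimes> v" "x \<in> factor i" "x \<notin> H" "v \<in> Tw l (Suc i)"
      using w Tw_SucE by metis
    have s': "s \<in> factor i" using s True factor_cong by blast
    have eq: "s \<otimes> w = (s \<otimes> x) \<otimes> v"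
      using x s' by (simp add: m_assoc factor_carrier Tw_carrier)
    show ?thesis
    proof (cases "s \<otimes> x \<in> H")
      case True
      then have "s \<otimes> w \<in> Tw l (Suc i)" using eq x Tw_H_left by metis
      then show ?thesis using l by (intro exI[of _ "Suc i"] exI[of _ l]) auto
    next
      case False
      then have "s \<otimes> w \<in> Tw k i" using eq x s' factor_m_closed l Tw_SucI by metis
      then show ?thesis by (intro exI[of _ i] exI[of _ k]) auto
    qed
  qed
qed

text \<open>Left multiplication by a fixed element touches only the beginning of a sufficiently long
  word. The admissible losses \<open>r\<close> add up under products of generators.\<close>

lemma generated_mult_Tw:
  assumes "g \<in> carrier G"
  shows "\<exists>r. \<forall>k i w. w \<in> Tw k i \<and> k > r \<longrightarrow>
    (\<exists>i' k'. k \<le> k' + r \<and> even (i' + k') = even (i + k) \<and> g \<otimes> w \<in> Tw k' i')"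
proof -
  have fac: "\<exists>r. \<forall>k i w. w \<in> Tw k i \<and> k > r \<longrightarrow>
      (\<exists>i' k'. k \<le> k' + r \<and> even (i' + k') = even (i + k) \<and> s \<otimes> w \<in> Tw k' i')"
    if "s \<in> factor a" for s a
    using factor_mult_Tw[OF that] by (intro exI[of _ 1]) auto
  have gen: "generate G (G0 \<union> G1) = carrier G" using amalgam unfolding is_amalgam_def by blast
  have un: "\<exists>a. x \<in> factor a" if "x \<in> G0 \<union> G1" for x
    using that by (auto simp: factor_def intro: exI[of _ 0] exI[of _ 1])
  from assms have "g \<in> generate G (G0 \<union> G1)" using gen by simp
  then show ?thesis
  proof induction
    case one
    then show ?case using fac H_one_closed H_factor by metis
  next
    case (incl h)
    then show ?case using un fac by metis
  next
    case (inv h)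
    then show ?case using un fac factor_inv_closed by metis
  next
    case (eng h1 h2)
    then obtain r1 r2 where
      r1: "\<And>k i w. w \<in> Tw k i \<Longrightarrow> k > r1 \<Longrightarrow>
        \<exists>i' k'. k \<le> k' + r1 \<and> even (i' + k') = even (i + k) \<and> h1 \<otimes> w \<in> Tw k' i'" and
      r2: "\<And>k i w. w \<in> Tw k i \<Longrightarrow> k > r2 \<Longrightarrow>
        \<exists>i' k'. k \<le> k' + r2 \<and> even (i' + k') = even (i + k) \<and> h2 \<otimes> w \<in> Tw k' i'"
      by blast
    have c: "h1 \<in> carrier G" "h2 \<in> carrier G" using eng.hyps gen by auto
    have "\<exists>i' k'. k \<le> k' + (r1 + r2) \<and> even (i' + k') = even (i + k) \<and> (h1 \<otimes> h2) \<otimes> w \<in> Tw k' i'"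
      if wk: "w \<in> Tw k i \<and> k > r1 + r2" for k i w
    proof -
      note w = conjunct1[OF wk] conjunct2[OF wk]
      obtain i2 k2 where 2: "k \<le> k2 + r2" "even (i2 + k2) = even (i + k)" "h2 \<otimes> w \<in> Tw k2 i2"
        using r2[OF w(1)] w(2) by auto
      then have "k2 > r1" using w by linarith
      then obtain i1 k1 where 1: "k2 \<le> k1 + r1" "even (i1 + k1) = even (i2 + k2)" "h1 \<otimes> (h2 \<otimes> w) \<in> Tw k1 i1"
        using r1[OF 2(3)] by auto
      have "(h1 \<otimes> h2) \<otimes> w = h1 \<otimes> (h2 \<otimes> w)" using c w Tw_carrier by (simp add: m_assoc)
      then show ?thesis using 1 2 by (intro exI[of _ i1] exI[of _ k1]) auto
    qed
    then show ?case by (intro exI[of _ "r1 + r2"] allI) (rule impI)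
  qed
qed

text \<open>The induction over generators runs on the stronger claim that left multiplication by
  \<open>g\<close> preserves having a reduced form, which composes; the claim is used at the
  identity.\<close>

lemma carrier_Tw:
  assumes "g \<in> carrier G" shows "\<exists>k i. g \<in> Tw k i"
proof -
  have gen: "generate G (G0 \<union> G1) = carrier G" using amalgam unfolding is_amalgam_def by blast
  have fac: "\<exists>k' i'. s \<otimes> w \<in> Tw k' i'" if "s \<in> factor a" "w \<in> Tw k i" for s a w k i
  proof (cases "k = 0")
    case True
    then have "s \<otimes> w \<in> factor a" using that H_factor factor_m_closed by simp
    then show ?thesis using Tw_one[of "s \<otimes> w" a] Tw.simps(1)[of a] by blast
  next
    case False
    then show ?thesis using factor_mult_Tw that by blast
  qed
  have un: "\<exists>a. x \<in> factor a" if "x \<in> G0 \<union> G1" for x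
    using that by (auto simp: factor_def intro: exI[of _ 0] exI[of _ 1])
  from assms have "g \<in> generate G (G0 \<union> G1)" using gen by simp
  then have "\<forall>k i w. w \<in> Tw k i \<longrightarrow> (\<exists>k' i'. g \<otimes> w \<in> Tw k' i')"
  proof induction
    case one
    then show ?case using fac H_one_closed H_factor by metis
  next
    case (incl h)
    then show ?case using un fac by metis
  next
    case (inv h)
    then show ?case using un fac factor_inv_closed by metis
  next
    case (eng h1 h2)
    have "h1 \<in> carrier G" "h2 \<in> carrier G" using eng.hyps gen by auto
    then show ?case using eng.IH m_assoc Tw_carrier by metis
  qed
  then show ?thesis using H_one_closed assms by (metis Tw.simps(1) r_one)
qed

lemma carrier_cases:
  assumes "g \<in> carrier G"
  obtains (base) "g \<in> H" | (same) m where "m > 0" "g \<in> Tw m i" | (other) m where "m > 0" "g \<in> Tw m (Suc i)"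
proof -
  obtain k j where kj: "g \<in> Tw k j" using carrier_Tw assms by blast
  show ?thesis
  proof (cases "k = 0")
    case True
    then show ?thesis using kj that(1) by simp
  next
    case False
    then show ?thesis
      using kj that(2,3) Tw_cong[of j i k] Tw_cong[of j "Suc i" k] by (cases "even j = even i") auto
  qed
qed

lemma not_halftree:
  assumes "w \<in> carrier G" "w \<notin> halftree i"
  shows "w \<in> H \<or> w \<in> halftree (Suc i)"
  by (rule carrier_cases[OF assms(1), where i = i]) (use assms(2) halftreeI in blast)+

text \<open>A word of odd length that begins in factor \<open>i\<close> also ends there, so nothing
  cancels when it is followed by an element that does not begin there.\<close>

lemma odd_Tw_moves_complement:
  assumes q: "q \<in> Tw m i" "odd m" and w: "w \<in> carrier G" "w \<notin> halftree i"
  shows "q \<otimes> w \<in> halftree i"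
  using not_halftree[OF w]
proof
  assume "w \<in> H"
  then have "q \<otimes> w \<in> Tw (m + 0) i" using q by (intro Tw_mult[where j = "i + m"]) auto
  then show ?thesis using q by (intro halftreeI[of _ m]) (auto elim: oddE)
next
  assume "w \<in> halftree (Suc i)"
  then show ?thesis using q by (intro Tw_halftree) auto
qed

text \<open>The condition at \<open>w\<close> says that \<open>z\<close> fixes the edge of
  \<open>w\<close>. Length 0 is included, so the base edge is fixed too.\<close>

definition fixer :: "nat \<Rightarrow> 'a set" where
  "fixer i = {z \<in> carrier G. \<forall>k. \<forall>w \<in> Tw k i. inv w \<otimes> z \<otimes> w \<in> H}"

lemma K_set_eq: "K_set G G0 G1 H i = fixer i"
proof -
  have conj: "z \<in> (w <# H) #> inv w \<longleftrightarrow> z \<in> carrier G \<and> inv w \<otimes> z \<otimes> w \<in> H"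
    if "w \<in> carrier G" for w z
  proof
    assume "z \<in> (w <# H) #> inv w"
    then obtain h where h: "h \<in> H" "z = w \<otimes> h \<otimes> inv w" by (auto simp: l_coset_def r_coset_def)
    then have "inv w \<otimes> z \<otimes> w = h" using that H_carrier
      by (simp add: m_assoc cancel_inv)
    then show "z \<in> carrier G \<and> inv w \<otimes> z \<otimes> w \<in> H" using h that H_carrier by auto
  next
    assume z: "z \<in> carrier G \<and> inv w \<otimes> z \<otimes> w \<in> H"
    then have "z = w \<otimes> (inv w \<otimes> z \<otimes> w) \<otimes> inv w" using that
      by (simp add: m_assoc cancel_inv)
    then show "z \<in> (w <# H) #> inv w" using z unfolding l_coset_def r_coset_def by blast
  qed
  have one: "\<one> \<in> Tw 0 i" using H_one_closed by simp
  have "z \<in> (\<Inter>k. \<Inter>w\<in>Tw k i. (w <# H) #> inv w) \<longleftrightarrow> z \<in> fixer i" for z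
  proof -
    have "z \<in> (\<Inter>k. \<Inter>w\<in>Tw k i. (w <# H) #> inv w) \<longleftrightarrow>
        (\<forall>k. \<forall>w\<in>Tw k i. z \<in> carrier G \<and> inv w \<otimes> z \<otimes> w \<in> H)"
      using conj[OF Tw_carrier] by simp
    then show ?thesis unfolding fixer_def using one by blast
  qed
  then show ?thesis unfolding K_set_def C_set_def T_set_eq by blast
qed

lemma fixer_cong: "even i = even j \<Longrightarrow> fixer i = fixer j"
  unfolding fixer_def using Tw_cong[of i j] by simp

lemma fixer_H: "z \<in> fixer i \<Longrightarrow> z \<in> H"
proof -
  assume "z \<in> fixer i"
  moreover have "\<one> \<in> Tw 0 i" using H_one_closed by simp
  ultimately have "z \<in> carrier G" "inv \<one> \<otimes> z \<otimes> \<one> \<in> H" unfolding fixer_def by blast+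
  then show "z \<in> H" by simp
qed

text \<open>With base edges included, the translate by \<open>w\<close> of side \<open>j\<close>
  sits inside side \<open>i\<close>; whatever fixes the larger set of edges fixes the
  smaller.\<close>

lemma fixer_conj:
  assumes w: "w \<in> Tw k i" and j: "even j = even (i + k)" and z: "z \<in> fixer i"
  shows "inv w \<otimes> z \<otimes> w \<in> fixer j"
proof -
  have c: "w \<in> carrier G" "z \<in> carrier G" using w z Tw_carrier by (auto simp: fixer_def)
  have "inv v \<otimes> (inv w \<otimes> z \<otimes> w) \<otimes> v \<in> H" if v: "v \<in> Tw l j" for l v
  proof -
    have "w \<otimes> v \<in> Tw (k + l) i" using Tw_mult w v j by blast
    then have "inv (w \<otimes> v) \<otimes> z \<otimes> (w \<otimes> v) \<in> H" using z unfolding fixer_def by blast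
    then show ?thesis using c v Tw_carrier by (simp add: inv_mult_group m_assoc)
  qed
  then show ?thesis using c unfolding fixer_def by blast
qed

lemma fixer_subgroup: "subgroup (fixer i) G"
proof (rule subgroupI)
  show "fixer i \<subseteq> carrier G" by (auto simp: fixer_def)
  have "\<one> \<in> fixer i" using H_one_closed Tw_carrier by (auto simp: fixer_def)
  then show "fixer i \<noteq> {}" by blast
next
  fix a assume a: "a \<in> fixer i"
  have "inv w \<otimes> inv a \<otimes> w \<in> H" if "w \<in> Tw k i" for w k
  proof -
    have "inv (inv w \<otimes> a \<otimes> w) \<in> H" using a that H_inv_closed unfolding fixer_def by blast
    then show ?thesis using a Tw_carrier[OF that] by (simp add: fixer_def inv_mult_group m_assoc)
  qed
  then show "inv a \<in> fixer i" using a by (auto simp: fixer_def)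
next
  fix a b assume ab: "a \<in> fixer i" "b \<in> fixer i"
  have "inv w \<otimes> (a \<otimes> b) \<otimes> w \<in> H" if "w \<in> Tw k i" for w k
  proof -
    have "(inv w \<otimes> a \<otimes> w) \<otimes> (inv w \<otimes> b \<otimes> w) \<in> H"
      using ab that H_m_closed unfolding fixer_def by blast
    moreover have "(inv w \<otimes> a \<otimes> w) \<otimes> (inv w \<otimes> b \<otimes> w) = inv w \<otimes> (a \<otimes> b) \<otimes> w"
      using ab Tw_carrier[OF that] by (simp add: fixer_def m_assoc cancel_inv)
    ultimately show ?thesis by simp
  qed
  then show "a \<otimes> b \<in> fixer i" using ab by (auto simp: fixer_def)
qed

end

section \<open>Half-trees\<close>

context amalgam
begin

text \<open>When \<open>H\<close> is proper in the factor, this says that its index there is at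
  least 3: besides \<open>H\<close> and the coset of \<open>s\<close> there is another left
  coset.\<close>

definition branching :: "nat \<Rightarrow> bool" where
  "branching i \<longleftrightarrow> (\<forall>s \<in> factor i - H. \<exists>y \<in> factor i - H. inv y \<otimes> s \<notin> H)"

section \<open>Nondegeneracy and a third coset\<close>

lemma sub_index_le:
  assumes "finite B" "\<And>g. g \<in> K \<Longrightarrow> H #> g \<in> B"
  shows "sub_index G K H \<le> enat (card B)"
proof -
  have sub: "{H #> g |g. g \<in> K} \<subseteq> B" using assms by blast
  then have "finite {H #> g |g. g \<in> K}" "card {H #> g |g. g \<in> K} \<le> card B"
    using assms(1) finite_subset card_mono by blast+
  then show ?thesis by (simp add: sub_index_def)
qed

lemma sub_index_le_1:
  assumes "factor i - H = {}" shows "sub_index G (factor i) H \<le> 1"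
proof -
  have "sub_index G (factor i) H \<le> enat (card {H})"
    using assms coset_join2[OF _ H_subgroup] H_carrier by (intro sub_index_le) auto
  then show ?thesis by (simp add: one_enat_def)
qed

lemma sub_index_le_2:
  assumes "\<not> branching i" shows "sub_index G (factor i) H \<le> 2"
proof -
  obtain s where s: "s \<in> factor i" "s \<notin> H" "\<And>y. y \<in> factor i - H \<Longrightarrow> inv y \<otimes> s \<in> H"
    using assms unfolding branching_def by blast
  have sc: "s \<in> carrier G" using s factor_carrier by blast
  \<comment> \<open>Right cosets are counted here, while the exceptional \<open>s\<close> controls
    left cosets; hence the inverse.\<close>
  have "sub_index G (factor i) H \<le> enat (card {H, H #> inv s})"
  proof (rule sub_index_le)
    fix y assume y: "y \<in> factor i"
    have yc: "y \<in> carrier G" using y factor_carrier by blast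
    show "H #> y \<in> {H, H #> inv s}"
    proof (cases "y \<in> H")
      case True
      then show ?thesis using coset_join2[OF yc H_subgroup] by simp
    next
      case False
      then have "inv y \<in> factor i - H" using y factor_inv_closed H_inv_iff yc by blast
      then have "y \<otimes> s \<in> H" using s(3)[of "inv y"] yc by simp
      moreover have "y = (y \<otimes> s) \<otimes> inv s" using yc sc by (simp add: m_assoc)
      ultimately have "y \<in> H #> inv s" unfolding r_coset_def by blast
      then have "H #> inv s = H #> y" using sc H_subgroup by (intro repr_independence) auto
      then show ?thesis by simp
    qed
  qed simp
  also have "card {H, H #> inv s} \<le> 2" by (simp add: card_insert_if)
  finally show ?thesis by (simp add: numeral_eq_enat)
qed

text \<open>Index 1 on one side makes the product 0, even against an infinite index, and indices at
  most 2 on both sides make it at most 1.\<close>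

lemma nondegenerateD:
  assumes "nondegenerate G G0 G1 H"
  shows "factor i - H \<noteq> {}" "branching i \<or> branching (Suc i)"
proof -
  let ?a = "sub_index G G0 H" and ?b = "sub_index G G1 H"
  have ab: "(?a - 1) * (?b - 1) \<ge> 2" using assms by (simp add: nondegenerate_def)
  have zero: "x - 1 = 0" if "x \<le> 1" for x :: enat
    using that by (cases x) (auto simp: one_enat_def zero_enat_def)
  have one: "x - 1 \<le> 1" if "x \<le> 2" for x :: enat
    using that by (cases x) (auto simp: one_enat_def numeral_eq_enat)
  show "factor i - H \<noteq> {}"
  proof
    assume "factor i - H = {}"
    then have "sub_index G (factor i) H - 1 = 0" using sub_index_le_1 zero by blast
    then show False using ab by (auto simp: factor_def split: if_splits)
  qed
  show "branching i \<or> branching (Suc i)"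
  proof (rule ccontr)
    assume "\<not> ?thesis"
    then have "sub_index G (factor i) H \<le> 2" "sub_index G (factor (Suc i)) H \<le> 2"
      using sub_index_le_2 by blast+
    then have "?a - 1 \<le> 1" "?b - 1 \<le> 1" using one by (auto simp: factor_def split: if_splits)
    then have "(?a - 1) * (?b - 1) \<le> 1 * 1" by (intro mult_mono) auto
    then have "(2::enat) \<le> 1" using ab by (metis mult_1 order_trans)
    then show False by (simp add: one_enat_def numeral_eq_enat)
  qed
qed

section \<open>Moving half-trees off themselves\<close>

definition displaces :: "'a \<Rightarrow> nat \<Rightarrow> bool" where
  "displaces s i \<longleftrightarrow> (\<forall>w \<in> halftree i. s \<otimes> w \<notin> halftree i)"

lemma displaces_odd:
  assumes s: "s \<in> Tw m j" "odd m" and ij: "even i \<noteq> even j"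
  shows "displaces s i"
  unfolding displaces_def
proof
  fix w assume "w \<in> halftree i"
  then have "s \<otimes> w \<in> halftree j" using s ij by (intro Tw_halftree) auto
  then show "s \<otimes> w \<notin> halftree i" using halftree_disjoint ij by metis
qed

lemma displaces_inv:
  assumes s: "s \<in> carrier G" and d: "displaces (inv s) i" shows "displaces s i"
  unfolding displaces_def
proof (intro ballI notI)
  fix w assume w: "w \<in> halftree i" "s \<otimes> w \<in> halftree i"
  have "inv s \<otimes> (s \<otimes> w) = w" using s halftree_carrier w by (intro cancel_inv) auto
  then show False using w d unfolding displaces_def by metis
qed

text \<open>A nonempty word of even length begins and ends in different factors. Conjugation by a
  letter \<open>y\<close> from the factor of the front letter, but from another coset, alters the
  front letter without cancelling it and appends \<open>y\<close>; the conjugate has odd length, so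
  \<open>displaces_odd\<close> applies.\<close>

lemma conj_displaces_even:
  assumes nd: "nondegenerate G G0 G1 H"
    and s: "s \<in> Tw m i" "even m" "m > 0"
  shows "\<exists>k y. y \<in> Tw k i \<and> displaces (inv y \<otimes> s \<otimes> y) (i + k)"
proof -
  obtain n where m: "m = Suc (Suc n)" using s by (metis even_Suc gr0_implies_Suc even_zero old.nat.exhaust)
  obtain s0 u where u: "s = s0 \<otimes> u" "s0 \<in> factor i" "s0 \<notin> H" "u \<in> Tw (Suc n) (Suc i)"
    using s m Tw_SucE by metis
  obtain s1 v where v: "u = s1 \<otimes> v" "s1 \<in> factor (Suc i)" "s1 \<notin> H" "v \<in> Tw n (Suc (Suc i))"
    using u Tw_SucE by metis
  have c: "s0 \<in> carrier G" "s1 \<in> carrier G" "v \<in> carrier G" "u \<in> carrier G"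
    using u v factor_carrier Tw_carrier by blast+
  have en: "even n" using s m by simp
  from nondegenerateD(2)[OF nd, of i] show ?thesis
  proof
    assume "branching i"
    then obtain y where y: "y \<in> factor i - H" "inv y \<otimes> s0 \<notin> H"
      using u unfolding branching_def by blast
    then have yc: "y \<in> carrier G" and yi: "inv y \<otimes> s0 \<in> factor i - H"
      using factor_carrier[of y i] factor_inv_closed[of y i] factor_m_closed[of "inv y" i s0] u by auto
    have "(inv y \<otimes> s0) \<otimes> (u \<otimes> y) \<in> Tw (1 + (Suc n + 1)) i"
      using en by (intro Tw_mult[OF Tw_one[OF yi] Tw_mult[OF u(4) Tw_one[OF y(1)]]]) auto
    moreover have "inv y \<otimes> s \<otimes> y = (inv y \<otimes> s0) \<otimes> (u \<otimes> y)" using u(1) c yc by (simp add: m_assoc)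
    ultimately have "displaces (inv y \<otimes> s \<otimes> y) (i + 1)"
      using en displaces_odd[of _ "1 + (Suc n + 1)" i "i + 1"] by simp
    then show ?thesis using Tw_one[OF y(1)] by blast
  next
    assume "branching (Suc i)"
    then obtain y where y: "y \<in> factor (Suc i) - H" "inv y \<otimes> s1 \<notin> H"
      using v unfolding branching_def by blast
    then have yc: "y \<in> carrier G" and yi: "inv y \<otimes> s1 \<in> factor (Suc i) - H"
      using factor_carrier[of y "Suc i"] factor_inv_closed[of y "Suc i"]
        factor_m_closed[of "inv y" "Suc i" s1] v by auto
    have s0: "s0 \<in> factor i - H" using u by simp
    have 1: "s0 \<otimes> y \<in> Tw (1 + 1) i" by (intro Tw_mult[OF Tw_one[OF s0] Tw_one[OF y(1)]]) auto
    have "v \<otimes> (s0 \<otimes> y) \<in> Tw (n + (1 + 1)) (Suc (Suc i))"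
      using en by (intro Tw_mult[OF v(4) 1]) auto
    then have "(inv y \<otimes> s1) \<otimes> (v \<otimes> (s0 \<otimes> y)) \<in> Tw (1 + (n + (1 + 1))) (Suc i)"
      by (rule Tw_mult[OF Tw_one[OF yi]]) simp
    \<comment> \<open>Conjugation by \<open>s0\<close> rotates the front letter to the end, so that
      \<open>s1\<close> becomes the front letter on which \<open>y\<close> acts.\<close>
    moreover have "inv (s0 \<otimes> y) \<otimes> s \<otimes> (s0 \<otimes> y) = (inv y \<otimes> s1) \<otimes> (v \<otimes> (s0 \<otimes> y))"
      using u(1) v(1) c yc by (simp add: m_assoc inv_mult_group cancel_inv)
    ultimately have "displaces (inv (s0 \<otimes> y) \<otimes> s \<otimes> (s0 \<otimes> y)) (i + (1 + 1))"
      using en displaces_odd[of _ "1 + (n + (1 + 1))" "Suc i" "i + (1 + 1)"] by simp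
    then show ?thesis using 1 by blast
  qed
qed

text \<open>In the tree: an element that moves the base edge displaces some half-tree contained in
  side \<open>i\<close>, namely the translate by \<open>y\<close> of side
  \<open>i + k\<close>.\<close>

lemma conj_displaces:
  assumes nd: "nondegenerate G G0 G1 H" and s: "s \<in> carrier G" "s \<notin> H"
  shows "\<exists>k y. y \<in> Tw k i \<and> displaces (inv y \<otimes> s \<otimes> y) (i + k)"
proof (rule carrier_cases[OF s(1), where i = i])
  assume "s \<in> H"
  then show ?thesis using s by blast
next
  fix m assume m: "m > 0" "s \<in> Tw m i"
  show ?thesis
  proof (cases "even m")
    case True
    then show ?thesis using conj_displaces_even[OF nd] m by blast
  next
    case False
    then have "displaces s (i + m)" using displaces_odd[OF m(2)] by simp
    moreover have "inv s \<otimes> s \<otimes> s = s" using s by simp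
    \<comment> \<open>The witness \<open>s\<close> leaves the element unchanged under conjugation;
      it only shifts the index by the odd number \<open>m\<close>, to the side that \<open>s\<close>
      displaces.\<close>
    ultimately show ?thesis using m by (intro exI[of _ m] exI[of _ s]) simp
  qed
next
  fix m assume m: "m > 0" "s \<in> Tw m (Suc i)"
  show ?thesis
  proof (cases "even m")
    case True
    \<comment> \<open>The inverse of an even word beginning in factor \<open>Suc i\<close> begins in
      factor \<open>i\<close>, and an element displaces a half-tree as soon as its inverse
      does.\<close>
    have "inv s \<in> Tw m (Suc (Suc i + m))" using m Tw_inv by blast
    moreover have "Tw m (Suc (Suc i + m)) = Tw m i" using True by (intro Tw_cong) auto
    ultimately obtain k y where y: "y \<in> Tw k i" "displaces (inv y \<otimes> inv s \<otimes> y) (i + k)"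
      using conj_displaces_even[OF nd, of "inv s" m i] m True by auto
    have yc: "y \<in> carrier G" using y Tw_carrier by blast
    have "inv (inv y \<otimes> s \<otimes> y) = inv y \<otimes> inv s \<otimes> y"
      using yc s by (simp add: inv_mult_group m_assoc)
    then have "displaces (inv (inv y \<otimes> s \<otimes> y)) (i + k)" using y by simp
    then have "displaces (inv y \<otimes> s \<otimes> y) (i + k)" by (rule displaces_inv[rotated]) (use s yc in simp)
    then show ?thesis using y by blast
  next
    case False
    then have "displaces s i" using displaces_odd[OF m(2)] by simp
    moreover have "inv \<one> \<otimes> s \<otimes> \<one> = s" using s by simp
    moreover have "\<one> \<in> Tw 0 i" using H_one_closed by simp
    ultimately show ?thesis by (intro exI[of _ 0] exI[of _ \<one>]) simp
  qed
qed

text \<open>Since no nontrivial element fixes side \<open>j\<close> pointwise, the conjugate of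
  \<open>t\<close> by \<open>g\<close> moves an edge there, and \<open>conj_displaces\<close> at
  that edge gives a smaller half-tree. Prescribing the surrounding half-tree allows several elements
  to be treated in turn.\<close>

lemma shrink_halftree:
  assumes nd: "nondegenerate G G0 G1 H" and K: "fixer 0 = {\<one>}" "fixer 1 = {\<one>}"
    and t: "t \<in> carrier G" "t \<noteq> \<one>" and g: "g \<in> carrier G"
  shows "\<exists>g' j'. g' \<in> carrier G \<and> g' <# halftree j' \<subseteq> g <# halftree j \<and>
    (\<forall>x \<in> g' <# halftree j'. t \<otimes> x \<notin> g' <# halftree j')"
proof -
  define t' where "t' = inv g \<otimes> t \<otimes> g"
  have t'c: "t' \<in> carrier G" using t g by (simp add: t'_def)
  have "t' \<noteq> \<one>"
  proof
    assume "t' = \<one>"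
    then have "g \<otimes> t' \<otimes> inv g = \<one>" using g by simp
    then show False using t g by (simp add: t'_def m_assoc cancel_inv)
  qed
  moreover have "fixer j = {\<one>}" 
    using K fixer_cong[of j 0] fixer_cong[of j 1] by (cases "even j") simp_all
  ultimately have "t' \<notin> fixer j" by simp
  then obtain k w where w: "w \<in> Tw k j" "inv w \<otimes> t' \<otimes> w \<notin> H"
    using t'c unfolding fixer_def by blast
  have wc: "w \<in> carrier G" using w Tw_carrier by blast
  define s where "s = inv w \<otimes> t' \<otimes> w"
  have "s \<in> carrier G" "s \<notin> H" using w t'c wc by (auto simp: s_def)
  then obtain l y where y: "y \<in> Tw l (j + k)" "displaces (inv y \<otimes> s \<otimes> y) (j + k + l)"
    using conj_displaces[OF nd] by blast
  have yc: "y \<in> carrier G" using y Tw_carrier by blast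
  define g' where "g' = g \<otimes> w \<otimes> y"
  have g'c: "g' \<in> carrier G" using g wc yc by (simp add: g'_def)
  have eq: "inv g' \<otimes> t \<otimes> g' = inv y \<otimes> s \<otimes> y"
    using t g wc yc by (simp add: g'_def s_def t'_def inv_mult_group m_assoc)
  have wy: "w \<otimes> y \<in> Tw (k + l) j" using w y by (intro Tw_mult) auto
  have "g' <# halftree (j + k + l) \<subseteq> g <# halftree j"
  proof
    fix x assume "x \<in> g' <# halftree (j + k + l)"
    then obtain v where v: "v \<in> halftree (j + k + l)" "x = g' \<otimes> v" by (auto simp: l_coset_def)
    then have "x = g \<otimes> ((w \<otimes> y) \<otimes> v)" using g wc yc halftree_carrier[OF v(1)] by (simp add: g'_def m_assoc)
    moreover have "(w \<otimes> y) \<otimes> v \<in> halftree j" using wy v by (intro Tw_halftree) auto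
    ultimately show "x \<in> g <# halftree j" by (auto simp: l_coset_def)
  qed
  moreover have "t \<otimes> x \<notin> g' <# halftree (j + k + l)" if "x \<in> g' <# halftree (j + k + l)" for x
  proof
    assume "t \<otimes> x \<in> g' <# halftree (j + k + l)"
    then obtain v v' where v: "v \<in> halftree (j + k + l)" "x = g' \<otimes> v"
      "v' \<in> halftree (j + k + l)" "t \<otimes> x = g' \<otimes> v'" using \<open>x \<in> _\<close> by (auto simp: l_coset_def)
    have vc: "v \<in> carrier G" "v' \<in> carrier G" using v halftree_carrier by blast+
    have "v' = inv g' \<otimes> (t \<otimes> (g' \<otimes> v))" using v vc g'c by (simp flip: v(2) add: cancel_inv)
    also have "\<dots> = (inv g' \<otimes> t \<otimes> g') \<otimes> v" using vc g'c t by (simp add: m_assoc)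
    finally show False using y(2) v eq unfolding displaces_def by simp
  qed
  ultimately show ?thesis using g'c by blast
qed

text \<open>An element that displaces a half-tree also displaces every smaller one, so shrinking
  once per element of \<open>F\<close> is enough.\<close>

lemma common_displaced_halftree:
  assumes nd: "nondegenerate G G0 G1 H" and K: "fixer 0 = {\<one>}" "fixer 1 = {\<one>}"
    and F: "finite F" "F \<subseteq> carrier G - {\<one>}"
  shows "\<exists>g j. g \<in> carrier G \<and> (\<forall>t\<in>F. \<forall>x \<in> g <# halftree j. t \<otimes> x \<notin> g <# halftree j)"
  using F
proof (induction F)
  case empty
  then show ?case using one_closed by blast
next
  case (insert t F)
  then obtain g j where g: "g \<in> carrier G" "\<forall>t\<in>F. \<forall>x \<in> g <# halftree j. t \<otimes> x \<notin> g <# halftree j"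
    by auto
  obtain g' j' where g': "g' \<in> carrier G" "g' <# halftree j' \<subseteq> g <# halftree j"
    "\<forall>x \<in> g' <# halftree j'. t \<otimes> x \<notin> g' <# halftree j'"
    using shrink_halftree[OF nd K, of t g j] insert.prems g by auto
  have "\<forall>t\<in>insert t F. \<forall>x \<in> g' <# halftree j'. t \<otimes> x \<notin> g' <# halftree j'"
    using g g' by blast
  then show ?case using g'(1) by blast
qed

text \<open>These are the ping-pong maps. Both carry the complement of half-tree \<open>j\<close>
  into itself, and their images are disjoint because \<open>inv a \<otimes> b\<close> begins and
  ends in factor \<open>j\<close>. The third coset provides two words that differ in one
  letter.\<close>

lemma disjoint_contractions:
  assumes nd: "nondegenerate G G0 G1 H"
  shows "\<exists>a b. a \<in> Tw 2 (Suc j) \<and> b \<in> Tw 2 (Suc j) \<and> (\<exists>m. odd m \<and> inv a \<otimes> b \<in> Tw m j)"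
proof -
  obtain y where y: "y \<in> factor (Suc j) - H" using nondegenerateD(1)[OF nd] by blast
  obtain z where z: "z \<in> factor j - H" using nondegenerateD(1)[OF nd] by blast
  have c: "y \<in> carrier G" "z \<in> carrier G" using y z factor_carrier by blast+
  have T2: "p \<otimes> q \<in> Tw 2 (Suc j)" if "p \<in> factor (Suc j) - H" "q \<in> factor j - H" for p q
    using Tw_mult[OF Tw_one[OF that(1)] Tw_one[OF that(2)]] by (simp flip: numeral_2_eq_2)
  from nondegenerateD(2)[OF nd, of j] show ?thesis
  proof
    assume "branching j"
    then obtain z' where z': "z' \<in> factor j - H" "inv z' \<otimes> z \<notin> H" using z unfolding branching_def by blast
    have z'c: "z' \<in> carrier G" using z' factor_carrier by blast
    have "inv (y \<otimes> z') \<otimes> (y \<otimes> z) = inv z' \<otimes> z"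
      using c z'c by (simp add: inv_mult_group m_assoc cancel_inv)
    moreover have "inv z' \<otimes> z \<in> Tw 1 j"
      using z z' factor_inv_closed[of z' j] factor_m_closed[of "inv z'" j z] by (intro Tw_one) auto
    ultimately show ?thesis using T2[OF y z] T2[OF y z'(1)] by (metis odd_one)
  next
    assume "branching (Suc j)"
    then obtain y' where y': "y' \<in> factor (Suc j) - H" "inv y' \<otimes> y \<notin> H" using y unfolding branching_def by blast
    have y'c: "y' \<in> carrier G" using y' factor_carrier by blast
    have eq: "inv (y' \<otimes> z) \<otimes> (y \<otimes> z) = inv z \<otimes> ((inv y' \<otimes> y) \<otimes> z)"
      using c y'c by (simp add: inv_mult_group m_assoc)
    have yy: "inv y' \<otimes> y \<in> factor (Suc j) - H"
      using y y' factor_inv_closed[of y' "Suc j"] factor_m_closed[of "inv y'" "Suc j" y] by auto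
    have iz: "inv z \<in> factor j - H" using z factor_inv_closed[of z j] H_inv_iff c by blast
    have "inv z \<otimes> ((inv y' \<otimes> y) \<otimes> z) \<in> Tw (1 + 2) j"
      using T2[OF yy z] by (intro Tw_mult[OF Tw_one[OF iz]]) auto
    then have "\<exists>m. odd m \<and> inv (y' \<otimes> z) \<otimes> (y \<otimes> z) \<in> Tw m j"
      unfolding eq by (intro exI[of _ "1 + 2"]) simp
    then show ?thesis using T2[OF y z] T2[OF y'(1) z] by blast
  qed
qed

lemma powers_property:
  assumes nd: "nondegenerate G G0 G1 H" and K: "fixer 0 = {\<one>}" "fixer 1 = {\<one>}"
    and F: "finite F" "F \<subseteq> carrier G - {\<one>}"
  obtains C \<gamma> where "\<And>n::nat. \<gamma> n \<in> carrier G"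
    "\<And>t x. t \<in> F \<Longrightarrow> x \<in> C \<Longrightarrow> t \<otimes> x \<notin> C"
    "\<And>m n x y. m \<noteq> n \<Longrightarrow> x \<in> carrier G - C \<Longrightarrow> y \<in> carrier G - C \<Longrightarrow> \<gamma> m \<otimes> x \<noteq> \<gamma> n \<otimes> y"
proof -
  obtain g j where g: "g \<in> carrier G" "\<forall>t\<in>F. \<forall>x \<in> g <# halftree j. t \<otimes> x \<notin> g <# halftree j"
    using common_displaced_halftree[OF nd K F] by blast
  obtain a b m0 where ab: "a \<in> Tw 2 (Suc j)" "b \<in> Tw 2 (Suc j)" "odd m0" "inv a \<otimes> b \<in> Tw m0 j"
    using disjoint_contractions[OF nd] by blast
  have c: "a \<in> carrier G" "b \<in> carrier G" using ab Tw_carrier by blast+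
  define Y where "Y = carrier G - halftree j"
  have into: "q \<otimes> w \<in> Y" if q: "q \<in> Tw 2 (Suc j)" and w: "w \<in> Y" for q w
  proof -
    have "q \<otimes> w \<in> halftree (Suc j)"
    proof (cases "w \<in> H")
      case True
      then have "q \<otimes> w \<in> Tw (2 + 0) (Suc j)" using q by (intro Tw_mult[where j = "Suc j"]) auto
      then show ?thesis by (intro halftreeI[of _ 2]) auto
    next
      case False
      then have "w \<in> halftree (Suc j)" using not_halftree[of w j] w by (auto simp: Y_def)
      then show ?thesis using q by (intro Tw_halftree) auto
    qed
    then show ?thesis using halftree_disjoint[of _ "Suc j" j] halftree_carrier by (auto simp: Y_def)
  qed
  have disj: "a \<otimes> x \<noteq> b \<otimes> y" if "x \<in> Y" "y \<in> Y" for x y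
  proof
    assume eq: "a \<otimes> x = b \<otimes> y"
    have "x = inv a \<otimes> (a \<otimes> x)" using c that by (simp add: Y_def cancel_inv)
    also have "\<dots> = (inv a \<otimes> b) \<otimes> y" using c that by (simp add: eq Y_def m_assoc)
    also have "\<dots> \<in> halftree j" using ab that by (intro odd_Tw_moves_complement) (auto simp: Y_def)
    finally show False using that by (simp add: Y_def)
  qed
  \<comment> \<open>The factor \<open>inv g\<close> turns the complement of the displaced half-tree
    into \<open>Y\<close>. The images of \<open>Y\<close> under \<open>b\<close>,
    \<open>a \<otimes> b\<close>, \<open>a \<otimes> a \<otimes> b\<close> and so on are disjoint:
    after cancelling common powers of \<open>a\<close>, one lies in the image under \<open>b\<close>
    and the other in the image under \<open>a\<close>.\<close>
  define \<gamma> where "\<gamma> = (\<lambda>n::nat. a [^] n \<otimes> b \<otimes> inv g)"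
  have pow: "a [^] n \<otimes> y \<in> Y" if "y \<in> Y" for n :: nat and y
  proof (induction n)
    case (Suc n)
    have "a [^] Suc n \<otimes> y = a \<otimes> (a [^] n \<otimes> y)"
      unfolding nat_pow_Suc2[OF c(1)] using c that by (intro m_assoc) (auto simp: Y_def)
    then show ?case using into[OF ab(1) Suc] by simp
  qed (use that in \<open>simp add: Y_def\<close>)
  have lt: "a [^] m \<otimes> (b \<otimes> x) \<noteq> a [^] n \<otimes> (b \<otimes> y)" if mn: "m < n" and xY: "x \<in> Y" and yY: "y \<in> Y" for m n :: nat and x y
  proof
    assume eq: "a [^] m \<otimes> (b \<otimes> x) = a [^] n \<otimes> (b \<otimes> y)"
    obtain d where d: "n = m + Suc d" using less_imp_Suc_add[OF mn] by auto
    have xy: "x \<in> carrier G" "y \<in> carrier G" using xY yY by (auto simp: Y_def)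
    have "a [^] n = a [^] m \<otimes> (a \<otimes> a [^] d)"
      unfolding nat_pow_Suc2[OF c(1), symmetric] using c by (simp only: d nat_pow_mult)
    then have "a [^] m \<otimes> (b \<otimes> x) = a [^] m \<otimes> (a \<otimes> (a [^] d \<otimes> (b \<otimes> y)))"
      using eq c xy by (simp add: m_assoc)
    then have "b \<otimes> x = a \<otimes> (a [^] d \<otimes> (b \<otimes> y))" using c xy by simp
    moreover have "a [^] d \<otimes> (b \<otimes> y) \<in> Y" using pow into ab yY by blast
    ultimately show False using disj xY by metis
  qed
  have neq: "a [^] m \<otimes> (b \<otimes> x) \<noteq> a [^] n \<otimes> (b \<otimes> y)" if "m \<noteq> n" "x \<in> Y" "y \<in> Y" for m n :: nat and x y
    using lt[of m n x y] lt[of n m y x] that by (metis nat_neq_iff)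
  have gY: "inv g \<otimes> x \<in> Y" if "x \<in> carrier G - (g <# halftree j)" for x
  proof -
    have "x = g \<otimes> (inv g \<otimes> x)" using that g by (simp add: cancel_inv)
    then have "inv g \<otimes> x \<notin> halftree j" using that unfolding l_coset_def by blast
    then show ?thesis using that g by (simp add: Y_def)
  qed
  have "\<gamma> m \<otimes> x \<noteq> \<gamma> n \<otimes> y"
    if mn: "m \<noteq> n" and x: "x \<in> carrier G - (g <# halftree j)" and y: "y \<in> carrier G - (g <# halftree j)" for m n x y
  proof -
    have "\<gamma> m \<otimes> x = a [^] m \<otimes> (b \<otimes> (inv g \<otimes> x))" "\<gamma> n \<otimes> y = a [^] n \<otimes> (b \<otimes> (inv g \<otimes> y))"
      using c g x y by (simp_all add: \<gamma>_def m_assoc)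
    then show ?thesis using neq[OF mn gY[OF x] gY[OF y]] by simp
  qed
  moreover have "\<gamma> n \<in> carrier G" for n using c g by (simp add: \<gamma>_def)
  ultimately show ?thesis using that[of \<gamma> "g <# halftree j"] g(2) by blast
qed

lemma trivial_kernels_cstar_simple:
  assumes nd: "nondegenerate G G0 G1 H" and K: "fixer 0 = {\<one>}" "fixer 1 = {\<one>}"
  shows "cstar_simple G"
proof (rule powers_group_cstar_simple)
  show powers_group unfolding powers_group_def
  proof (intro allI impI)
    fix F assume "finite F \<and> F \<subseteq> carrier G - {\<one>}"
    then have F: "finite F" "F \<subseteq> carrier G - {\<one>}" by auto
    obtain C \<gamma> where C: "\<And>n::nat. \<gamma> n \<in> carrier G"
      "\<And>t x. t \<in> F \<Longrightarrow> x \<in> C \<Longrightarrow> t \<otimes> x \<notin> C"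
      "\<And>m n x y. m \<noteq> n \<Longrightarrow> x \<in> carrier G - C \<Longrightarrow> y \<in> carrier G - C \<Longrightarrow> \<gamma> m \<otimes> x \<noteq> \<gamma> n \<otimes> y"
      using powers_property[OF nd K F] by metis
    show "\<exists>C \<gamma>. (\<forall>n::nat. \<gamma> n \<in> carrier G) \<and> (\<forall>t\<in>F. \<forall>x\<in>C. t \<otimes> x \<notin> C) \<and>
     (\<forall>m n x y. m \<noteq> n \<and> x \<in> carrier G - C \<and> y \<in> carrier G - C \<longrightarrow> \<gamma> m \<otimes> x \<noteq> \<gamma> n \<otimes> y)"
      by (intro exI[of _ C] exI[of _ \<gamma>] conjI allI ballI impI) (simp_all add: C)
  qed
qed

end

section \<open>Nontrivial amenable half-tree stabilisers\<close>

context amalgam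
begin

section \<open>Stabilisers of neighbourhoods of an end\<close>

lemma Tw_pow:
  assumes a: "a \<in> Tw 2 j" shows "a [^] n \<in> Tw (2 * n) j"
proof (induction n)
  case 0
  then show ?case using H_one_closed by simp
next
  case (Suc n)
  have "a [^] n \<otimes> a \<in> Tw (2 * n + 2) j" by (rule Tw_mult[OF Suc a]) simp
  then show ?case by simp
qed

text \<open>The pointwise stabiliser of some neighbourhood of the end of the Bass--Serre tree to which the
  half-trees at the edges \<open>a\<^sup>n H\<close> shrink.\<close>

definition germ_stabiliser :: "'a \<Rightarrow> nat \<Rightarrow> 'a set" where
  "germ_stabiliser a j = {z \<in> carrier G. \<exists>n::nat. inv (a [^] n) \<otimes> z \<otimes> (a [^] n) \<in> fixer j}"

text \<open>The half-trees at the powers of \<open>a\<close> are nested, so fixing one entails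
  fixing all later ones. Hence finitely many elements can be tested with a common exponent.\<close>

lemma germ_stabiliser_mono:
  assumes a: "a \<in> Tw 2 j" and z: "z \<in> carrier G" "inv (a [^] n) \<otimes> z \<otimes> (a [^] n) \<in> fixer j" and le: "n \<le> m"
  shows "inv (a [^] m) \<otimes> z \<otimes> (a [^] (m::nat)) \<in> fixer j"
  using le
proof (induction m rule: dec_induct)
  case base
  then show ?case using z by simp
next
  case (step m)
  have c: "a \<in> carrier G" "a [^] m \<in> carrier G" using a Tw_carrier by auto
  have "inv a \<otimes> (inv (a [^] m) \<otimes> z \<otimes> (a [^] m)) \<otimes> a \<in> fixer j"
    by (rule fixer_conj[OF a _ step.IH]) simp
  moreover have "inv a \<otimes> (inv (a [^] m) \<otimes> z \<otimes> (a [^] m)) \<otimes> a = inv (a [^] Suc m) \<otimes> z \<otimes> (a [^] Suc m)"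
    using c z by (simp add: inv_mult_group m_assoc)
  ultimately show ?case by simp
qed

lemma germ_stabiliser_subgroup:
  assumes a: "a \<in> Tw 2 j" shows "subgroup (germ_stabiliser a j) G"
proof (rule subgroupI)
  have ac: "a \<in> carrier G" using a Tw_carrier by blast
  show "germ_stabiliser a j \<subseteq> carrier G" by (auto simp: germ_stabiliser_def)
  have "inv (a [^] (0::nat)) \<otimes> \<one> \<otimes> (a [^] (0::nat)) \<in> fixer j" using subgroup.one_closed[OF fixer_subgroup] by simp
  then have "\<one> \<in> germ_stabiliser a j" unfolding germ_stabiliser_def by blast
  then show "germ_stabiliser a j \<noteq> {}" by blast
  show "inv z \<in> germ_stabiliser a j" if zL: "z \<in> germ_stabiliser a j" for z
  proof -
    obtain n :: nat where z: "z \<in> carrier G" "inv (a [^] n) \<otimes> z \<otimes> (a [^] n) \<in> fixer j"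
      using zL unfolding germ_stabiliser_def by blast
    then have "inv (inv (a [^] n) \<otimes> z \<otimes> (a [^] n)) \<in> fixer j" using subgroup.m_inv_closed[OF fixer_subgroup] by blast
    then have "inv (a [^] n) \<otimes> inv z \<otimes> (a [^] n) \<in> fixer j" using ac z by (simp add: inv_mult_group m_assoc)
    then show ?thesis using z unfolding germ_stabiliser_def by blast
  qed
  show "y \<otimes> z \<in> germ_stabiliser a j" if yL: "y \<in> germ_stabiliser a j" and zL: "z \<in> germ_stabiliser a j" for y z
  proof -
    obtain n m :: nat where y: "y \<in> carrier G" "inv (a [^] n) \<otimes> y \<otimes> (a [^] n) \<in> fixer j"
      and z: "z \<in> carrier G" "inv (a [^] m) \<otimes> z \<otimes> (a [^] m) \<in> fixer j"
      using yL zL unfolding germ_stabiliser_def by blast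
    let ?k = "max n m"
    have "inv (a [^] ?k) \<otimes> y \<otimes> (a [^] ?k) \<in> fixer j" by (rule germ_stabiliser_mono[OF a y]) simp
    moreover have "inv (a [^] ?k) \<otimes> z \<otimes> (a [^] ?k) \<in> fixer j" by (rule germ_stabiliser_mono[OF a z]) simp
    ultimately have "(inv (a [^] ?k) \<otimes> y \<otimes> (a [^] ?k)) \<otimes> (inv (a [^] ?k) \<otimes> z \<otimes> (a [^] ?k)) \<in> fixer j"
      using subgroup.m_closed[OF fixer_subgroup] by blast
    moreover have "(inv (a [^] ?k) \<otimes> y \<otimes> (a [^] ?k)) \<otimes> (inv (a [^] ?k) \<otimes> z \<otimes> (a [^] ?k)) =
        inv (a [^] ?k) \<otimes> (y \<otimes> z) \<otimes> (a [^] ?k)"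
      using ac y z by (simp add: m_assoc cancel_inv)
    ultimately have "inv (a [^] ?k) \<otimes> (y \<otimes> z) \<otimes> (a [^] ?k) \<in> fixer j" by simp
    then show ?thesis using y z unfolding germ_stabiliser_def by blast
  qed
qed

text \<open>The translate by \<open>v\<close> of the chosen end lies on one side of the base edge,
  and the stabiliser of that side fixes a neighbourhood of the translated end. In words: for large
  \<open>n\<close>, \<open>v \<otimes> a [^] n\<close> begins in some factor \<open>i\<close> and
  still ends in the same factor as \<open>a [^] n\<close>.\<close>

lemma fixer_conj_germ_stabiliser:
  assumes a: "a \<in> Tw 2 j" and v: "v \<in> carrier G"
  shows "(\<forall>z \<in> fixer 0. inv v \<otimes> z \<otimes> v \<in> germ_stabiliser a j) \<or> (\<forall>z \<in> fixer 1. inv v \<otimes> z \<otimes> v \<in> germ_stabiliser a j)"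
proof -
  obtain r where r: "\<forall>k i w. w \<in> Tw k i \<and> k > r \<longrightarrow>
    (\<exists>i' k'. k \<le> k' + r \<and> even (i' + k') = even (i + k) \<and> v \<otimes> w \<in> Tw k' i')"
    using generated_mult_Tw[OF v] by blast
  \<comment> \<open>The power \<open>a [^] n\<close> has length \<open>2 * n\<close>, which has to
    exceed the loss \<open>r\<close> caused by \<open>v\<close>.\<close>
  define n where "n = Suc r"
  have ac: "a \<in> carrier G" "a [^] n \<in> carrier G" using a Tw_carrier by auto
  have "2 * n > r" by (simp add: n_def)
  then have "a [^] n \<in> Tw (2 * n) j \<and> 2 * n > r" using Tw_pow[OF a] by blast
  then obtain i k where ik: "even (i + k) = even (j + 2 * n)" "v \<otimes> a [^] n \<in> Tw k i"
    using r by blast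
  have "inv v \<otimes> z \<otimes> v \<in> germ_stabiliser a j" if z: "z \<in> fixer i" for z
  proof -
    have zc: "z \<in> carrier G" using z by (simp add: fixer_def)
    have "inv (v \<otimes> a [^] n) \<otimes> z \<otimes> (v \<otimes> a [^] n) \<in> fixer j"
      using ik by (intro fixer_conj[OF ik(2) _ z]) simp
    moreover have "inv (v \<otimes> a [^] n) \<otimes> z \<otimes> (v \<otimes> a [^] n) = inv (a [^] n) \<otimes> (inv v \<otimes> z \<otimes> v) \<otimes> a [^] n"
      using v ac zc by (simp add: inv_mult_group m_assoc)
    ultimately have "inv (a [^] n) \<otimes> (inv v \<otimes> z \<otimes> v) \<otimes> a [^] n \<in> fixer j" by simp
    then show ?thesis using v zc unfolding germ_stabiliser_def by blast
  qed
  then show ?thesis using fixer_cong[of i 0] fixer_cong[of i 1] by (cases "even i") simp_all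
qed

lemma nontrivial_amenable_kernels_not_cstar_simple:
  assumes nd: "nondegenerate G G0 G1 H" and am: "amenable_subgroup G (fixer j)"
    and h: "h \<in> fixer 0" "h \<noteq> \<one>" and k: "k \<in> fixer 1" "k \<noteq> \<one>"
  shows "\<not> cstar_simple G"
proof -
  obtain x y where "x \<in> factor j - H" "y \<in> factor (Suc j) - H" using nondegenerateD(1)[OF nd] by blast
  then have "x \<otimes> y \<in> Tw (1 + 1) j" by (intro Tw_mult[OF Tw_one Tw_one]) auto
  then obtain a where a: "a \<in> Tw 2 j" by (metis one_add_one)
  have ac: "a \<in> carrier G" using a Tw_carrier by blast
  have hc: "h \<in> carrier G" and kc: "k \<in> carrier G" using h k by (auto simp: fixer_def)
  define L where "L = germ_stabiliser a j"
  have L: "subgroup L G" unfolding L_def by (rule germ_stabiliser_subgroup[OF a])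
  have Lc: "z \<in> carrier G" if "z \<in> L" for z using that L subgroup.mem_carrier by metis
  have absorb: "w \<otimes> z \<in> L \<longleftrightarrow> w \<in> L" if z: "z \<in> L" and w: "w \<in> carrier G" for w z
  proof
    assume "w \<otimes> z \<in> L"
    then have "w \<otimes> z \<otimes> inv z \<in> L" using z subgroup.m_closed[OF L] subgroup.m_inv_closed[OF L] by blast
    then show "w \<in> L" using w Lc[OF z] by (simp add: m_assoc)
  qed (use z subgroup.m_closed[OF L] in blast)
  define \<chi> :: "'a \<Rightarrow> complex" where "\<chi> = (\<lambda>g. if g \<in> L then 1 else 0)"
  \<comment> \<open>The value \<open>\<chi> (u \<otimes> g \<otimes> v)\<close> is the matrix
    coefficient of \<open>g\<close> on G/L between the cosets of \<open>v\<close> and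
    \<open>inv u\<close>, so the formal sum acts as zero there. Quantifying over both
    \<open>u\<close> and \<open>v\<close> makes the condition stable under translations on either
    side.\<close>
  define P where "P = (\<lambda>ps. snd ` set ps \<subseteq> carrier G \<and>
    (\<forall>u\<in>carrier G. \<forall>v\<in>carrier G. lsum (\<lambda>g. \<chi> (u \<otimes> g \<otimes> v)) ps = 0))"
  define J where "J = {lop G ps | ps. P ps}"
  have JI: "lop G ps \<in> J" if "P ps" for ps using that unfolding J_def by blast
  have JE: "\<exists>ps. S = lop G ps \<and> P ps" if "S \<in> J" for S using that unfolding J_def by blast
  have Pc: "snd ` set ps \<subseteq> carrier G" if "P ps" for ps using that by (simp add: P_def)
  define I where "I = norm_closure G J"
  have ideal: "closed_ideal G (reduced_cstar G) I" unfolding I_def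
  proof (rule closed_ideal_norm_closure)
    show "J \<subseteq> group_algebra_ops G" unfolding group_algebra_ops_lop J_def using Pc by blast
    have "P []" by (simp add: P_def)
    then show "op_zero \<in> J" using JI lop_Nil by metis
  next
    fix S T assume "S \<in> J" "T \<in> J"
    then obtain ps qs where *: "S = lop G ps" "T = lop G qs" "P ps" "P qs" using JE by blast
    then have "P (ps @ qs)" by (auto simp: P_def)
    then show "op_add S T \<in> J" using JI lop_append * by metis
  next
    fix c S assume "S \<in> J"
    then obtain ps where *: "S = lop G ps" "P ps" using JE by blast
    then have "P (map (\<lambda>p. (c * fst p, snd p)) ps)"
      by (simp add: P_def image_image lsum_scale)
    then show "op_scale c S \<in> J" using JI lop_scale * by metis
  next
    fix g S assume "S \<in> J" and g: "g \<in> carrier G"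
    then obtain ps where *: "S = lop G ps" "P ps" using JE by blast
    have "lsum (\<lambda>x. \<chi> (u \<otimes> (x \<otimes> g) \<otimes> v)) ps = 0" if uv: "u \<in> carrier G" "v \<in> carrier G" for u v
    proof -
      have "lsum (\<lambda>x. \<chi> (u \<otimes> (x \<otimes> g) \<otimes> v)) ps = lsum (\<lambda>x. \<chi> (u \<otimes> x \<otimes> (g \<otimes> v))) ps"
        using uv g Pc[OF *(2)] by (intro lsum_cong) (simp add: m_assoc subset_iff)
      then show ?thesis using *(2) uv g by (simp add: P_def)
    qed
    then have "P (map (\<lambda>p. (fst p, snd p \<otimes> g)) ps)"
      using Pc[OF *(2)] g unfolding P_def lsum_map[where h = "\<lambda>x. x \<otimes> g"] by auto
    then show "S \<circ> left_reg G g \<in> J" using JI lop_comp_left_reg[OF g Pc[OF *(2)]] * by simp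
    have "lsum (\<lambda>x. \<chi> (u \<otimes> (g \<otimes> x) \<otimes> v)) ps = 0" if uv: "u \<in> carrier G" "v \<in> carrier G" for u v
    proof -
      have "lsum (\<lambda>x. \<chi> (u \<otimes> (g \<otimes> x) \<otimes> v)) ps = lsum (\<lambda>x. \<chi> ((u \<otimes> g) \<otimes> x \<otimes> v)) ps"
        using uv g Pc[OF *(2)] by (intro lsum_cong) (simp add: m_assoc subset_iff)
      then show ?thesis using *(2) uv g by (simp add: P_def)
    qed
    then have "P (map (\<lambda>p. (fst p, g \<otimes> snd p)) ps)"
      using Pc[OF *(2)] g unfolding P_def lsum_map[where h = "\<lambda>x. g \<otimes> x"] by auto
    then show "left_reg G g \<circ> S \<in> J" using JI left_reg_comp_lop[OF g Pc[OF *(2)]] * by simp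
  qed
  \<comment> \<open>The expansion of \<open>(1 - h)(1 - k)\<close>.\<close>
  define qs :: "(complex \<times> 'a) list" where "qs = [(1, \<one>), (-1, h), (-1, k), (1, h \<otimes> k)]"
  have qsc: "snd ` set qs \<subseteq> carrier G" using hc kc by (simp add: qs_def)
  have "P qs" unfolding P_def
  proof (intro conjI ballI qsc)
    fix u v assume uv: "u \<in> carrier G" "v \<in> carrier G"
    have cong: "\<chi> (u \<otimes> (g \<otimes> z) \<otimes> v) = \<chi> (u \<otimes> g \<otimes> v)"
      if g: "g \<in> carrier G" and z: "z \<in> carrier G" "inv v \<otimes> z \<otimes> v \<in> L" for g z
    proof -
      have "u \<otimes> (g \<otimes> z) \<otimes> v = (u \<otimes> g \<otimes> v) \<otimes> (inv v \<otimes> z \<otimes> v)"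
        using uv g z by (simp add: m_assoc cancel_inv)
      then show ?thesis using absorb[OF z(2), of "u \<otimes> g \<otimes> v"] uv g by (simp add: \<chi>_def)
    qed
    from fixer_conj_germ_stabiliser[OF a uv(2)]
    show "lsum (\<lambda>g. \<chi> (u \<otimes> g \<otimes> v)) qs = 0"
    proof
      assume *: "\<forall>z\<in>fixer 0. inv v \<otimes> z \<otimes> v \<in> germ_stabiliser a j"
      \<comment> \<open>Here \<open>h\<close> is invisible at the coset of \<open>v\<close>, but in
        the product it stands to the left of \<open>k\<close>. As \<open>k\<close> lies in
        \<open>H\<close>, which normalises this stabiliser, \<open>h\<close> can be moved past
        \<open>k\<close>.\<close>
      have "k \<in> Tw 0 0" using k fixer_H by simp
      then have hk: "inv k \<otimes> h \<otimes> k \<in> fixer 0" by (rule fixer_conj[OF _ _ h(1)]) simp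
      have "h \<otimes> k = k \<otimes> (inv k \<otimes> h \<otimes> k)" using hc kc by (simp add: m_assoc cancel_inv)
      then have "\<chi> (u \<otimes> (h \<otimes> k) \<otimes> v) = \<chi> (u \<otimes> k \<otimes> v)"
        using cong[OF kc, of "inv k \<otimes> h \<otimes> k"] hk * hc kc by (simp add: L_def)
      moreover have "\<chi> (u \<otimes> h \<otimes> v) = \<chi> (u \<otimes> \<one> \<otimes> v)"
        using cong[OF one_closed hc] h * hc by (simp add: L_def)
      ultimately show ?thesis by (simp add: qs_def)
    next
      assume *: "\<forall>z\<in>fixer 1. inv v \<otimes> z \<otimes> v \<in> germ_stabiliser a j"
      have "\<chi> (u \<otimes> (h \<otimes> k) \<otimes> v) = \<chi> (u \<otimes> h \<otimes> v)"
        using cong[OF hc kc] k * by (simp add: L_def)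
      moreover have "\<chi> (u \<otimes> k \<otimes> v) = \<chi> (u \<otimes> \<one> \<otimes> v)"
        using cong[OF one_closed kc] k * kc by (simp add: L_def)
      ultimately show ?thesis by (simp add: qs_def)
    qed
  qed
  then have qI: "lop G qs \<in> I" unfolding I_def by (intro subset_norm_closure JI bounded_op_lop qsc)
  have "lop G qs \<noteq> op_zero"
  proof
    assume eq: "lop G qs = op_zero"
    define f :: "'a \<Rightarrow> complex" where "f = (\<lambda>x. if x \<in> {\<one>} then 1 else 0)"
    have f: "f \<in> l2 G" unfolding f_def by (rule l2_indicator) auto
    have "inv h \<noteq> \<one>" "inv k \<noteq> \<one>" using h k hc kc by (simp_all add: inv_eq_1_iff)
    \<comment> \<open>The terms of \<open>h\<close> and \<open>k\<close> vanish at the identity.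
      That of \<open>h \<otimes> k\<close> contributes 1 if \<open>k\<close> is the inverse of
      \<open>h\<close> and 0 otherwise, so the value is 2 or 1.\<close>
    then have "lop G qs f \<one> = 1 + f (inv (h \<otimes> k))"
      using hc kc f by (simp add: lop_def qs_def left_reg_apply f_def)
    moreover have "1 + f (inv (h \<otimes> k)) \<noteq> 0" by (simp add: f_def)
    ultimately show False using eq by (simp add: op_zero_def)
  qed
  then have I1: "I \<noteq> {op_zero}" using qI by blast
  have "left_reg G \<one> \<notin> I"
  proof
    assume "left_reg G \<one> \<in> I"
    then obtain A where A: "A \<in> J" "opnorm G (op_diff (left_reg G \<one>) A) < 1"
      unfolding I_def norm_closure_def using zero_less_one by blast
    obtain ps where ps: "A = lop G ps" "P ps" using JE[OF A(1)] by blast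
    \<comment> \<open>The identity minus the approximant: its coefficient at the trivial coset is 1,
      although its operator norm is below 1.\<close>
    define rs where "rs = (1, \<one>) # map (\<lambda>p. (- 1 * fst p, snd p)) ps"
    have rsc: "snd ` set rs \<subseteq> carrier G" using Pc[OF ps(2)] by (auto simp: rs_def)
    have "lop G rs = op_diff (left_reg G \<one>) A"
      unfolding rs_def lop_Cons lop_scale op_diff_conv ps(1) by (simp add: op_scale_def)
    then have lt: "opnorm G (lop G rs) < 1" using A(2) by simp
    have "lsum \<chi> ps = lsum (\<lambda>g. \<chi> (\<one> \<otimes> g \<otimes> \<one>)) ps"
      using Pc[OF ps(2)] by (intro lsum_cong) (simp add: subset_iff)
    then have "lsum \<chi> ps = 0" using ps(2) by (simp add: P_def)
    then have one: "lsum \<chi> rs = 1"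
      using subgroup.one_closed[OF L] lsum_scale[of \<chi> "-1" ps] by (simp add: rs_def \<chi>_def)
    have "\<forall>g \<in> snd ` set rs. \<exists>n::nat. g \<in> L \<longrightarrow> inv (a [^] n) \<otimes> g \<otimes> (a [^] n) \<in> fixer j"
      unfolding L_def germ_stabiliser_def by blast
    then obtain n :: "'a \<Rightarrow> nat" where
      n: "\<And>g. g \<in> snd ` set rs \<Longrightarrow> g \<in> L \<Longrightarrow> inv (a [^] n g) \<otimes> g \<otimes> (a [^] n g) \<in> fixer j" by metis
    \<comment> \<open>The sum dominates every exponent needed, so on the finite support of
      \<open>rs\<close> membership in \<open>L\<close> agrees with membership in one conjugate of
      \<open>fixer j\<close>, to which \<open>amenable_lsum_bound\<close> applies.\<close>
    define m where "m = (\<Sum>g\<in>snd ` set rs. n g)"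
    have iff: "g \<in> L \<longleftrightarrow> inv (a [^] m) \<otimes> g \<otimes> (a [^] m) \<in> fixer j" if g: "g \<in> snd ` set rs" for g
    proof
      assume gL: "g \<in> L"
      have "n g \<le> m" unfolding m_def using g by (intro member_le_sum) auto
      then show "inv (a [^] m) \<otimes> g \<otimes> (a [^] m) \<in> fixer j"
        by (rule germ_stabiliser_mono[OF a Lc[OF gL] n[OF g gL]])
    next
      assume "inv (a [^] m) \<otimes> g \<otimes> (a [^] m) \<in> fixer j"
      then show "g \<in> L" using g rsc unfolding L_def germ_stabiliser_def by blast
    qed
    have "lsum \<chi> rs = lsum (\<lambda>g. if inv (a [^] m) \<otimes> g \<otimes> (a [^] m) \<in> fixer j then 1 else 0) rs"
      by (rule lsum_cong) (simp only: \<chi>_def iff)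
    then have "cmod (lsum \<chi> rs) \<le> opnorm G (lop G rs)"
      using amenable_lsum_bound[OF fixer_subgroup am _ rsc, of "a [^] m"] ac by simp
    then show False using one lt by simp
  qed
  then have I2: "I \<noteq> reduced_cstar G" using left_reg_reduced_cstar[OF one_closed] by blast
  show ?thesis using ideal I1 I2 unfolding cstar_simple_def by blast
qed

text \<open>Conjugation by a letter of factor \<open>i\<close> embeds the stabiliser of side
  \<open>i\<close> into that of the other side, since a translate of the other side lies inside side
  \<open>i\<close>.\<close>

lemma fixer_trivial_Suc:
  assumes nd: "nondegenerate G G0 G1 H" and K: "fixer (Suc i) = {\<one>}"
  shows "fixer i = {\<one>}"
proof -
  obtain x where x: "x \<in> factor i - H" using nondegenerateD(1)[OF nd] by blast
  have xc: "x \<in> carrier G" using x factor_carrier by blast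
  have "z = \<one>" if z: "z \<in> fixer i" for z
  proof -
    have zc: "z \<in> carrier G" using z by (simp add: fixer_def)
    have "inv x \<otimes> z \<otimes> x \<in> fixer (Suc i)" using fixer_conj[OF Tw_one[OF x] _ z] by simp
    then have "inv x \<otimes> z \<otimes> x = \<one>" using K by simp
    then have "x \<otimes> (inv x \<otimes> z \<otimes> x) \<otimes> inv x = \<one>" using xc by simp
    then show ?thesis using xc zc by (simp add: m_assoc cancel_inv)
  qed
  moreover have "\<one> \<in> fixer i" using subgroup.one_closed[OF fixer_subgroup] .
  ultimately show ?thesis by blast
qed

end

theorem theorem5p9:
  fixes G :: "('a, 'b) monoid_scheme" and G0 G1 H :: "'a set"
  assumes "is_amalgam G G0 G1 H"
    and "nondegenerate G G0 G1 H"
    and "amenable_subgroup G (K_set G G0 G1 H 0) \<or> amenable_subgroup G (K_set G G0 G1 H 1)"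
  shows "cstar_simple G \<longleftrightarrow>
           K_set G G0 G1 H 0 = {\<one>\<^bsub>G\<^esub>} \<and> K_set G G0 G1 H 1 = {\<one>\<^bsub>G\<^esub>}"
proof -
  interpret amalgam G G0 G1 H by unfold_locales (rule assms(1))
  note nd = assms(2)
  show ?thesis unfolding K_set_eq
  proof
    assume simple: "cstar_simple G"
    show "fixer 0 = {\<one>\<^bsub>G\<^esub>} \<and> fixer 1 = {\<one>\<^bsub>G\<^esub>}"
    proof (rule ccontr)
      assume "\<not> ?thesis"
      moreover have "fixer 1 = {\<one>\<^bsub>G\<^esub>} \<Longrightarrow> fixer 0 = {\<one>\<^bsub>G\<^esub>}" using fixer_trivial_Suc[OF nd, of 0] by simp
      \<comment> \<open>Stepping down from index 2, which by parity stands for index 0.\<close>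
      moreover have "fixer 0 = {\<one>\<^bsub>G\<^esub>} \<Longrightarrow> fixer 1 = {\<one>\<^bsub>G\<^esub>}"
        using fixer_trivial_Suc[OF nd, of 1] fixer_cong[of 0 "Suc 1"] by simp
      ultimately have "fixer 0 \<noteq> {\<one>\<^bsub>G\<^esub>}" "fixer 1 \<noteq> {\<one>\<^bsub>G\<^esub>}" by auto
      then obtain h k where "h \<in> fixer 0" "h \<noteq> \<one>\<^bsub>G\<^esub>" "k \<in> fixer 1" "k \<noteq> \<one>\<^bsub>G\<^esub>"
        using subgroup.one_closed[OF fixer_subgroup] by blast
      moreover obtain j where "amenable_subgroup G (fixer j)" using assms(3) unfolding K_set_eq by blast
      ultimately show False using nontrivial_amenable_kernels_not_cstar_simple[OF nd] simple by blast
    qed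
  next
    assume "fixer 0 = {\<one>\<^bsub>G\<^esub>} \<and> fixer 1 = {\<one>\<^bsub>G\<^esub>}"
    then show "cstar_simple G" using trivial_kernels_cstar_simple[OF nd] by blast
  qed
qed

end
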